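(* Let $$A=\begin{bmatrix} a_1&a_2&\cdots&a_n\\ b_1&b_2&\cdots&b_n\end{bmatrix}\in\mathbb{N}^{2\times n},\qquad a_1\le a_2\le\cdots\le a_n,$$ and let $\sigma\in S_n$ be a permutation for which $b_{\sigma(1)}\le b_{\sigma(2)}\le\cdots\le b_{\sigma(n)}$. Let $\alpha$ be the largest $0\le j\le n$ such that $b_j\ne b_n$, and let $\beta$ be the largest $0\le j\le n$ such that $a_{\sigma(j)}\neq a_{\sigma(n)}$, with the convention $a_0=b_0=a_{\sigma(0)}=b_{\sigma(0)}=0$. If $A$ has rank $2$, then the degree of the tensor product Chebyshev surface $\mathcal{X}_{A,\otimes}\subset\mathbb{C}^n$ is at most $$\frac14\Big(2\operatorname{vol}(P_B)-4\,b_n(a_n-a_\alpha)-4\,a_{\sigma(n)}(b_{\sigma(n)}-b_{\sigma(\beta)})\Big).$$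
   Context: The Chebyshev polynomials of the first kind are defined by $T_0(t)=1$, $T_1(t)=t$, $T_{k+1}(t)=2t\,T_k(t)-T_{k-1}(t)$. The variety $\mathcal{X}_{A,\otimes}\subset\mathbb{C}^n$ is the Zariski closure of the image of the map $\mathbb{C}^2\to\mathbb{C}^n$, $(t_1,t_2)\mapsto(T_{a_1}(t_1)T_{b_1}(t_2),\ldots,T_{a_n}(t_1)T_{b_n}(t_2))$. The degree of a $d$-dimensional affine variety in $\mathbb{C}^n$ is the number of its intersection points with a generic affine-linear space of dimension $n-d$. The polygon $P_B\subset\mathbb{R}^2$ is the convex hull of the union over $j=1,\ldots,n$ of the sets $\{-a_j,a_j\}\times\{-b_j,b_j\}$, and $\operatorname{vol}$ is the Euclidean area. *)

theory Defs
  imports "HOL-Analysis.Analysis" "HOL-Combinatorics.Permutations"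
begin

section \<open>Affine varieties in coordinates\<close>

text \<open>
  Complex affine space with coordinates indexed by \<open>I\<close>. Points are extensional functions
  (with the value \<open>undefined\<close> outside \<open>I\<close>), so that equality of points is equality of
  coordinates and counting points is meaningful.
\<close>

definition affine_space :: "'i set \<Rightarrow> ('i \<Rightarrow> complex) set" where
  "affine_space I = (I \<rightarrow>\<^sub>E UNIV)"

inductive_set poly_funs :: "'i set \<Rightarrow> (('i \<Rightarrow> complex) \<Rightarrow> complex) set"
  for I :: "'i set"
where
  const: "(\<lambda>x. c) \<in> poly_funs I"
| coord: "i \<in> I \<Longrightarrow> (\<lambda>x. x i) \<in> poly_funs I"
| add: "f \<in> poly_funs I \<Longrightarrow> g \<in> poly_funs I \<Longrightarrow> (\<lambda>x. f x + g x) \<in> poly_funs I"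
| mult: "f \<in> poly_funs I \<Longrightarrow> g \<in> poly_funs I \<Longrightarrow> (\<lambda>x. f x * g x) \<in> poly_funs I"

definition zariski_closed :: "'i set \<Rightarrow> ('i \<Rightarrow> complex) set \<Rightarrow> bool" where
  "zariski_closed I V \<longleftrightarrow>
     (\<exists>F \<subseteq> poly_funs I. V = {x \<in> affine_space I. \<forall>f\<in>F. f x = 0})"

definition zariski_closure :: "'i set \<Rightarrow> ('i \<Rightarrow> complex) set \<Rightarrow> ('i \<Rightarrow> complex) set" where
  "zariski_closure I S = zariski_closed I hull S"

definition irreducible_closed :: "'i set \<Rightarrow> ('i \<Rightarrow> complex) set \<Rightarrow> bool" where
  "irreducible_closed I Z \<longleftrightarrow> zariski_closed I Z \<and> Z \<noteq> {} \<and>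
     (\<forall>Z1 Z2. zariski_closed I Z1 \<longrightarrow> zariski_closed I Z2 \<longrightarrow> Z = Z1 \<union> Z2 \<longrightarrow> Z = Z1 \<or> Z = Z2)"

text \<open>
  Krull dimension: the largest \<open>d\<close> admitting a chain \<open>Z 0 \<subset> \<dots> \<subset> Z d\<close> of irreducible closed
  subsets of \<open>V\<close>. For finite \<open>I\<close> the lengths are bounded by the cardinality of \<open>I\<close>.
\<close>

definition variety_dim :: "'i set \<Rightarrow> ('i \<Rightarrow> complex) set \<Rightarrow> nat" where
  "variety_dim I V = Sup {d. \<exists>Z. (\<forall>k\<le>d. irreducible_closed I (Z k) \<and> Z k \<subseteq> V) \<and>
                                 (\<forall>k<d. Z k \<subset> Z (Suc k))}"

text \<open>
  The affine-linear subspace of \<open>n\<close>-space cut out by the \<open>d\<close> equations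
  \<open>p (i,1) x\<^sub>1 + \<dots> + p (i,n) x\<^sub>n = p (i,0)\<close>. It has dimension \<open>n - d\<close> when the
  coefficient matrix has rank \<open>d\<close>; for \<open>d \<le> n\<close> this holds on a nonempty Zariski-open set
  of parameters \<open>p\<close>.
\<close>

definition linear_section :: "nat \<Rightarrow> nat \<Rightarrow> (nat \<times> nat \<Rightarrow> complex) \<Rightarrow> (nat \<Rightarrow> complex) set" where
  "linear_section n d p =
     {x \<in> affine_space {1..n}. \<forall>i\<in>{1..d}. (\<Sum>j=1..n. p (i, j) * x j) = p (i, 0)}"

text \<open>
  \<open>k\<close> is the number of points of \<open>V\<close> on a generic affine-linear subspace of codimension \<open>d\<close>:
  it is attained for all parameters outside a proper closed subset of the parameter space.
  Since that space is irreducible, there is at most one such \<open>k\<close>.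
\<close>

definition generic_section_count :: "nat \<Rightarrow> nat \<Rightarrow> (nat \<Rightarrow> complex) set \<Rightarrow> nat \<Rightarrow> bool" where
  "generic_section_count n d V k \<longleftrightarrow>
     (\<exists>W. zariski_closed ({1..d} \<times> {0..n}) W \<and> W \<noteq> affine_space ({1..d} \<times> {0..n}) \<and>
        (\<forall>p \<in> affine_space ({1..d} \<times> {0..n}) - W.
           finite (V \<inter> linear_section n d p) \<and> card (V \<inter> linear_section n d p) = k))"

definition variety_degree :: "nat \<Rightarrow> (nat \<Rightarrow> complex) set \<Rightarrow> nat" where
  "variety_degree n V = (THE k. generic_section_count n (variety_dim {1..n} V) V k)"

section \<open>Tensor product Chebyshev surfaces\<close>

fun chebyshev_T :: "nat \<Rightarrow> complex \<Rightarrow> complex" where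
  "chebyshev_T 0 t = 1"
| "chebyshev_T (Suc 0) t = t"
| "chebyshev_T (Suc (Suc k)) t = 2 * t * chebyshev_T (Suc k) t - chebyshev_T k t"

text \<open>
  The matrix \<open>A\<close> is given by its rows \<open>a\<close> and \<open>b\<close>, with columns indexed by \<open>{1..n}\<close>.
\<close>

definition chebyshev_surface :: "nat \<Rightarrow> (nat \<Rightarrow> nat) \<Rightarrow> (nat \<Rightarrow> nat) \<Rightarrow> (nat \<Rightarrow> complex) set" where
  "chebyshev_surface n a b = zariski_closure {1..n}
     (range (\<lambda>(t1, t2). \<lambda>j\<in>{1..n}. chebyshev_T (a j) t1 * chebyshev_T (b j) t2))"

definition matrix_rank :: "nat \<Rightarrow> (nat \<Rightarrow> nat) \<Rightarrow> (nat \<Rightarrow> nat) \<Rightarrow> nat" where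
  "matrix_rank n a b = dim ((\<lambda>j. (real (a j), real (b j))) ` {1..n})"

definition polygon_B :: "nat \<Rightarrow> (nat \<Rightarrow> nat) \<Rightarrow> (nat \<Rightarrow> nat) \<Rightarrow> (real \<times> real) set" where
  "polygon_B n a b =
     convex hull (\<Union>j\<in>{1..n}. {- real (a j), real (a j)} \<times> {- real (b j), real (b j)})"

end

theory Submission
  imports Defs "HOL-Computational_Algebra.Fundamental_Theorem_Algebra"
begin

text \<open>
  The degree of a surface \<open>X\<close> is read off from the growth of its coordinate ring: if generic linear
  sections of \<open>X\<close> have \<open>k\<close> points, then the polynomial functions of degree at most \<open>m\<close> restricted
  to \<open>X\<close> span a space of dimension at least about \<open>k * m\<^sup>2 / 2\<close> (\<open>separated_points_growth\<close>). On the
  Chebyshev surface these functions are polynomials in \<open>t\<^sub>1\<close> and \<open>t\<^sub>2\<close>, namely combinations of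
  products of at most \<open>m\<close> coordinates \<open>T\<^bsub>a j\<^esub>(t\<^sub>1) * T\<^bsub>b j\<^esub>(t\<^sub>2)\<close>, and the dimension is at most the number
  of monomials that occur as lexicographically leading monomials.

  Three conditions restrict a leading monomial \<open>t\<^sub>1 ^ i * t\<^sub>2 ^ j\<close>. It lies in the dilated polygon
  \<open>m P\<^sub>B\<close>. Next, a factor of degree above \<open>a \<alpha>\<close> in \<open>t\<^sub>1\<close> comes from a column \<open>j\<close> with \<open>j > \<alpha>\<close>, hence is
  divisible by \<open>T\<^bsub>b n\<^esub>(t\<^sub>2)\<close>, and its degree exceeds \<open>a \<alpha>\<close> by at most \<open>\<delta> = a n - a \<alpha>\<close>; so the coefficient
  of \<open>t\<^sub>1 ^ i\<close> is divisible by the power of \<open>T\<^bsub>b n\<^esub>(t\<^sub>2)\<close> with exponent at least \<open>(i - m * a \<alpha>) / \<delta>\<close>, rounded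
  down, and \<open>j\<close> is at least \<open>b n\<close> times that exponent (for \<open>\<delta> = 0\<close>, nothing is claimed). The third
  condition is the same one with the two variables exchanged (\<open>leading_monomial\<close>). After division by \<open>m\<close>, the second and the third
  condition each cut a triangle from the quarter of \<open>P\<^sub>B\<close> in the positive quadrant, of areas
  \<open>b n * (a n - a \<alpha>) / 2\<close> and \<open>a (\<sigma> n) * (b (\<sigma> n) - b (\<sigma> \<beta>)) / 2\<close>. The triangles are disjoint
  (\<open>triangles_disjoint\<close>), and comparing the growth with the remaining area
  (\<open>quadratic_growth_le_area\<close>, \<open>area_admissible_region\<close>) gives the bound.

  The degree is defined as the number of points that is attained generically, so the argument
  also has to show that such a number exists. Since \<open>X\<close> is cut out by finitely many equations
  (\<open>zariski_closed_finite\<close>), the existence of \<open>k\<close> points on a linear section, told apart by an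
  auxiliary linear form, is a constructible condition on the parameters (\<open>constructible_exists\<close>),
  and a constructible condition holds generically or fails generically (\<open>constructible_generically\<close>). The largest \<open>k\<close> for which it holds generically
  is the degree (\<open>variety_degree_le\<close>). Finally, the codimension of the sections is the Krull
  dimension of \<open>X\<close>; it is \<open>2\<close> because a chain of irreducible closed sets produces algebraically
  independent functions (\<open>alg_independent_chain\<close>), whereas any three polynomials in two variables are
  dependent (\<open>three_bivariate_dependent\<close>).
\<close>

section \<open>Polynomial functions\<close>

lemma poly_funs_cong:
  assumes "f \<in> poly_funs I" and "\<And>i. i \<in> I \<Longrightarrow> x i = y i"
  shows "f x = f y"
  using assms(1)
proof (induct f rule: poly_funs.induct)
  case (coord i)
  show ?case by (rule assms(2)[OF coord])
next
  case (add f g)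
  show ?case unfolding add(2) add(4) ..
next
  case (mult f g)
  show ?case unfolding mult(2) mult(4) ..
qed (rule refl)

lemma poly_funs_restrict: "f \<in> poly_funs I \<Longrightarrow> f (restrict x I) = f x"
  by (rule poly_funs_cong[of f I]) auto

lemma poly_funs_subst:
  assumes "f \<in> poly_funs I" and "\<And>i. i \<in> I \<Longrightarrow> (\<lambda>x. g x i) \<in> poly_funs J"
  shows "(\<lambda>x. f (g x)) \<in> poly_funs J"
  using assms(1)
proof (induct f rule: poly_funs.induct)
  case (const c)
  show ?case by (rule poly_funs.const)
next
  case (coord i)
  show ?case by (rule assms(2)[OF coord])
next
  case (add f g)
  show ?case by (rule poly_funs.add[OF add(2) add(4)])
next
  case (mult f g)
  show ?case by (rule poly_funs.mult[OF mult(2) mult(4)])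
qed

lemma poly_funs_mono: "f \<in> poly_funs I \<Longrightarrow> I \<subseteq> J \<Longrightarrow> f \<in> poly_funs J"
  by (rule poly_funs_subst[where f=f and I=I and g="\<lambda>x. x"]) (auto intro: poly_funs.coord)

lemma poly_funs_uminus: "f \<in> poly_funs I \<Longrightarrow> (\<lambda>x. - f x) \<in> poly_funs I"
  using poly_funs.mult[OF poly_funs.const[of "-1"], of f I] by simp

lemma poly_funs_diff: "f \<in> poly_funs I \<Longrightarrow> g \<in> poly_funs I \<Longrightarrow> (\<lambda>x. f x - g x) \<in> poly_funs I"
  using poly_funs.add[OF _ poly_funs_uminus, of f I g] by simp

lemma poly_funs_sum: "(\<And>s. s \<in> S \<Longrightarrow> f s \<in> poly_funs I) \<Longrightarrow> (\<lambda>x. \<Sum>s\<in>S. f s x) \<in> poly_funs I"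
  by (induction S rule: infinite_finite_induct) (auto intro: poly_funs.intros)

lemma poly_funs_prod: "(\<And>s. s \<in> S \<Longrightarrow> f s \<in> poly_funs I) \<Longrightarrow> (\<lambda>x. \<Prod>s\<in>S. f s x) \<in> poly_funs I"
  by (induction S rule: infinite_finite_induct) (auto intro: poly_funs.intros)

lemma poly_funs_power: "f \<in> poly_funs I \<Longrightarrow> (\<lambda>x. f x ^ k) \<in> poly_funs I"
  by (induction k) (auto intro: poly_funs.intros)

lemma poly_funs_along_curve:
  assumes "f \<in> poly_funs I" and "\<And>i. i \<in> I \<Longrightarrow> \<exists>q. \<forall>z. h z i = poly q z"
  shows "\<exists>q. \<forall>z. f (h z) = poly q (z :: complex)"
  using assms(1)
proof (induct f rule: poly_funs.induct)
  case (const c)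
  show ?case by (rule exI[of _ "[:c:]"]) simp
next
  case (coord i)
  show ?case by (rule assms(2)[OF coord])
next
  case (add f g)
  from add(2,4) obtain p q where "\<forall>z. f (h z) = poly p z" "\<forall>z. g (h z) = poly q z" by blast
  then show ?case by (intro exI[of _ "p + q"]) simp
next
  case (mult f g)
  from mult(2,4) obtain p q where "\<forall>z. f (h z) = poly p z" "\<forall>z. g (h z) = poly q z" by blast
  then show ?case by (intro exI[of _ "p * q"]) simp
qed

text \<open>
  Irreducibility of affine space: on the line through a point where \<open>f\<close> does not vanish and one
  where \<open>g\<close> does not vanish, both become nonzero univariate polynomials.
\<close>

lemma poly_funs_mult_nonzero:
  assumes f: "f \<in> poly_funs I" and g: "g \<in> poly_funs I" and x: "f x \<noteq> 0" and y: "g y \<noteq> 0"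
  shows "\<exists>z. f z \<noteq> 0 \<and> g z \<noteq> 0"
proof -
  define l where "l t = (\<lambda>i. x i + t * (y i - x i))" for t :: complex
  have l: "\<exists>q. \<forall>t. l t i = poly q t" for i
    by (rule exI[of _ "[:x i, y i - x i:]"]) (simp add: l_def)
  obtain p where p: "\<And>t. f (l t) = poly p t"
    using poly_funs_along_curve[OF f, of l] l by blast
  obtain q where q: "\<And>t. g (l t) = poly q t"
    using poly_funs_along_curve[OF g, of l] l by blast
  have "l 0 = x" "l 1 = y" by (auto simp: l_def)
  then have "p \<noteq> 0" "q \<noteq> 0" using p[of 0] q[of 1] x y by auto
  then have "p * q \<noteq> 0" by simp
  then obtain t where "poly (p * q) t \<noteq> 0" using poly_all_0_iff_0 by blast
  then have "f (l t) \<noteq> 0 \<and> g (l t) \<noteq> 0" by (simp add: p q)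
  then show ?thesis by blast
qed

text \<open>
  One variable separated from those in \<open>I\<close>. The bound \<open>d\<close> on the degree is strict and uniform in \<open>x\<close>, so
  that arguments by descending degree can end with \<open>d = 0\<close>, the zero polynomial; the actual degree of
  \<open>P x\<close> depends on \<open>x\<close>.
\<close>

definition poly_family :: "'i set \<Rightarrow> nat \<Rightarrow> (('i \<Rightarrow> complex) \<Rightarrow> complex poly) \<Rightarrow> bool" where
  "poly_family I d P \<longleftrightarrow>
     (\<forall>k. (\<lambda>x. coeff (P x) k) \<in> poly_funs I) \<and> (\<forall>x. \<forall>k\<ge>d. coeff (P x) k = 0)"

lemma poly_family_mono: "poly_family I d P \<Longrightarrow> d \<le> e \<Longrightarrow> poly_family I e P"
  by (auto simp: poly_family_def)

lemma poly_family_lower: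
  assumes "poly_family I d P" and "\<And>x. coeff (P x) (d - 1) = 0"
  shows "poly_family I (d - 1) P"
  unfolding poly_family_def
proof (intro conjI allI impI)
  fix x k assume "d - 1 \<le> k"
  then have "k = d - 1 \<or> d \<le> k" by linarith
  then show "coeff (P x) k = 0" using assms by (auto simp: poly_family_def)
qed (use assms(1) in \<open>auto simp: poly_family_def\<close>)

lemma poly_family_add:
  assumes "poly_family I d P" "poly_family I d Q"
  shows "poly_family I d (\<lambda>x. P x + Q x)"
  using assms by (auto simp: poly_family_def intro: poly_funs.add)

lemma poly_family_smult:
  assumes "poly_family I d P" "f \<in> poly_funs I"
  shows "poly_family I d (\<lambda>x. smult (f x) (P x))"
  using assms by (auto simp: poly_family_def intro: poly_funs.mult)

lemma poly_family_diff:
  assumes "poly_family I d P" "poly_family I d Q"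
  shows "poly_family I d (\<lambda>x. P x - Q x)"
  using assms by (auto simp: poly_family_def intro: poly_funs_diff)

lemma poly_family_mult:
  assumes P: "poly_family I d P" and Q: "poly_family I e Q"
  shows "poly_family I (d + e) (\<lambda>x. P x * Q x)"
  unfolding poly_family_def
proof (intro conjI allI impI)
  fix k
  show "(\<lambda>x. coeff (P x * Q x) k) \<in> poly_funs I"
    using P Q unfolding coeff_mult poly_family_def by (intro poly_funs_sum poly_funs.mult) auto
next
  fix x k assume k: "d + e \<le> k"
  show "coeff (P x * Q x) k = 0"
    unfolding coeff_mult
  proof (rule sum.neutral, rule ballI)
    fix i assume "i \<in> {..k}"
    then have "d \<le> i \<or> e \<le> k - i" using k by auto
    then show "coeff (P x) i * coeff (Q x) (k - i) = 0"
      using P Q by (auto simp: poly_family_def)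
  qed
qed

lemma poly_family_power:
  assumes "poly_family I d P"
  shows "\<exists>e. poly_family I e (\<lambda>x. P x ^ k)"
proof (induction k)
  case 0
  have "poly_family I 1 (\<lambda>x. 1)"
    by (auto simp: poly_family_def intro: poly_funs.const)
  then show ?case by auto
next
  case (Suc k)
  then show ?case using poly_family_mult[OF assms] by auto
qed

lemma poly_family_monom_mult:
  assumes "poly_family I d P" "f \<in> poly_funs I"
  shows "poly_family I (k + d) (\<lambda>x. monom (f x) k * P x)"
  unfolding poly_family_def
proof (intro conjI allI impI)
  fix j
  show "(\<lambda>x. coeff (monom (f x) k * P x) j) \<in> poly_funs I"
    using assms by (cases "j < k")
      (auto simp: poly_family_def coeff_monom_mult intro: poly_funs.const poly_funs.mult)
qed (use assms in \<open>auto simp: poly_family_def coeff_monom_mult\<close>)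

lemma poly_family_cong:
  assumes "poly_family I d P" and "\<And>i. i \<in> I \<Longrightarrow> x i = y i"
  shows "P x = P y"
proof (rule poly_eqI)
  fix k
  show "coeff (P x) k = coeff (P y) k"
    using assms unfolding poly_family_def by (intro poly_funs_cong[of "\<lambda>x. coeff (P x) k" I]) auto
qed

lemma poly_family_nonzero_coeff:
  assumes "poly_family I d P" "P x \<noteq> 0"
  shows "\<exists>k<d. coeff (P x) k \<noteq> 0"
  using assms unfolding poly_family_def by (metis leading_coeff_0_iff not_le)

lemma poly_family_zero: "poly_family I 0 P \<Longrightarrow> P x = 0"
  by (simp add: poly_family_def poly_eq_iff)

lemma poly_family_eval:
  assumes "poly_family I d P" "I \<subseteq> J" "f \<in> poly_funs J"
  shows "(\<lambda>x. poly (P x) (f x)) \<in> poly_funs J"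
proof -
  have "poly (P x) z = (\<Sum>k<d. coeff (P x) k * z ^ k)" for x z
  proof -
    have d: "coeff (P x) k = 0" if "k \<ge> d" for k
      using assms(1) that by (auto simp: poly_family_def)
    have "(\<Sum>k\<le>degree (P x). coeff (P x) k * z ^ k) = (\<Sum>k<d. coeff (P x) k * z ^ k)"
      by (rule sum.mono_neutral_cong) (use d in \<open>auto simp: not_less coeff_eq_0\<close>)
    then show ?thesis by (simp add: poly_altdef)
  qed
  moreover have "(\<lambda>x. \<Sum>k<d. coeff (P x) k * f x ^ k) \<in> poly_funs J"
    using assms
    by (intro poly_funs_sum poly_funs.mult poly_funs_power)
      (auto simp: poly_family_def intro: poly_funs_mono)
  ultimately show ?thesis by simp
qed

lemma poly_funs_separate:
  assumes "f \<in> poly_funs (insert i I)"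
  shows "\<exists>d P. poly_family I d P \<and> (\<forall>x. f x = poly (P x) (x i))"
  using assms
proof (induct f rule: poly_funs.induct)
  case (const c)
  show ?case
    by (rule exI[of _ 1], rule exI[of _ "\<lambda>x. [:c:]"])
      (auto simp: poly_family_def coeff_pCons split: nat.splits intro: poly_funs.const)
next
  case (coord j)
  show ?case
  proof (cases "j = i")
    case True
    then show ?thesis
      by (intro exI[of _ 2] exI[of _ "\<lambda>x. [:0, 1:]"])
        (auto simp: poly_family_def coeff_pCons split: nat.splits intro: poly_funs.const)
  next
    case False
    with coord have "j \<in> I" by simp
    then have "(\<lambda>x. coeff [:x j:] k) \<in> poly_funs I" for k
      by (cases k) (auto intro: poly_funs.const poly_funs.coord)
    then show ?thesis
      by (intro exI[of _ 1] exI[of _ "\<lambda>x. [:x j:]"])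
        (auto simp: poly_family_def coeff_pCons split: nat.splits)
  qed
next
  case (add f g)
  then obtain d P e Q where "poly_family I d P" "\<forall>x. f x = poly (P x) (x i)"
    "poly_family I e Q" "\<forall>x. g x = poly (Q x) (x i)" by blast
  then show ?case
    by (intro exI[of _ "max d e"] exI[of _ "\<lambda>x. P x + Q x"])
      (auto intro!: poly_family_add elim: poly_family_mono)
next
  case (mult f g)
  then obtain d P e Q where "poly_family I d P" "\<forall>x. f x = poly (P x) (x i)"
    "poly_family I e Q" "\<forall>x. g x = poly (Q x) (x i)" by blast
  then show ?case
    by (intro exI[of _ "d + e"] exI[of _ "\<lambda>x. P x * Q x"]) (auto intro!: poly_family_mult)
qed

section \<open>Finite generation of ideals of polynomial functions\<close>

text \<open>Summands are added one at a time, so that membership in the ideal comes with an induction rule.\<close>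

inductive_set poly_ideal ::
    "'i set \<Rightarrow> (('i \<Rightarrow> complex) \<Rightarrow> complex) set \<Rightarrow> (('i \<Rightarrow> complex) \<Rightarrow> complex) set"
  for I F
where
  zero: "(\<lambda>x. 0) \<in> poly_ideal I F"
| add_mult: "h \<in> poly_ideal I F \<Longrightarrow> g \<in> poly_funs I \<Longrightarrow> f \<in> F \<Longrightarrow> (\<lambda>x. h x + g x * f x) \<in> poly_ideal I F"

lemma poly_ideal_generator: "f \<in> F \<Longrightarrow> f \<in> poly_ideal I F"
  using poly_ideal.add_mult[OF poly_ideal.zero poly_funs.const[of 1], of f F I] by simp

lemma poly_ideal_add:
  assumes "h \<in> poly_ideal I F" "k \<in> poly_ideal I F"
  shows "(\<lambda>x. h x + k x) \<in> poly_ideal I F"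
  using assms(2)
proof (induct k rule: poly_ideal.induct)
  case zero
  show ?case using assms(1) by simp
next
  case (add_mult k g f)
  show ?case using poly_ideal.add_mult[OF add_mult(2-4)] by (simp add: add.assoc)
qed

lemma poly_ideal_mult:
  assumes "h \<in> poly_ideal I F" "k \<in> poly_funs I"
  shows "(\<lambda>x. k x * h x) \<in> poly_ideal I F"
  using assms(1)
proof (induct h rule: poly_ideal.induct)
  case zero
  show ?case using poly_ideal.zero by simp
next
  case (add_mult h g f)
  show ?case using poly_ideal.add_mult[OF add_mult(2) poly_funs.mult[OF assms(2) add_mult(3)] add_mult(4)]
    by (simp add: algebra_simps)
qed

lemma poly_ideal_sum:
  "(\<And>r. r \<in> R \<Longrightarrow> h r \<in> poly_ideal I F) \<Longrightarrow> (\<lambda>x. \<Sum>r\<in>R. h r x) \<in> poly_ideal I F"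
proof (induction R rule: infinite_finite_induct)
  case (insert r R)
  then show ?case using poly_ideal_add[of "h r" I F "\<lambda>x. \<Sum>r\<in>R. h r x"] by simp
qed (auto intro: poly_ideal.zero)

lemma poly_ideal_trans:
  assumes "h \<in> poly_ideal I F" "F \<subseteq> poly_ideal I G"
  shows "h \<in> poly_ideal I G"
  using assms(1)
proof (induct h rule: poly_ideal.induct)
  case zero
  show ?case by (rule poly_ideal.zero)
next
  case (add_mult h g f)
  show ?case using poly_ideal_add[OF add_mult(2) poly_ideal_mult[OF _ add_mult(3)]] add_mult(4) assms(2)
    by blast
qed

lemma poly_ideal_mono: "F \<subseteq> G \<Longrightarrow> h \<in> poly_ideal I F \<Longrightarrow> h \<in> poly_ideal I G"
  by (erule poly_ideal_trans) (auto intro: poly_ideal_generator)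

lemma poly_ideal_subset:
  assumes "h \<in> poly_ideal I F" "F \<subseteq> poly_funs I"
  shows "h \<in> poly_funs I"
  using assms(1)
proof (induct h rule: poly_ideal.induct)
  case zero
  show ?case by (rule poly_funs.const)
next
  case (add_mult h g f)
  have "f \<in> poly_funs I" using add_mult(4) assms(2) by blast
  then show ?case by (rule poly_funs.add[OF add_mult(2) poly_funs.mult[OF add_mult(3)]])
qed

lemma poly_ideal_vanishes:
  assumes "h \<in> poly_ideal I F" "\<And>f. f \<in> F \<Longrightarrow> f x = 0"
  shows "h x = 0"
  using assms(1)
proof (induct h rule: poly_ideal.induct)
  case (add_mult h g f)
  show ?case unfolding add_mult(2) assms(2)[OF add_mult(4)] by simp
qed (rule refl)

lemma poly_ideal_finite_support:
  assumes "h \<in> poly_ideal I F"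
  shows "\<exists>S. finite S \<and> S \<subseteq> F \<and> h \<in> poly_ideal I S"
  using assms
proof (induct h rule: poly_ideal.induct)
  case zero
  show ?case by (rule exI[of _ "{}"]) (auto intro: poly_ideal.zero)
next
  case (add_mult h g f)
  from add_mult(2) obtain S where S: "finite S" "S \<subseteq> F" "h \<in> poly_ideal I S" by blast
  have "(\<lambda>x. h x + g x * f x) \<in> poly_ideal I (insert f S)"
    using poly_ideal.add_mult[OF poly_ideal_mono[OF _ S(3), of "insert f S"] add_mult(3), of f] by blast
  then show ?case using S add_mult(4) by (intro exI[of _ "insert f S"]) auto
qed

lemma poly_ideal_finite_subset:
  assumes "finite T" "T \<subseteq> poly_ideal I F"
  shows "\<exists>S. finite S \<and> S \<subseteq> F \<and> T \<subseteq> poly_ideal I S"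
  using assms
proof (induction T rule: finite_induct)
  case (insert h T)
  then obtain S where S: "finite S" "S \<subseteq> F" "T \<subseteq> poly_ideal I S" by auto
  have "h \<in> poly_ideal I F" using insert.prems by simp
  from poly_ideal_finite_support[OF this]
  obtain S' where S': "finite S'" "S' \<subseteq> F" "h \<in> poly_ideal I S'" by (elim exE conjE)
  have "poly_ideal I S \<subseteq> poly_ideal I (S \<union> S')" "poly_ideal I S' \<subseteq> poly_ideal I (S \<union> S')"
    by (rule subsetI, rule poly_ideal_mono[rotated], assumption, simp)+
  then have "insert h T \<subseteq> poly_ideal I (S \<union> S')"
    using S S' by auto
  then show ?case using S S' by (intro exI[of _ "S \<union> S'"]) auto
qed auto

text \<open>Collects the summands that belong to the same generator.\<close>

lemma poly_ideal_indexed: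
  assumes "h \<in> poly_ideal I (l ` {..<m::nat})"
  shows "\<exists>g. (\<forall>r<m. g r \<in> poly_funs I) \<and> h = (\<lambda>x. \<Sum>r<m. g r x * l r x)"
  using assms
proof (induct h rule: poly_ideal.induct)
  case zero
  show ?case by (rule exI[of _ "\<lambda>r x. 0"]) (auto intro: poly_funs.const)
next
  case (add_mult h k f)
  from add_mult(2) obtain g where g: "\<forall>r<m. g r \<in> poly_funs I" "h = (\<lambda>x. \<Sum>r<m. g r x * l r x)"
    by blast
  from add_mult(4) obtain s where s: "s < m" "f = l s" by blast
  define g' where "g' = g(s := (\<lambda>x. g s x + k x))"
  have "(\<Sum>r<m. g' r x * l r x) = h x + k x * f x" for x
  proof -
    have "(\<Sum>r<m. g' r x * l r x) = g' s x * l s x + (\<Sum>r\<in>{..<m} - {s}. g' r x * l r x)"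
      using s by (intro sum.remove) auto
    also have "(\<Sum>r\<in>{..<m} - {s}. g' r x * l r x) = (\<Sum>r\<in>{..<m} - {s}. g r x * l r x)"
      by (intro sum.cong) (auto simp: g'_def)
    also have "g' s x * l s x = k x * f x + g s x * l s x"
      by (simp add: g'_def s algebra_simps)
    also have "\<dots> + (\<Sum>r\<in>{..<m} - {s}. g r x * l r x) = k x * f x + (\<Sum>r<m. g r x * l r x)"
      using s by (simp add: sum.remove[of "{..<m}" s])
    finally show ?thesis by (simp add: g(2))
  qed
  moreover have "\<forall>r<m. g' r \<in> poly_funs I"
    using g(1) s add_mult(3) by (auto simp: g'_def intro: poly_funs.add)
  ultimately show ?case by (intro exI[of _ g']) auto
qed

lemma poly_family_sum:
  "finite R \<Longrightarrow> (\<And>r. r \<in> R \<Longrightarrow> poly_family I d (P r)) \<Longrightarrow> poly_family I d (\<lambda>x. \<Sum>r\<in>R. P r x)"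
proof (induction R rule: finite_induct)
  case empty
  show ?case by (auto simp: poly_family_def intro: poly_funs.const)
next
  case (insert r R)
  then show ?case using poly_family_add[of I d "P r" "\<lambda>x. \<Sum>r\<in>R. P r x"] by simp
qed

definition finitely_generated :: "'i set \<Rightarrow> bool" where
  "finitely_generated I \<longleftrightarrow>
     (\<forall>F \<subseteq> poly_funs I. \<exists>S. finite S \<and> S \<subseteq> F \<and> F \<subseteq> poly_ideal I S)"

lemma finitely_generatedD:
  "finitely_generated I \<Longrightarrow> F \<subseteq> poly_funs I \<Longrightarrow>
     \<exists>S. finite S \<and> S \<subseteq> F \<and> F \<subseteq> poly_ideal I S"
  by (simp add: finitely_generated_def)

lemma finitely_generated_sequence:
  assumes "finitely_generated I" "\<And>m. l m \<in> poly_funs I"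
  shows "\<exists>m. l m \<in> poly_ideal I (l ` {..<m::nat})"
proof -
  have "range l \<subseteq> poly_funs I" by (simp add: image_subset_iff assms(2))
  from finitely_generatedD[OF assms(1) this]
  obtain S where S: "finite S" "S \<subseteq> range l" "range l \<subseteq> poly_ideal I S" by (elim exE conjE)
  from finite_subset_image[OF S(1,2)] obtain M where M: "finite M" "S = l ` M" by (elim exE conjE)
  obtain m where "M \<subseteq> {..<m}" using finite_nat_iff_bounded[of M] M(1) by auto
  then have "S \<subseteq> l ` {..<m}" unfolding M(2) by (rule image_mono)
  moreover have "l m \<in> poly_ideal I S" using S(3) by (simp add: image_subset_iff)
  ultimately have "l m \<in> poly_ideal I (l ` {..<m})" by (rule poly_ideal_mono)
  then show ?thesis by (rule exI)
qed

lemma finitely_generated_empty: "finitely_generated ({} :: 'i set)"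
  unfolding finitely_generated_def
proof (intro allI impI)
  fix F :: "(('i \<Rightarrow> complex) \<Rightarrow> complex) set"
  assume F: "F \<subseteq> poly_funs {}"
  have const: "f x = f y" if "f \<in> F" for f x y
    using that F by (intro poly_funs_cong[of f "{}"]) auto
  show "\<exists>S. finite S \<and> S \<subseteq> F \<and> F \<subseteq> poly_ideal {} S"
  proof (cases "\<exists>f\<in>F. \<exists>x. f x \<noteq> 0")
    case True
    then obtain f y where f: "f \<in> F" "f y \<noteq> 0" by blast
    have "g \<in> poly_ideal {} {f}" if "g \<in> F" for g
    proof -
      have "(\<lambda>x. g y / f y * f x) \<in> poly_ideal {} {f}"
        by (intro poly_ideal_mult poly_ideal_generator poly_funs.const) simp
      moreover have "g y / f y * f x = g x" for x
        using const[OF f(1), of x y] const[OF that, of x y] f(2) by simp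
      ultimately show ?thesis by simp
    qed
    then show ?thesis using f by (intro exI[of _ "{f}"]) auto
  next
    case False
    have "f \<in> poly_ideal {} {}" if "f \<in> F" for f
    proof -
      have "f = (\<lambda>x. 0)" using False that by auto
      then show ?thesis by (simp only: poly_ideal.zero)
    qed
    then show ?thesis by (intro exI[of _ "{}"]) auto
  qed
qed

text \<open>
  Hilbert's argument. If an ideal were not finitely generated, one could choose in it functions
  \<open>f 0, f 1, \<dots>\<close>, each outside the ideal of its predecessors and of least possible degree in the new
  variable. Some leading coefficient is a combination of the earlier ones; subtracting the
  corresponding combination of the earlier functions contradicts the choice of the degree.
\<close>

lemma finitely_generated_insert:
  assumes I: "finitely_generated I" and i: "i \<notin> I"
  shows "finitely_generated (insert i I)"
proof (rule ccontr)
  let ?J = "insert i I"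
  assume "\<not> finitely_generated ?J"
  then obtain F where F: "F \<subseteq> poly_funs ?J"
    and "\<not> (\<exists>S. finite S \<and> S \<subseteq> F \<and> F \<subseteq> poly_ideal ?J S)"
    unfolding finitely_generated_def not_all not_imp by (elim exE conjE)
  then have notfg: "\<And>S. finite S \<Longrightarrow> S \<subseteq> F \<Longrightarrow> \<not> F \<subseteq> poly_ideal ?J S" by simp
  define A where "A = poly_ideal ?J F"
  have A: "A \<subseteq> poly_funs ?J" using F poly_ideal_subset by (auto simp: A_def)
  define deg where "deg d f \<longleftrightarrow> (\<exists>P. poly_family I d P \<and> (\<forall>x. f x = poly (P x) (x i)))"
    for d and f :: "('a \<Rightarrow> complex) \<Rightarrow> complex"
  \<comment> \<open>\<open>cand T d\<close>: degree bound \<open>d\<close> is possible for a function of the ideal that \<open>T\<close> does not generate.\<close>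
  define cand where "cand T d \<longleftrightarrow> (\<exists>f. f \<in> A \<and> f \<notin> poly_ideal ?J T \<and> deg d f)" for T d
  have cand: "\<exists>d. cand T d" if T: "finite T" "T \<subseteq> A" for T
  proof -
    have "\<not> A \<subseteq> poly_ideal ?J T"
    proof
      assume sub: "A \<subseteq> poly_ideal ?J T"
      from poly_ideal_finite_subset[OF T(1) T(2)[unfolded A_def]]
      obtain S where S: "finite S" "S \<subseteq> F" "T \<subseteq> poly_ideal ?J S" by (elim exE conjE)
      have "F \<subseteq> poly_ideal ?J S"
      proof
        fix f assume "f \<in> F"
        then have "f \<in> poly_ideal ?J T"
          by (intro subsetD[OF sub[unfolded A_def]] poly_ideal_generator)
        then show "f \<in> poly_ideal ?J S" using S(3) by (rule poly_ideal_trans)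
      qed
      then show False using notfg[OF S(1,2)] by simp
    qed
    then obtain f where f: "f \<in> A" "f \<notin> poly_ideal ?J T" unfolding subset_iff not_all not_imp by (elim exE conjE)
    from poly_funs_separate[OF subsetD[OF A f(1)]] have "\<exists>d. deg d f" unfolding deg_def .
    with f show ?thesis unfolding cand_def by auto
  qed
  define dmin where "dmin T = (LEAST d. cand T d)" for T
  define pick where "pick T = (SOME f. f \<in> A \<and> f \<notin> poly_ideal ?J T \<and> deg (dmin T) f)" for T
  have pick: "pick T \<in> A \<and> pick T \<notin> poly_ideal ?J T \<and> deg (dmin T) (pick T)"
    if "finite T" "T \<subseteq> A" for T
  proof -
    have "cand T (dmin T)" unfolding dmin_def using cand[OF that] by (rule LeastI_ex)
    then show ?thesis unfolding pick_def cand_def by (rule someI_ex)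
  qed
  define S where "S = rec_nat {} (\<lambda>_ T. insert (pick T) T)"
  define f where "f m = pick (S m)" for m :: nat
  define d where "d m = dmin (S m)" for m
  have S_Suc: "S (Suc m) = insert (f m) (S m)" for m by (simp add: S_def f_def)
  have S_eq: "S m = f ` {..<m}" for m
    by (induction m) (simp_all add: S_Suc lessThan_Suc, simp add: S_def)
  have fin: "finite (S m)" for m by (simp add: S_eq)
  have SA: "S m \<subseteq> A" for m
  proof (induction m)
    case 0
    show ?case by (simp add: S_def)
  next
    case (Suc m)
    then show ?case using pick[OF fin Suc.IH] by (simp add: S_Suc f_def)
  qed
  have fA: "f m \<in> A" and fnot: "f m \<notin> poly_ideal ?J (S m)" and fdeg: "deg (d m) (f m)" for m
    using pick[OF fin SA] by (auto simp: f_def d_def)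
  have "\<forall>m. \<exists>P. poly_family I (d m) P \<and> (\<forall>x. f m x = poly (P x) (x i))"
    using fdeg unfolding deg_def by simp
  from choice[OF this] obtain P
    where P: "\<And>m. poly_family I (d m) (P m)" "\<And>m x. f m x = poly (P m x) (x i)" by auto
  have mono: "d r \<le> d m" if "r < m" for r m
  proof -
    have "S r \<subseteq> S m" using that by (auto simp: S_eq)
    then have "f m \<notin> poly_ideal ?J (S r)" using fnot[of m] poly_ideal_mono[of "S r" "S m" "f m" ?J] by auto
    then have "cand (S r) (d m)" using fA fdeg by (auto simp: cand_def)
    then show ?thesis unfolding d_def[of r] dmin_def by (rule Least_le)
  qed
  have pos: "d m > 0" for m
  proof (rule ccontr)
    assume "\<not> d m > 0"
    then have "P m x = 0" for x
      using poly_family_nonzero_coeff[OF P(1), of m x] by auto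
    then have "f m = (\<lambda>x. 0)" using P(2) by auto
    then show False using fnot[of m] by (simp add: poly_ideal.zero)
  qed
  define lc where "lc m = (\<lambda>x. coeff (P m x) (d m - 1))" for m
  have "lc m \<in> poly_funs I" for m using P(1) by (auto simp: lc_def poly_family_def)
  from finitely_generated_sequence[of I lc, OF I this]
  obtain m where "lc m \<in> poly_ideal I (lc ` {..<m})" by (elim exE)
  from poly_ideal_indexed[OF this] obtain g where g: "\<And>r. r < m \<Longrightarrow> g r \<in> poly_funs I"
    and lc: "lc m = (\<lambda>x. \<Sum>r<m. g r x * lc r x)" by auto
  define Q where "Q = (\<lambda>x. \<Sum>r<m. monom (g r x) (d m - d r) * P r x)"
  define q where "q = (\<lambda>x. \<Sum>r<m. (g r x * x i ^ (d m - d r)) * f r x)"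
  have "g r \<in> poly_funs ?J" if "r < m" for r
    using g[OF that] by (rule poly_funs_mono) auto
  then have "q \<in> poly_ideal ?J (S m)" unfolding q_def
    by (intro poly_ideal_sum poly_ideal_mult poly_ideal_generator poly_funs.mult poly_funs_power
        poly_funs.coord) (auto simp: S_eq)
  moreover have "q \<in> A" if "q \<in> poly_ideal ?J (S m)"
    using poly_ideal_trans[OF that, of F] SA by (simp add: A_def)
  moreover define h where "h = (\<lambda>x. f m x + (-1) * q x)"
  ultimately have "h \<in> A" unfolding A_def h_def
    by (intro poly_ideal_add poly_ideal_mult poly_funs.const) (use fA in \<open>auto simp: A_def\<close>)
  have "h \<notin> poly_ideal ?J (S m)"
  proof
    assume "h \<in> poly_ideal ?J (S m)"
    from poly_ideal_add[OF this \<open>q \<in> poly_ideal ?J (S m)\<close>] show False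
      using fnot by (simp add: h_def)
  qed
  have "poly_family I (d m) Q" unfolding Q_def
  proof (rule poly_family_sum)
    fix r assume "r \<in> {..<m}"
    then have "r < m" by simp
    have "poly_family I (d m - d r + d r) (\<lambda>x. monom (g r x) (d m - d r) * P r x)"
      by (rule poly_family_monom_mult[OF P(1) g[OF \<open>r < m\<close>]])
    then show "poly_family I (d m) (\<lambda>x. monom (g r x) (d m - d r) * P r x)"
      using mono[OF \<open>r < m\<close>] by simp
  qed simp
  then have PQ: "poly_family I (d m) (\<lambda>x. P m x - Q x)"
    by (rule poly_family_diff[OF P(1)])
  have "coeff (P m x - Q x) (d m - 1) = 0" for x
  proof -
    have "coeff (monom (g r x) (d m - d r) * P r x) (d m - 1) = g r x * lc r x" if "r < m" for r
      using mono[OF that] pos[of r] by (auto simp: coeff_monom_mult lc_def)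
    then have "coeff (Q x) (d m - 1) = (\<Sum>r<m. g r x * lc r x)"
      by (simp add: Q_def coeff_sum)
    then show ?thesis using fun_cong[OF lc, of x] by (simp add: lc_def)
  qed
  then have "poly_family I (d m - 1) (\<lambda>x. P m x - Q x)"
    by (rule poly_family_lower[OF PQ])
  moreover have "h x = poly (P m x - Q x) (x i)" for x
    by (simp add: h_def q_def Q_def P(2) poly_sum poly_monom mult_ac)
  ultimately have "deg (d m - 1) h" unfolding deg_def by (intro exI[of _ "\<lambda>x. P m x - Q x"]) simp
  then have "cand (S m) (d m - 1)"
    using \<open>h \<in> A\<close> \<open>h \<notin> poly_ideal ?J (S m)\<close> by (auto simp: cand_def)
  then have "d m \<le> d m - 1" unfolding d_def dmin_def by (rule Least_le)
  then show False using pos[of m] by simp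
qed

lemma hilbert_basis: "finite I \<Longrightarrow> finitely_generated I"
  by (induction I rule: finite_induct) (auto intro: finitely_generated_empty finitely_generated_insert)

text \<open>Quantification over the points of a closed set thus becomes a first-order condition.\<close>

lemma zariski_closed_finite:
  assumes "finite I" "zariski_closed I V"
  shows "\<exists>S. finite S \<and> S \<subseteq> poly_funs I \<and> V = {x \<in> affine_space I. \<forall>f\<in>S. f x = 0}"
proof -
  obtain F where F: "F \<subseteq> poly_funs I" "V = {x \<in> affine_space I. \<forall>f\<in>F. f x = 0}"
    using assms(2) by (auto simp: zariski_closed_def)
  from finitely_generatedD[OF hilbert_basis[OF assms(1)] F(1)]
  obtain S where S: "finite S" "S \<subseteq> F" "F \<subseteq> poly_ideal I S" by (elim exE conjE)
  have "f x = 0" if "\<forall>f\<in>S. f x = 0" "f \<in> F" for f x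
    using that S(3) by (intro poly_ideal_vanishes[of f I S]) auto
  then show ?thesis using F S by (intro exI[of _ S]) auto
qed

section \<open>Constructible conditions and generic points\<close>

inductive_set constructible :: "'i set \<Rightarrow> (('i \<Rightarrow> complex) \<Rightarrow> bool) set"
  for I :: "'i set"
where
  zero: "f \<in> poly_funs I \<Longrightarrow> (\<lambda>x. f x = 0) \<in> constructible I"
| neg: "P \<in> constructible I \<Longrightarrow> (\<lambda>x. \<not> P x) \<in> constructible I"
| conj: "P \<in> constructible I \<Longrightarrow> Q \<in> constructible I \<Longrightarrow> (\<lambda>x. P x \<and> Q x) \<in> constructible I"

lemma constructible_nonzero: "f \<in> poly_funs I \<Longrightarrow> (\<lambda>x. f x \<noteq> 0) \<in> constructible I"
  by (rule constructible.neg[OF constructible.zero])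

lemma constructible_disj:
  assumes "P \<in> constructible I" "Q \<in> constructible I"
  shows "(\<lambda>x. P x \<or> Q x) \<in> constructible I"
  using constructible.neg[OF constructible.conj[OF constructible.neg[OF assms(1)] constructible.neg[OF assms(2)]]]
  by simp

lemma constructible_const: "(\<lambda>x. c) \<in> constructible I"
proof (cases c)
  case True
  then show ?thesis using constructible.zero[OF poly_funs.const[of 0 I]] by simp
next
  case False
  then show ?thesis using constructible_nonzero[OF poly_funs.const[of 0 I]] by simp
qed

lemma constructible_ball:
  assumes "finite S" "\<And>s. s \<in> S \<Longrightarrow> P s \<in> constructible I"
  shows "(\<lambda>x. \<forall>s\<in>S. P s x) \<in> constructible I"
  using assms
proof (induction S rule: finite_induct)
  case empty
  show ?case using constructible_const[of True] by simp
next
  case (insert s S)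
  then show ?case using constructible.conj[of "P s" I "\<lambda>x. \<forall>s\<in>S. P s x"] by simp
qed

lemma constructible_bex:
  assumes "finite S" "\<And>s. s \<in> S \<Longrightarrow> P s \<in> constructible I"
  shows "(\<lambda>x. \<exists>s\<in>S. P s x) \<in> constructible I"
proof -
  have "(\<lambda>x. \<forall>s\<in>S. \<not> P s x) \<in> constructible I"
    using constructible_ball[OF assms(1), of "\<lambda>s x. \<not> P s x" I]
      constructible.neg[OF assms(2)] by simp
  from constructible.neg[OF this] show ?thesis by simp
qed

text \<open>Disjunctive normal form, so that a quantifier only has to be removed from basic conditions.\<close>

definition dnf :: "'i set \<Rightarrow> (('i \<Rightarrow> complex) \<Rightarrow> bool) \<Rightarrow> bool" where
  "dnf I P \<longleftrightarrow> (\<exists>C. finite C \<and>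
     (\<forall>c\<in>C. finite (fst c) \<and> fst c \<subseteq> poly_funs I \<and> snd c \<in> poly_funs I) \<and>
     (\<forall>x. P x \<longleftrightarrow> (\<exists>c\<in>C. (\<forall>f\<in>fst c. f x = 0) \<and> snd c x \<noteq> 0)))"

lemma dnf_disj:
  assumes "dnf I P" "dnf I Q"
  shows "dnf I (\<lambda>x. P x \<or> Q x)"
proof -
  from assms(1)[unfolded dnf_def] obtain C where C: "finite C"
    "\<forall>c\<in>C. finite (fst c) \<and> fst c \<subseteq> poly_funs I \<and> snd c \<in> poly_funs I"
    "\<forall>x. P x \<longleftrightarrow> (\<exists>c\<in>C. (\<forall>f\<in>fst c. f x = 0) \<and> snd c x \<noteq> 0)" by (elim exE conjE)
  from assms(2)[unfolded dnf_def] obtain D where D: "finite D"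
    "\<forall>c\<in>D. finite (fst c) \<and> fst c \<subseteq> poly_funs I \<and> snd c \<in> poly_funs I"
    "\<forall>x. Q x \<longleftrightarrow> (\<exists>c\<in>D. (\<forall>f\<in>fst c. f x = 0) \<and> snd c x \<noteq> 0)" by (elim exE conjE)
  show ?thesis unfolding dnf_def
    by (rule exI[of _ "C \<union> D"]) (simp add: ball_Un bex_Un C D)
qed

lemma dnf_conj:
  assumes "dnf I P" "dnf I Q"
  shows "dnf I (\<lambda>x. P x \<and> Q x)"
proof -
  from assms(1)[unfolded dnf_def] obtain C where C: "finite C"
    "\<forall>c\<in>C. finite (fst c) \<and> fst c \<subseteq> poly_funs I \<and> snd c \<in> poly_funs I"
    "\<forall>x. P x \<longleftrightarrow> (\<exists>c\<in>C. (\<forall>f\<in>fst c. f x = 0) \<and> snd c x \<noteq> 0)" by (elim exE conjE)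
  from assms(2)[unfolded dnf_def] obtain D where D: "finite D"
    "\<forall>c\<in>D. finite (fst c) \<and> fst c \<subseteq> poly_funs I \<and> snd c \<in> poly_funs I"
    "\<forall>x. Q x \<longleftrightarrow> (\<exists>c\<in>D. (\<forall>f\<in>fst c. f x = 0) \<and> snd c x \<noteq> 0)" by (elim exE conjE)
  define m where "m c d = (fst c \<union> fst d, \<lambda>x. snd c x * snd d x)"
    for c d :: "(('a \<Rightarrow> complex) \<Rightarrow> complex) set \<times> (('a \<Rightarrow> complex) \<Rightarrow> complex)"
  define E where "E = case_prod m ` (C \<times> D)"
  have E: "(\<forall>e\<in>E. R e) \<longleftrightarrow> (\<forall>c\<in>C. \<forall>d\<in>D. R (m c d))" "(\<exists>e\<in>E. R e) \<longleftrightarrow> (\<exists>c\<in>C. \<exists>d\<in>D. R (m c d))" for R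
    by (auto simp: E_def)
  show ?thesis unfolding dnf_def
  proof (rule exI[of _ E], unfold E, intro conjI ballI allI)
    show "finite E" using C D by (simp add: E_def)
    fix c d assume cd: "c \<in> C" "d \<in> D"
    show "finite (fst (m c d))" "fst (m c d) \<subseteq> poly_funs I"
      using cd C D by (simp_all add: m_def)
    have "snd c \<in> poly_funs I" "snd d \<in> poly_funs I" using cd C D by simp_all
    from poly_funs.mult[OF this] show "snd (m c d) \<in> poly_funs I" by (simp add: m_def)
  next
    fix x
    have bex: "((\<exists>c\<in>C. A c) \<and> (\<exists>d\<in>D. B d)) = (\<exists>c\<in>C. \<exists>d\<in>D. A c \<and> B d)" for A B by blast
    have m: "((\<forall>f\<in>fst (m c d). f x = 0) \<and> snd (m c d) x \<noteq> 0) =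
        (((\<forall>f\<in>fst c. f x = 0) \<and> snd c x \<noteq> 0) \<and> ((\<forall>f\<in>fst d. f x = 0) \<and> snd d x \<noteq> 0))" for c d
      by (auto simp: m_def ball_Un)
    show "(P x \<and> Q x) = (\<exists>c\<in>C. \<exists>d\<in>D. (\<forall>f\<in>fst (m c d). f x = 0) \<and> snd (m c d) x \<noteq> 0)"
      unfolding C(3)[rule_format] D(3)[rule_format] m by (rule bex)
  qed
qed

lemma constructible_dnf:
  assumes "P \<in> constructible I"
  shows "dnf I P \<and> dnf I (\<lambda>x. \<not> P x)"
  using assms
proof (induct P rule: constructible.induct)
  case (zero f)
  show ?case unfolding dnf_def
  proof (intro conjI)
    show "\<exists>C. finite C \<and> (\<forall>c\<in>C. finite (fst c) \<and> fst c \<subseteq> poly_funs I \<and> snd c \<in> poly_funs I) \<and>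
     (\<forall>x. f x = 0 \<longleftrightarrow> (\<exists>c\<in>C. (\<forall>f\<in>fst c. f x = 0) \<and> snd c x \<noteq> 0))"
      by (rule exI[of _ "{({f}, \<lambda>x. 1)}"]) (simp add: zero poly_funs.const)
    show "\<exists>C. finite C \<and> (\<forall>c\<in>C. finite (fst c) \<and> fst c \<subseteq> poly_funs I \<and> snd c \<in> poly_funs I) \<and>
     (\<forall>x. f x \<noteq> 0 \<longleftrightarrow> (\<exists>c\<in>C. (\<forall>f\<in>fst c. f x = 0) \<and> snd c x \<noteq> 0))"
      by (rule exI[of _ "{({}, f)}"]) (simp add: zero)
  qed
next
  case (neg P)
  from neg(2) show ?case by simp
next
  case (conj P Q)
  have "dnf I (\<lambda>x. \<not> P x \<or> \<not> Q x)" "dnf I (\<lambda>x. P x \<and> Q x)"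
    by (rule dnf_disj[OF conj(2)[THEN conjunct2] conj(4)[THEN conjunct2]],
        rule dnf_conj[OF conj(2)[THEN conjunct1] conj(4)[THEN conjunct1]])
  then show ?case unfolding de_Morgan_conj by (rule conjI[rotated])
qed

text \<open>
  Division with remainder by \<open>P x\<close>, where \<open>H x\<close> is first multiplied by the leading coefficient of \<open>P x\<close>
  so that all coefficients remain polynomial functions of \<open>x\<close>.
\<close>

lemma constructible_family_dvd:
  assumes P: "poly_family I d P" "d > 0" and H: "poly_family I e H"
  shows "(\<lambda>x. coeff (P x) (d - 1) \<noteq> 0 \<and> P x dvd H x) \<in> constructible I"
  using H
proof (induction e arbitrary: H)
  case 0
  then have "H x = 0" for x by (rule poly_family_zero)
  moreover have "(\<lambda>x. coeff (P x) (d - 1) \<noteq> 0) \<in> constructible I"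
    using P(1) by (intro constructible_nonzero) (simp add: poly_family_def)
  ultimately show ?case by simp
next
  case (Suc e)
  define l where "l x = coeff (P x) (d - 1)" for x
  have l: "l \<in> poly_funs I" using P(1) by (simp add: poly_family_def l_def[abs_def])
  show ?case
  proof (cases "Suc e < d")
    case True
    have "P x dvd H x \<longleftrightarrow> (\<forall>k\<in>{..<Suc e}. coeff (H x) k = 0)" if "l x \<noteq> 0" for x
    proof
      assume dvd: "P x dvd H x"
      have "H x = 0"
      proof (rule ccontr)
        assume nz: "H x \<noteq> 0"
        have "d - 1 \<le> degree (P x)" using that by (intro le_degree) (simp add: l_def)
        also have "\<dots> \<le> degree (H x)" by (rule dvd_imp_degree_le[OF dvd nz])
        also have "degree (H x) \<le> e"
          using Suc.prems by (intro degree_le) (auto simp: poly_family_def)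
        finally show False using True by simp
      qed
      then show "\<forall>k\<in>{..<Suc e}. coeff (H x) k = 0" by simp
    next
      assume "\<forall>k\<in>{..<Suc e}. coeff (H x) k = 0"
      then have "H x = 0" using poly_family_nonzero_coeff[OF Suc.prems, of x] by auto
      then show "P x dvd H x" by simp
    qed
    then have eq: "(\<lambda>x. coeff (P x) (d - 1) \<noteq> 0 \<and> P x dvd H x) =
        (\<lambda>x. l x \<noteq> 0 \<and> (\<forall>k\<in>{..<Suc e}. coeff (H x) k = 0))"
      by (auto simp: l_def fun_eq_iff)
    have "(\<lambda>x. coeff (H x) k = 0) \<in> constructible I" for k
      using Suc.prems by (intro constructible.zero) (simp add: poly_family_def)
    then have "(\<lambda>x. \<forall>k\<in>{..<Suc e}. coeff (H x) k = 0) \<in> constructible I"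
      by (intro constructible_ball) auto
    from constructible.conj[OF constructible_nonzero[OF l] this] show ?thesis unfolding eq .
  next
    case False
    define H' where "H' x = smult (l x) (H x) - monom (coeff (H x) e) (Suc e - d) * P x" for x
    have c: "(\<lambda>x. coeff (H x) e) \<in> poly_funs I" using Suc.prems by (simp add: poly_family_def)
    have "poly_family I (Suc e - d + d) (\<lambda>x. monom (coeff (H x) e) (Suc e - d) * P x)"
      by (rule poly_family_monom_mult[OF P(1) c])
    then have "poly_family I (Suc e) (\<lambda>x. monom (coeff (H x) e) (Suc e - d) * P x)"
      using False by simp
    from poly_family_diff[OF poly_family_smult[OF Suc.prems l] this]
    have "poly_family I (Suc e) H'" by (simp add: H'_def[abs_def])
    moreover have "coeff (H' x) (Suc e - 1) = 0" for x
      using False P(2) by (simp add: H'_def coeff_monom_mult l_def)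
    ultimately have "poly_family I (Suc e - 1) H'" by (rule poly_family_lower)
    then have "(\<lambda>x. coeff (P x) (d - 1) \<noteq> 0 \<and> P x dvd H' x) \<in> constructible I"
      by (intro Suc.IH) simp
    moreover have "P x dvd H' x \<longleftrightarrow> P x dvd H x" if "l x \<noteq> 0" for x
      using that by (simp add: H'_def dvd_diff_left_iff dvd_smult_iff)
    then have "(\<lambda>x. coeff (P x) (d - 1) \<noteq> 0 \<and> P x dvd H' x) =
        (\<lambda>x. coeff (P x) (d - 1) \<noteq> 0 \<and> P x dvd H x)"
      by (auto simp: l_def fun_eq_iff)
    ultimately show ?thesis by simp
  qed
qed

text \<open>
  Elimination by Euclid's algorithm, with a case distinction on the vanishing of each leading
  coefficient. When a single equation \<open>P = 0\<close> of degree \<open>d\<close> is left next to the inequation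
  \<open>G \<noteq> 0\<close>, it is unsolvable exactly if every root of \<open>P\<close> is a root of \<open>G\<close>, that is, if \<open>P\<close>
  divides \<open>G ^ d\<close>.
\<close>

lemma constructible_eliminate:
  assumes "\<And>d P. (d, P) \<in> set L \<Longrightarrow> poly_family I d P" and G: "poly_family I e G"
  shows "(\<lambda>x. \<exists>z. (\<forall>p\<in>set L. poly (snd p x) z = 0) \<and> poly (G x) z \<noteq> 0) \<in> constructible I"
  using assms(1)
proof (induction "sum_list (map (\<lambda>p. Suc (fst p)) L)" arbitrary: L rule: less_induct)
  case less
  define E where "E L x \<longleftrightarrow> (\<exists>z. (\<forall>p\<in>set L. poly (snd p x) z = 0) \<and> poly (G x) z \<noteq> 0)"
    for L :: "(nat \<times> (('a \<Rightarrow> complex) \<Rightarrow> complex poly)) list" and x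
  have IH: "E M \<in> constructible I"
    if "sum_list (map (\<lambda>p. Suc (fst p)) M) < sum_list (map (\<lambda>p. Suc (fst p)) L)"
      "\<forall>p\<in>set M. poly_family I (fst p) (snd p)" for M
    using less.hyps[OF that(1)] that(2) unfolding E_def[abs_def] by (metis fst_conv snd_conv)
  have fam: "\<forall>p\<in>set L. poly_family I (fst p) (snd p)" using less.prems by auto
  have branch: "E L \<in> constructible I"
    if "l \<in> poly_funs I" "E M \<in> constructible I" "Q \<in> constructible I"
      "\<And>x. l x = 0 \<Longrightarrow> E L x = E M x" "\<And>x. l x \<noteq> 0 \<Longrightarrow> E L x = Q x" for l M Q
  proof -
    have "E L = (\<lambda>x. l x = 0 \<and> E M x \<or> l x \<noteq> 0 \<and> Q x)" using that(4,5) by (auto simp: fun_eq_iff)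
    then show ?thesis
      using constructible_disj[OF constructible.conj[OF constructible.zero[OF that(1)] that(2)]
          constructible.conj[OF constructible_nonzero[OF that(1)] that(3)]] by simp
  qed
  define lc where "lc p x = coeff (snd p x) (fst p - 1)"
    for p :: "nat \<times> (('a \<Rightarrow> complex) \<Rightarrow> complex poly)" and x
  \<comment> \<open>\<open>cut p\<close> agrees with \<open>p\<close> wherever the leading coefficient \<open>lc p\<close> vanishes, and has a smaller bound.\<close>
  define cut where "cut p = (fst p - 1, \<lambda>x. snd p x - monom (lc p x) (fst p - 1))"
    for p :: "nat \<times> (('a \<Rightarrow> complex) \<Rightarrow> complex poly)"
  have lc: "lc p \<in> poly_funs I" if "p \<in> set L" for p
    using fam that by (simp add: poly_family_def lc_def[abs_def])
  have cut: "poly_family I (fst (cut p)) (snd (cut p))" if p: "p \<in> set L" for p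
  proof -
    have 1: "poly_family I 1 (\<lambda>x. 1)" by (auto simp: poly_family_def intro: poly_funs.const)
    show ?thesis
    proof (cases "fst p = 0")
      case True
      then have "snd p x = 0" for x
        using poly_family_zero[of I "snd p" x] fam p by auto
      then show ?thesis by (simp add: cut_def lc_def poly_family_def poly_funs.const)
    next
      case False
      have "poly_family I (fst p) (\<lambda>x. monom (lc p x) (fst p - 1))"
        using poly_family_monom_mult[OF 1 lc[OF p], of "fst p - 1"] False by simp
      from poly_family_diff[OF _ this] have "poly_family I (fst p) (snd (cut p))"
        using fam p by (simp add: cut_def)
      then have "poly_family I (fst p - 1) (snd (cut p))"
        by (rule poly_family_lower) (simp add: cut_def lc_def)
      then show ?thesis by (simp add: cut_def)
    qed
  qed
  have cut_eq: "snd (cut p) x = snd p x" if "lc p x = 0" for p x using that by (simp add: cut_def)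
  have main: "E L \<in> constructible I"
  proof (cases "\<exists>p\<in>set L. fst p = 0")
    case True
    then obtain p L1 L2 where p: "fst p = 0" "L = L1 @ p # L2" by (metis split_list)
    have "snd p x = 0" for x
      using poly_family_zero[of I "snd p" x] fam p by auto
    then have "E L = E (L1 @ L2)" by (simp add: E_def fun_eq_iff p(2) ball_Un)
    then show ?thesis using IH[of "L1 @ L2"] fam p by simp
  next
    case False
    consider "L = []" | p where "L = [p]" | p q M where "L = p # q # M"
      by (metis list.exhaust)
    then show ?thesis
    proof cases
      case 1
      have "E L x \<longleftrightarrow> (\<exists>k\<in>{..<e}. coeff (G x) k \<noteq> 0)" for x
        using poly_family_nonzero_coeff[OF G, of x] poly_all_0_iff_0[of "G x"]
        by (auto simp: E_def 1)
      then have eq: "E L = (\<lambda>x. \<exists>k\<in>{..<e}. coeff (G x) k \<noteq> 0)" by (simp add: fun_eq_iff)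
      show ?thesis unfolding eq
        using G by (intro constructible_bex constructible_nonzero) (simp_all add: poly_family_def)
    next
      case (2 p)
      let ?d = "fst p"
      have d: "?d > 0" and p: "p \<in> set L" using False 2 by auto
      obtain e' where Gpow: "poly_family I e' (\<lambda>x. G x ^ (?d - 1))"
        using poly_family_power[OF G, of "?d - 1"] by (elim exE)
      have "(\<lambda>x. coeff (snd p x) (?d - 1) \<noteq> 0 \<and> snd p x dvd G x ^ (?d - 1)) \<in> constructible I"
        using fam p d Gpow by (intro constructible_family_dvd) auto
      from constructible.neg[OF this]
      have Q: "(\<lambda>x. \<not> (lc p x \<noteq> 0 \<and> snd p x dvd G x ^ (?d - 1))) \<in> constructible I"
        unfolding lc_def .
      have M: "E [cut p] \<in> constructible I"
        by (rule IH) (use 2 d cut[OF p] in \<open>auto simp: cut_def\<close>)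
      have degr: "degree (snd p x) = ?d - 1" if "lc p x \<noteq> 0" for x
      proof (rule antisym)
        show "degree (snd p x) \<le> ?d - 1"
          using fam p by (intro degree_le) (auto simp: poly_family_def)
        show "?d - 1 \<le> degree (snd p x)" using that by (intro le_degree) (simp add: lc_def)
      qed
      show ?thesis
      proof (rule branch[OF lc[OF p] M Q])
        fix x assume "lc p x = 0"
        then show "E L x = E [cut p] x" by (simp add: E_def 2 cut_eq)
      next
        fix x assume nz: "lc p x \<noteq> 0"
        then have "snd p x \<noteq> 0" by (auto simp: lc_def)
        then show "E L x = (\<not> (lc p x \<noteq> 0 \<and> snd p x dvd G x ^ (?d - 1)))"
          using nullstellensatz_univariate[of "snd p x" "G x"] nz degr[OF nz]
          by (auto simp: E_def 2)
      qed
    next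
      case (3 p0 q0 M)
      obtain p q where pq: "set L = insert p (insert q (set M))" "fst q \<le> fst p"
        "sum_list (map (\<lambda>p. Suc (fst p)) L) = fst p + fst q + sum_list (map (\<lambda>p. Suc (fst p)) M) + 2"
      proof (cases "fst q0 \<le> fst p0")
        case True
        then show ?thesis using that[of p0 q0] 3 by simp
      next
        case False
        then show ?thesis using that[of q0 p0] 3 by (simp add: insert_commute)
      qed
      have p: "p \<in> set L" and q: "q \<in> set L" and MM: "\<forall>p\<in>set M. poly_family I (fst p) (snd p)"
        using pq fam by auto
      have d: "fst p > 0" "fst q > 0" using False p q by auto
      \<comment> \<open>one division step, which lowers the larger of the two degree bounds\<close>
      define r where "r = (fst p - 1, \<lambda>x. smult (lc q x) (snd p x) -
        monom (lc p x) (fst p - fst q) * snd q x)"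
      have "poly_family I (fst p - fst q + fst q) (\<lambda>x. monom (lc p x) (fst p - fst q) * snd q x)"
        using fam q by (intro poly_family_monom_mult lc p) auto
      then have "poly_family I (fst p) (\<lambda>x. monom (lc p x) (fst p - fst q) * snd q x)"
        using pq(2) by simp
      from poly_family_diff[OF poly_family_smult[OF _ lc[OF q]] this]
      have "poly_family I (fst p) (snd r)" using fam p by (simp add: r_def)
      moreover have "fst p - Suc 0 - (fst p - fst q) = fst q - Suc 0" "\<not> fst p - Suc 0 < fst p - fst q"
        using pq(2) d by auto
      then have "coeff (snd r x) (fst p - 1) = 0" for x
        by (simp add: r_def coeff_monom_mult lc_def)
      ultimately have "poly_family I (fst p - 1) (snd r)" by (rule poly_family_lower)
      then have r: "poly_family I (fst r) (snd r)" by (simp add: r_def)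
      have M1: "E (p # cut q # M) \<in> constructible I"
        by (rule IH) (use pq(3) d fam p cut[OF q] MM in \<open>auto simp: cut_def\<close>)
      have M2: "E (r # q # M) \<in> constructible I"
        by (rule IH) (use pq(3) d fam q r MM in \<open>auto simp: r_def\<close>)
      show ?thesis
      proof (rule branch[OF lc[OF q] M1 M2])
        fix x assume "lc q x = 0"
        then show "E L x = E (p # cut q # M) x" by (simp add: E_def pq(1) cut_eq)
      next
        fix x assume nz: "lc q x \<noteq> 0"
        then have "poly (snd q x) z = 0 \<Longrightarrow> poly (snd r x) z = 0 \<longleftrightarrow> poly (snd p x) z = 0" for z
          by (simp add: r_def)
        then show "E L x = E (r # q # M) x" unfolding E_def pq(1) by (intro ex_cong1) auto
      qed
    qed
  qed
  then show ?case unfolding E_def[abs_def] .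
qed

text \<open>Chevalley's theorem: elimination is applied to each disjunct of the normal form.\<close>

lemma constructible_exists:
  assumes "P \<in> constructible (insert i I)" "i \<notin> I"
  shows "(\<lambda>x. \<exists>z. P (x(i := z))) \<in> constructible I"
proof -
  from constructible_dnf[OF assms(1), THEN conjunct1, unfolded dnf_def] obtain C where C: "finite C"
    "\<forall>c\<in>C. finite (fst c) \<and> fst c \<subseteq> poly_funs (insert i I) \<and> snd c \<in> poly_funs (insert i I)"
    "\<forall>x. P x \<longleftrightarrow> (\<exists>c\<in>C. (\<forall>f\<in>fst c. f x = 0) \<and> snd c x \<noteq> 0)" by (elim exE conjE)
  have one: "(\<lambda>x. \<exists>z. (\<forall>f\<in>fst c. f (x(i := z)) = 0) \<and> snd c (x(i := z)) \<noteq> 0) \<in> constructible I"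
    if "c \<in> C" for c
  proof -
    have sep: "\<exists>p. poly_family I (fst p) (snd p) \<and> (\<forall>x z. f (x(i := z)) = poly (snd p x) z)"
      if f: "f \<in> poly_funs (insert i I)" for f
    proof -
      from poly_funs_separate[OF f] obtain d Q
        where Q: "poly_family I d Q" "\<forall>x. f x = poly (Q x) (x i)" by (elim exE conjE)
      have "Q (x(i := z)) = Q x" for x z
        by (rule poly_family_cong[OF Q(1)]) (use assms(2) in auto)
      then show ?thesis using Q by (intro exI[of _ "(d, Q)"]) simp
    qed
    obtain s where s: "\<forall>f\<in>poly_funs (insert i I). poly_family I (fst (s f)) (snd (s f)) \<and>
        (\<forall>x z. f (x(i := z)) = poly (snd (s f) x) z)"
      using bchoice[of "poly_funs (insert i I)"] sep by (metis (no_types, lifting))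
    have fin: "finite (fst c)" and sub: "\<forall>f\<in>fst c. f \<in> poly_funs (insert i I)"
      and g: "snd c \<in> poly_funs (insert i I)" using C(2) that by auto
    obtain L where L: "set L = fst c" using finite_list[OF fin] by (elim exE)
    have "(\<lambda>x. \<exists>z. (\<forall>p\<in>set (map s L). poly (snd p x) z = 0) \<and> poly (snd (s (snd c)) x) z \<noteq> 0)
        \<in> constructible I"
    proof (rule constructible_eliminate)
      show "poly_family I (fst (s (snd c))) (snd (s (snd c)))" using s g by simp
      fix d Q assume "(d, Q) \<in> set (map s L)"
      then obtain f where "f \<in> fst c" "(d, Q) = s f" using L by auto
      then show "poly_family I d Q" using s sub by (metis fst_conv snd_conv)
    qed
    moreover have "(\<exists>z. (\<forall>p\<in>set (map s L). poly (snd p x) z = 0) \<and> poly (snd (s (snd c)) x) z \<noteq> 0)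
      \<longleftrightarrow> (\<exists>z. (\<forall>f\<in>fst c. f (x(i := z)) = 0) \<and> snd c (x(i := z)) \<noteq> 0)" for x
      using s g sub by (simp add: L)
    ultimately show ?thesis by simp
  qed
  have "(\<lambda>x. \<exists>c\<in>C. \<exists>z. (\<forall>f\<in>fst c. f (x(i := z)) = 0) \<and> snd c (x(i := z)) \<noteq> 0) \<in> constructible I"
    by (rule constructible_bex[OF C(1) one])
  moreover have "(\<exists>z. P (x(i := z))) \<longleftrightarrow>
      (\<exists>c\<in>C. \<exists>z. (\<forall>f\<in>fst c. f (x(i := z)) = 0) \<and> snd c (x(i := z)) \<noteq> 0)" for x
    unfolding C(3)[rule_format] by (simp only: bex_simps(6)[symmetric] ex_comm) fast
  ultimately show ?thesis by simp
qed

lemma constructible_exists_many: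
  assumes "finite K" "P \<in> constructible (I \<union> K)" "I \<inter> K = {}"
  shows "(\<lambda>x. \<exists>y. P (override_on x y K)) \<in> constructible I"
  using assms
proof (induction K arbitrary: P rule: finite_induct)
  case empty
  then show ?case by simp
next
  case (insert k K)
  have "(\<lambda>x. \<exists>z. P (x(k := z))) \<in> constructible (I \<union> K)"
    using insert.prems insert.hyps by (intro constructible_exists) auto
  moreover have "I \<inter> K = {}" using insert.prems by auto
  ultimately have "(\<lambda>x. \<exists>y z. P ((override_on x y K)(k := z))) \<in> constructible I"
    by (rule insert.IH)
  moreover have "(\<exists>y z. P ((override_on x y K)(k := z))) \<longleftrightarrow> (\<exists>y. P (override_on x y (insert k K)))" for x
  proof
    assume "\<exists>y z. P ((override_on x y K)(k := z))"
    then obtain y z where "P ((override_on x y K)(k := z))" by (elim exE)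
    moreover have "(override_on x y K)(k := z) = override_on x (y(k := z)) (insert k K)"
      using insert.hyps by (auto simp: override_on_def)
    ultimately show "\<exists>y. P (override_on x y (insert k K))" by auto
  next
    assume "\<exists>y. P (override_on x y (insert k K))"
    then obtain y where "P (override_on x y (insert k K))" by (elim exE)
    moreover have "(override_on x y K)(k := y k) = override_on x y (insert k K)"
      by (auto simp: override_on_def)
    ultimately show "\<exists>y z. P ((override_on x y K)(k := z))" by metis
  qed
  ultimately show ?case by simp
qed

definition generically :: "'i set \<Rightarrow> (('i \<Rightarrow> complex) \<Rightarrow> bool) \<Rightarrow> bool" where
  "generically I P \<longleftrightarrow> (\<exists>w\<in>poly_funs I. (\<exists>x. w x \<noteq> 0) \<and> (\<forall>x. w x \<noteq> 0 \<longrightarrow> P x))"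

lemma genericallyI:
  assumes "w \<in> poly_funs I" "w x \<noteq> 0" "\<And>x. w x \<noteq> 0 \<Longrightarrow> P x"
  shows "generically I P"
proof -
  have "(\<exists>x. w x \<noteq> 0) \<and> (\<forall>x. w x \<noteq> 0 \<longrightarrow> P x)"
    by (rule conjI[OF exI[of _ x]]) (use assms in simp_all)
  then show ?thesis unfolding generically_def by (rule bexI[of _ w]) (rule assms(1))
qed

lemma genericallyD:
  "generically I P \<Longrightarrow> \<exists>w x. w \<in> poly_funs I \<and> w x \<noteq> 0 \<and> (\<forall>x. w x \<noteq> 0 \<longrightarrow> P x)"
  unfolding generically_def Bex_def by simp

lemma generically_conj:
  assumes "generically I P" "generically I Q"
  shows "generically I (\<lambda>x. P x \<and> Q x)"
proof -
  from genericallyD[OF assms(1)]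
  obtain v y where v: "v \<in> poly_funs I" "v y \<noteq> 0" "\<forall>x. v x \<noteq> 0 \<longrightarrow> P x" by (elim exE conjE)
  from genericallyD[OF assms(2)]
  obtain w z where w: "w \<in> poly_funs I" "w z \<noteq> 0" "\<forall>x. w x \<noteq> 0 \<longrightarrow> Q x" by (elim exE conjE)
  obtain u where "v u \<noteq> 0 \<and> w u \<noteq> 0" using poly_funs_mult_nonzero[of v I w y z] v w by auto
  then show ?thesis
    by (intro genericallyI[OF poly_funs.mult[OF v(1) w(1)], of u]) (simp_all add: v(3) w(3))
qed

lemma generically_mono:
  assumes "generically I P" "\<And>x. P x \<Longrightarrow> Q x"
  shows "generically I Q"
proof -
  from genericallyD[OF assms(1)]
  obtain w x where w: "w \<in> poly_funs I" "w x \<noteq> 0" "\<forall>x. w x \<noteq> 0 \<longrightarrow> P x" by (elim exE conjE)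
  show ?thesis by (rule genericallyI[of w I x]) (simp_all add: assms(2) w)
qed

lemma generically_ex: "generically I P \<Longrightarrow> \<exists>x. P x"
  by (drule genericallyD, elim exE conjE) auto

lemma generically_const: "c \<Longrightarrow> generically I (\<lambda>x. c)"
  by (rule genericallyI[OF poly_funs.const[of 1]]) simp_all

text \<open>
  For a conjunction of two conditions that both hold generically, this needs that nonempty Zariski open
  sets meet, which is the irreducibility of affine space.
\<close>

lemma constructible_generically:
  assumes "P \<in> constructible I"
  shows "generically I P \<or> generically I (\<lambda>x. \<not> P x)"
  using assms
proof (induct P rule: constructible.induct)
  case (zero f)
  show ?case
  proof (cases "\<forall>x. f x = 0")
    case True
    then have "generically I (\<lambda>x. f x = 0)"
      by (intro generically_mono[OF generically_const[of True I]]) simp_all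
    then show ?thesis ..
  next
    case False
    then obtain y where "f y \<noteq> 0" by auto
    then have "generically I (\<lambda>x. f x \<noteq> 0)" by (intro genericallyI[OF zero, of y])
    then show ?thesis by (rule disjI2)
  qed
next
  case (neg P)
  from neg(2) show ?case by auto
next
  case (conj P Q)
  from conj(2) show ?case
  proof
    assume P: "generically I P"
    from conj(4) show ?thesis
    proof
      assume "generically I Q"
      from generically_conj[OF P this] show ?thesis ..
    next
      assume "generically I (\<lambda>x. \<not> Q x)"
      then have "generically I (\<lambda>x. \<not> (P x \<and> Q x))" by (rule generically_mono) simp
      then show ?thesis ..
    qed
  next
    assume "generically I (\<lambda>x. \<not> P x)"
    then have "generically I (\<lambda>x. \<not> (P x \<and> Q x))" by (rule generically_mono) simp
    then show ?thesis ..
  qed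
qed

section \<open>Irreducible closed sets and dimension\<close>

lemma zariski_closure_eq:
  assumes "S \<subseteq> affine_space I"
  shows "zariski_closure I S =
    {x \<in> affine_space I. \<forall>f\<in>{f \<in> poly_funs I. \<forall>s\<in>S. f s = 0}. f x = 0}"
  unfolding zariski_closure_def
proof (rule hull_unique)
  show "zariski_closed I {x \<in> affine_space I. \<forall>f\<in>{f \<in> poly_funs I. \<forall>s\<in>S. f s = 0}. f x = 0}"
    unfolding zariski_closed_def
    by (rule exI[of _ "{f \<in> poly_funs I. \<forall>s\<in>S. f s = 0}"]) (simp add: subset_iff)
  show "S \<subseteq> {x \<in> affine_space I. \<forall>f\<in>{f \<in> poly_funs I. \<forall>s\<in>S. f s = 0}. f x = 0}"
    using assms by (simp add: subset_iff)
  fix T assume T: "S \<subseteq> T" "zariski_closed I T"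
  from T(2) obtain F where F: "F \<subseteq> poly_funs I" "T = {x \<in> affine_space I. \<forall>f\<in>F. f x = 0}"
    unfolding zariski_closed_def by (elim exE conjE)
  have "f \<in> {f \<in> poly_funs I. \<forall>s\<in>S. f s = 0}" if "f \<in> F" for f
    using that F T(1) by (simp add: subset_iff)
  then show "{x \<in> affine_space I. \<forall>f\<in>{f \<in> poly_funs I. \<forall>s\<in>S. f s = 0}. f x = 0} \<subseteq> T"
    unfolding F(2) by (intro subsetI CollectI conjI ballI) simp_all
qed

lemma zariski_closure_vanishes:
  assumes "S \<subseteq> affine_space I" "f \<in> poly_funs I" "\<And>s. s \<in> S \<Longrightarrow> f s = 0" "x \<in> zariski_closure I S"
  shows "f x = 0"
  using assms(4) unfolding zariski_closure_eq[OF assms(1)] using assms(2,3) by simp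

lemma zariski_closed_closure: "S \<subseteq> affine_space I \<Longrightarrow> zariski_closed I (zariski_closure I S)"
  unfolding zariski_closure_eq zariski_closed_def
  by (rule exI[of _ "{f \<in> poly_funs I. \<forall>s\<in>S. f s = 0}"]) (simp add: subset_iff)

lemma zariski_closure_superset: "S \<subseteq> zariski_closure I S"
  unfolding zariski_closure_def by (rule hull_subset)

lemma zariski_closure_minimal: "S \<subseteq> T \<Longrightarrow> zariski_closed I T \<Longrightarrow> zariski_closure I S \<subseteq> T"
  unfolding zariski_closure_def by (rule hull_minimal)

lemma zariski_closed_zeros:
  assumes "zariski_closed I Z" "f \<in> poly_funs I"
  shows "zariski_closed I {x \<in> Z. f x = 0}"
proof -
  from assms(1) obtain F where F: "F \<subseteq> poly_funs I" "Z = {x \<in> affine_space I. \<forall>f\<in>F. f x = 0}"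
    unfolding zariski_closed_def by (elim exE conjE)
  show ?thesis unfolding zariski_closed_def
    by (rule exI[of _ "insert f F"]) (use F assms(2) in auto)
qed

lemma zariski_closed_separate:
  assumes "zariski_closed I Z" "x \<in> affine_space I" "x \<notin> Z"
  shows "\<exists>f. f \<in> poly_funs I \<and> (\<forall>z\<in>Z. f z = 0) \<and> f x \<noteq> 0"
proof -
  from assms(1) obtain F where F: "F \<subseteq> poly_funs I" "Z = {x \<in> affine_space I. \<forall>f\<in>F. f x = 0}"
    unfolding zariski_closed_def by (elim exE conjE)
  from assms F(2) obtain f where f: "f \<in> F" "f x \<noteq> 0" by auto
  have "f \<in> poly_funs I" using f F(1) by (simp add: subset_iff)
  moreover have "\<forall>z\<in>Z. f z = 0" using F(2) f by simp
  ultimately show ?thesis using f(2) by (intro exI[of _ f]) simp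
qed

lemma zariski_closed_affine: "zariski_closed I Z \<Longrightarrow> Z \<subseteq> affine_space I"
  unfolding zariski_closed_def by auto

lemma irreducible_closed_mult:
  assumes "irreducible_closed I Z" and f: "f \<in> poly_funs I" and g: "g \<in> poly_funs I"
    and fg: "\<And>x. x \<in> Z \<Longrightarrow> f x * g x = 0"
  shows "(\<forall>x\<in>Z. f x = 0) \<or> (\<forall>x\<in>Z. g x = 0)"
proof -
  have Z: "zariski_closed I Z" using assms(1) by (simp add: irreducible_closed_def)
  have eq: "Z = {x \<in> Z. f x = 0} \<union> {x \<in> Z. g x = 0}" using fg by auto
  have split: "Z = Z1 \<or> Z = Z2" if "zariski_closed I Z1" "zariski_closed I Z2" "Z = Z1 \<union> Z2" for Z1 Z2
    using assms(1) that unfolding irreducible_closed_def by blast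
  have "Z = {x \<in> Z. f x = 0} \<or> Z = {x \<in> Z. g x = 0}"
    by (rule split[OF zariski_closed_zeros[OF Z f] zariski_closed_zeros[OF Z g] eq])
  then show ?thesis by auto
qed

text \<open>
  If the closure were the union of two smaller closed sets, there would be a function vanishing on
  each of them but not on the whole image, and the product of the two would pull back to \<open>0\<close>.
\<close>

lemma irreducible_closure_image:
  assumes \<psi>: "range \<psi> \<subseteq> affine_space I"
    and dom: "\<And>f g. f \<in> poly_funs I \<Longrightarrow> g \<in> poly_funs I \<Longrightarrow> (\<And>t. f (\<psi> t) * g (\<psi> t) = 0) \<Longrightarrow>
      (\<forall>t. f (\<psi> t) = 0) \<or> (\<forall>t. g (\<psi> t) = 0)"
  shows "irreducible_closed I (zariski_closure I (range \<psi>))"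
  unfolding irreducible_closed_def
proof (intro conjI allI impI)
  let ?X = "zariski_closure I (range \<psi>)"
  show "zariski_closed I ?X" by (rule zariski_closed_closure[OF \<psi>])
  show "?X \<noteq> {}" using zariski_closure_superset[of "range \<psi>" I] by auto
  fix Z1 Z2 assume Z: "zariski_closed I Z1" "zariski_closed I Z2" "?X = Z1 \<union> Z2"
  show "?X = Z1 \<or> ?X = Z2"
  proof (rule ccontr)
    assume "\<not> (?X = Z1 \<or> ?X = Z2)"
    then have "\<not> ?X \<subseteq> Z1" "\<not> ?X \<subseteq> Z2" using Z(3) by auto
    then have "\<not> range \<psi> \<subseteq> Z1" "\<not> range \<psi> \<subseteq> Z2" using zariski_closure_minimal Z by metis+
    then obtain s t where st: "\<psi> s \<notin> Z1" "\<psi> t \<notin> Z2" by auto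
    have "\<psi> s \<in> affine_space I" "\<psi> t \<in> affine_space I" using \<psi> by auto
    from zariski_closed_separate[OF Z(1) this(1) st(1)] zariski_closed_separate[OF Z(2) this(2) st(2)]
    obtain f g where f: "f \<in> poly_funs I" "\<forall>z\<in>Z1. f z = 0" "f (\<psi> s) \<noteq> 0"
      and g: "g \<in> poly_funs I" "\<forall>z\<in>Z2. g z = 0" "g (\<psi> t) \<noteq> 0" by (elim exE conjE)
    have "f (\<psi> r) * g (\<psi> r) = 0" for r
    proof -
      have "\<psi> r \<in> Z1 \<union> Z2" using Z(3) zariski_closure_superset[of "range \<psi>" I] by auto
      then show ?thesis using f(2) g(2) by auto
    qed
    from dom[OF f(1) g(1) this] f(3) g(3) show False by auto
  qed
qed

lemma irreducible_closed_singleton: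
  assumes "x \<in> affine_space I"
  shows "irreducible_closed I {x}"
proof -
  have "(\<lambda>y. y i - x i) \<in> poly_funs I" if "i \<in> I" for i
    by (intro poly_funs_diff poly_funs.coord poly_funs.const that)
  then have "zariski_closed I {y \<in> affine_space I. \<forall>f\<in>(\<lambda>i y. y i - x i) ` I. f y = 0}"
    unfolding zariski_closed_def
    by (intro exI[of _ "(\<lambda>i y. y i - x i) ` I"] conjI refl) (simp add: image_subset_iff)
  also have "{y \<in> affine_space I. \<forall>f\<in>(\<lambda>i y. y i - x i) ` I. f y = 0} = {x}"
    using assms by (auto simp: affine_space_def intro: PiE_ext)
  finally show ?thesis by (simp add: irreducible_closed_def singleton_Un_iff)
qed

text \<open>
  Chains of irreducible sets are bounded by transcendence degrees. A relation is a polynomial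
  function \<open>Q\<close> of the variables \<open>0, \<dots>, k - 1\<close>, which stand for the values of \<open>h 0, \<dots>, h (k - 1)\<close>.
\<close>

definition alg_independent ::
    "'i set \<Rightarrow> ('i \<Rightarrow> complex) set \<Rightarrow> nat \<Rightarrow> (nat \<Rightarrow> ('i \<Rightarrow> complex) \<Rightarrow> complex) \<Rightarrow> bool" where
  "alg_independent I Z k h \<longleftrightarrow> (\<forall>r<k. h r \<in> poly_funs I) \<and>
     (\<forall>Q \<in> poly_funs {..<k}. (\<forall>x\<in>Z. Q (\<lambda>r. h r x) = 0) \<longrightarrow> (\<forall>y. Q y = 0))"

text \<open>
  Passing to a larger irreducible set raises the transcendence degree: a function \<open>g\<close> that vanishes
  on \<open>Z\<close> but not on \<open>Z'\<close> can be added. In a relation between \<open>g\<close> and the \<open>h r\<close> on \<open>Z'\<close>, the part free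
  of \<open>g\<close> is a relation between the \<open>h r\<close> on \<open>Z\<close>, hence trivial; so \<open>g\<close> can be cancelled.
\<close>

lemma alg_independent_extend:
  assumes ind: "alg_independent I Z k h" and Z': "irreducible_closed I Z'" "Z \<subseteq> Z'"
    and g: "g \<in> poly_funs I" "\<And>z. z \<in> Z \<Longrightarrow> g z = 0" "x0 \<in> Z'" "g x0 \<noteq> 0"
  shows "alg_independent I Z' (Suc k) (h(k := g))"
proof -
  have h: "h r \<in> poly_funs I" if "r < k" for r using ind that by (simp add: alg_independent_def)
  have rel: "Q y = 0" if "Q \<in> poly_funs {..<k}" "\<And>x. x \<in> Z \<Longrightarrow> Q (\<lambda>r. h r x) = 0" for Q y
  proof -
    have "\<forall>Q\<in>poly_funs {..<k}. (\<forall>x\<in>Z. Q (\<lambda>r. h r x) = 0) \<longrightarrow> (\<forall>y. Q y = 0)"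
      using ind by (simp add: alg_independent_def)
    from bspec[OF this that(1)] show ?thesis using that(2) by simp
  qed
  have vanish: "P y = 0"
    if "poly_family {..<k} d P" "\<And>x. x \<in> Z' \<Longrightarrow> poly (P (\<lambda>r. h r x)) (g x) = 0" for d P y
    using that
  proof (induction d arbitrary: P y)
    case 0
    show ?case by (rule poly_family_zero[OF 0(1)])
  next
    case (Suc d)
    have "(\<lambda>y. coeff (P y) 0) \<in> poly_funs {..<k}"
      using Suc.prems(1) by (simp add: poly_family_def)
    then have 0: "coeff (P y) 0 = 0" for y
    proof (rule rel)
      fix x assume x: "x \<in> Z"
      then have "poly (P (\<lambda>r. h r x)) (g x) = 0" using Suc.prems(2) Z'(2) by auto
      then show "coeff (P (\<lambda>r. h r x)) 0 = 0" using g(2)[OF x] by (simp add: poly_0_coeff_0)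
    qed
    define P' where "P' y = poly_shift 1 (P y)" for y
    have P': "poly_family {..<k} d P'"
      using Suc.prems(1) by (simp add: poly_family_def P'_def[abs_def] coeff_poly_shift)
    have PP': "P y = pCons 0 (P' y)" for y
      by (rule poly_eqI) (simp add: P'_def coeff_poly_shift coeff_pCons 0 split: nat.split)
    have "(\<lambda>y. poly (P' y) (y k)) \<in> poly_funs {..<Suc k}"
      by (rule poly_family_eval[OF P']) (auto intro: poly_funs.coord)
    then have "(\<lambda>x. (\<lambda>y. poly (P' y) (y k)) (\<lambda>r. (h(k := g)) r x)) \<in> poly_funs I"
    proof (rule poly_funs_subst)
      fix r assume "r \<in> {..<Suc k}"
      then show "(\<lambda>x. (h(k := g)) r x) \<in> poly_funs I" using h g(1) by (cases "r = k") simp_all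
    qed
    moreover have eq: "P' (\<lambda>r. (h(k := g)) r x) = P' (\<lambda>r. h r x)" for x
      by (rule poly_family_cong[OF P']) simp
    ultimately have F: "(\<lambda>x. poly (P' (\<lambda>r. h r x)) (g x)) \<in> poly_funs I" by simp
    have "g x * poly (P' (\<lambda>r. h r x)) (g x) = 0" if "x \<in> Z'" for x
      using Suc.prems(2)[OF that] by (simp add: PP')
    from irreducible_closed_mult[OF Z'(1) g(1) F this]
    have "\<forall>x\<in>Z'. poly (P' (\<lambda>r. h r x)) (g x) = 0" using g(3,4) by auto
    then have "P' y = 0" by (intro Suc.IH[OF P']) simp
    then show ?case by (simp add: PP')
  qed
  show ?thesis unfolding alg_independent_def
  proof (intro conjI allI impI ballI)
    fix r assume "r < Suc k"
    then show "(h(k := g)) r \<in> poly_funs I" using h g(1) by (cases "r = k") simp_all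
  next
    fix Q y assume Q: "Q \<in> poly_funs {..<Suc k}" and 0: "\<forall>x\<in>Z'. Q (\<lambda>r. (h(k := g)) r x) = 0"
    from Q have "Q \<in> poly_funs (insert k {..<k})" by (simp add: lessThan_Suc)
    from poly_funs_separate[OF this] obtain d P
      where P: "poly_family {..<k} d P" "\<forall>y. Q y = poly (P y) (y k)" by (elim exE conjE)
    have eq: "P (\<lambda>r. (h(k := g)) r x) = P (\<lambda>r. h r x)" for x
      by (rule poly_family_cong[OF P(1)]) simp
    have "poly (P (\<lambda>r. h r x)) (g x) = 0" if "x \<in> Z'" for x
      using bspec[OF 0 that] eq[of x] P(2)[rule_format, of "\<lambda>r. (h(k := g)) r x"]
      by (simp only: fun_upd_same)
    from vanish[OF P(1) this] show "Q y = 0" using P(2) by simp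
  qed
qed

lemma alg_independent_chain:
  assumes irr: "\<And>k. k \<le> d \<Longrightarrow> irreducible_closed I (Z k)" and strict: "\<And>k. k < d \<Longrightarrow> Z k \<subset> Z (Suc k)"
    and "k \<le> d"
  shows "\<exists>h. alg_independent I (Z k) k h"
  using assms(3)
proof (induction k)
  case 0
  have "Z 0 \<noteq> {}" using irr[of 0] by (simp add: irreducible_closed_def)
  then obtain x where x: "x \<in> Z 0" by auto
  have "Q y = 0" if "Q \<in> poly_funs {}" "\<forall>x\<in>Z 0. Q (\<lambda>r. undefined r x) = 0"
    for Q :: "(nat \<Rightarrow> complex) \<Rightarrow> complex" and y
  proof -
    have "Q (\<lambda>r. undefined r x) = 0" using that(2) x by blast
    then show ?thesis using poly_funs_cong[OF that(1), of y "\<lambda>r. undefined r x"] by simp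
  qed
  then show ?case by (intro exI[of _ "\<lambda>r x. undefined r x"]) (simp add: alg_independent_def)
next
  case (Suc k)
  then obtain h where h: "alg_independent I (Z k) k h" by auto
  have closed: "zariski_closed I (Z k)" "zariski_closed I (Z (Suc k))"
    using irr Suc.prems by (auto simp: irreducible_closed_def)
  obtain x where x: "x \<in> Z (Suc k)" "x \<notin> Z k" using strict[of k] Suc.prems by auto
  then have "x \<in> affine_space I" using zariski_closed_affine[OF closed(2)] by auto
  from zariski_closed_separate[OF closed(1) this x(2)] obtain g
    where g: "g \<in> poly_funs I" "\<forall>z\<in>Z k. g z = 0" "g x \<noteq> 0" by (elim exE conjE)
  have "alg_independent I (Z (Suc k)) (Suc k) (h(k := g))"
    by (rule alg_independent_extend[of I "Z k" k h "Z (Suc k)" g x, OF h irr _ g(1) _ x(1) g(3)])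
      (use Suc.prems strict[of k] g(2) in auto)
  then show ?case by (intro exI[of _ "h(k := g)"])
qed

lemma alg_independent_superset: "alg_independent I Z k h \<Longrightarrow> Z \<subseteq> X \<Longrightarrow> alg_independent I X k h"
  unfolding alg_independent_def by (simp add: subset_iff)

text \<open>A longer chain would contain an irreducible set with \<open>d + 1\<close> independent functions inside \<open>X\<close>.\<close>

lemma variety_dim_eqI:
  assumes chain: "\<And>k. k \<le> d \<Longrightarrow> irreducible_closed I (Z k) \<and> Z k \<subseteq> X" "\<And>k. k < d \<Longrightarrow> Z k \<subset> Z (Suc k)"
    and dep: "\<And>h. \<not> alg_independent I X (Suc d) h"
  shows "variety_dim I X = d"
  unfolding variety_dim_def
proof (rule cSup_eq_maximum)
  show "d \<in> {d. \<exists>Z. (\<forall>k\<le>d. irreducible_closed I (Z k) \<and> Z k \<subseteq> X) \<and> (\<forall>k<d. Z k \<subset> Z (Suc k))}"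
    using chain by (intro CollectI exI[of _ Z]) simp
  fix e assume "e \<in> {d. \<exists>Z. (\<forall>k\<le>d. irreducible_closed I (Z k) \<and> Z k \<subseteq> X) \<and> (\<forall>k<d. Z k \<subset> Z (Suc k))}"
  then obtain Y where Y: "\<forall>k\<le>e. irreducible_closed I (Y k) \<and> Y k \<subseteq> X" "\<forall>k<e. Y k \<subset> Y (Suc k)"
    by (elim CollectE exE conjE)
  show "e \<le> d"
  proof (rule ccontr)
    assume "\<not> e \<le> d"
    then have "\<exists>h. alg_independent I (Y (Suc d)) (Suc d) h"
      using Y by (intro alg_independent_chain[of e I Y]) simp_all
    then obtain h where "alg_independent I (Y (Suc d)) (Suc d) h" ..
    then have "alg_independent I X (Suc d) h"
      by (rule alg_independent_superset) (use Y(1) \<open>\<not> e \<le> d\<close> in simp)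
    then show False using dep by simp
  qed
qed

section \<open>Linear systems and bivariate polynomials\<close>

lemma homogeneous_system_nontrivial:
  fixes M :: "'e \<Rightarrow> 'u \<Rightarrow> 'k::field"
  assumes "finite E" "finite U" "card E < card U"
  shows "\<exists>c. (\<exists>u\<in>U. c u \<noteq> 0) \<and> (\<forall>e\<in>E. (\<Sum>u\<in>U. M e u * c u) = 0)"
  using assms
proof (induction E arbitrary: U M rule: finite_induct)
  case empty
  then have "U \<noteq> {}" by auto
  then show ?case by (intro exI[of _ "\<lambda>u. 1"]) auto
next
  case (insert e E)
  show ?case
  proof (cases "\<forall>u\<in>U. M e u = 0")
    case True
    have "card E < card U" using insert by simp
    from insert.IH[OF insert.prems(1) this, of M] show ?thesis using True by auto
  next
    case False
    then obtain v where v: "v \<in> U" "M e v \<noteq> 0" by auto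
    define U' where "U' = U - {v}"
    define M' where "M' f u = M f u - M f v * M e u / M e v" for f u
    have U: "finite U'" "U = insert v U'" "v \<notin> U'" using insert.prems(1) v by (auto simp: U'_def)
    have "card E < card U'" using insert U by simp
    from insert.IH[OF U(1) this, of M'] obtain c
      where c: "\<exists>u\<in>U'. c u \<noteq> 0" "\<forall>f\<in>E. (\<Sum>u\<in>U'. M' f u * c u) = 0" by auto
    define d where "d = c(v := - (\<Sum>u\<in>U'. M e u * c u) / M e v)"
    have d: "(\<Sum>u\<in>U. M f u * d u) = M f v * d v + (\<Sum>u\<in>U'. M f u * c u)" for f
    proof -
      have "(\<Sum>u\<in>U'. M f u * d u) = (\<Sum>u\<in>U'. M f u * c u)"
        by (rule sum.cong) (use U(3) in \<open>auto simp: d_def\<close>)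
      then show ?thesis using U by simp
    qed
    have dv: "M f v * d v = - (M f v / M e v * (\<Sum>u\<in>U'. M e u * c u))" for f
      by (simp add: d_def)
    have "(\<Sum>u\<in>U. M e u * d u) = 0" unfolding d dv using v(2) by simp
    moreover have "(\<Sum>u\<in>U. M f u * d u) = 0" if "f \<in> E" for f
    proof -
      have "(\<Sum>u\<in>U'. M' f u * c u) = (\<Sum>u\<in>U'. M f u * c u) - M f v / M e v * (\<Sum>u\<in>U'. M e u * c u)"
        by (simp add: M'_def algebra_simps sum_subtractf sum_distrib_left)
      then show ?thesis unfolding d dv using c(2) that by simp
    qed
    moreover have "\<exists>u\<in>U. d u \<noteq> 0" using c(1) U by (auto simp: d_def)
    ultimately show ?thesis by (intro exI[of _ d]) auto
  qed
qed

text \<open>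
  An element \<open>F\<close> of \<^typ>\<open>complex poly poly\<close> stands for a polynomial in \<open>t\<^sub>1\<close> with coefficients that
  are polynomials in \<open>t\<^sub>2\<close>.
\<close>

definition eval2 :: "complex poly poly \<Rightarrow> complex \<Rightarrow> complex \<Rightarrow> complex" where
  "eval2 F s t = poly (poly F [:s:]) t"

lemma eval2_simps [simp]:
  "eval2 0 s t = 0" "eval2 1 s t = 1" "eval2 [:[:c:]:] s t = c"
  "eval2 (F + G) s t = eval2 F s t + eval2 G s t"
  "eval2 (F * G) s t = eval2 F s t * eval2 G s t"
  "eval2 (F ^ k) s t = eval2 F s t ^ k"
  by (simp_all add: eval2_def poly_power)

lemma eval2_sum [simp]: "eval2 (\<Sum>u\<in>U. F u) s t = (\<Sum>u\<in>U. eval2 (F u) s t)"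
  by (simp add: eval2_def poly_sum)

lemma eval2_eq_0:
  assumes "\<And>s t. eval2 F s t = 0"
  shows "F = 0"
proof (rule ccontr)
  assume "F \<noteq> 0"
  then have "finite {x. poly F x = 0}" by (rule poly_roots_finite)
  moreover have "range (\<lambda>s. [:s:]) \<subseteq> {x. poly F x = 0}"
  proof (clarify)
    fix s
    have "\<forall>t. poly (poly F [:s:]) t = 0" using assms by (simp add: eval2_def)
    then show "poly F [:s:] = 0" by (simp only: poly_all_0_iff_0)
  qed
  ultimately have "finite (range (\<lambda>s::complex. [:s:]))" by (rule rev_finite_subset)
  moreover have "inj (\<lambda>s::complex. [:s:])" by (auto intro: injI)
  ultimately show False using infinite_UNIV_char_0[where 'a=complex] finite_image_iff by blast
qed

lemma eval2_mult_eq_0: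
  assumes "\<And>s t. eval2 F s t * eval2 G s t = 0"
  shows "F = 0 \<or> G = 0"
  using eval2_eq_0[of "F * G"] assms by simp

lemma poly_funs_eval2:
  assumes "f \<in> poly_funs I" and "\<And>i. i \<in> I \<Longrightarrow> \<exists>F. \<forall>s t. h s t i = eval2 F s t"
  shows "\<exists>F. \<forall>s t. f (h s t) = eval2 F s t"
  using assms(1)
proof (induct f rule: poly_funs.induct)
  case (const c)
  show ?case by (rule exI[of _ "[:[:c:]:]"]) simp
next
  case (coord i)
  show ?case by (rule assms(2)[OF coord])
next
  case (add f g)
  from add(2,4) obtain F G where "\<forall>s t. f (h s t) = eval2 F s t" "\<forall>s t. g (h s t) = eval2 G s t"
    by (elim exE)
  then show ?case by (intro exI[of _ "F + G"]) simp
next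
  case (mult f g)
  from mult(2,4) obtain F G where "\<forall>s t. f (h s t) = eval2 F s t" "\<forall>s t. g (h s t) = eval2 G s t"
    by (elim exE)
  then show ?case by (intro exI[of _ "F * G"]) simp
qed

text \<open>
  Bounds the dimension of a space of polynomials by a number of positions, for example those of all
  possible leading monomials: vanishing of the coefficients at the positions in \<open>S\<close> is a linear
  system with fewer equations than unknowns, and a combination that solves it is \<open>0\<close>.
\<close>

lemma linear_dependence_by_positions:
  fixes G :: "'u \<Rightarrow> complex poly poly"
  assumes "finite U" "finite S" "card S < card U"
    and pos: "\<And>c. (\<Sum>u\<in>U. [:[:c u:]:] * G u) \<noteq> 0 \<Longrightarrow>
      \<exists>(i, j)\<in>S. coeff (coeff (\<Sum>u\<in>U. [:[:c u:]:] * G u) i) j \<noteq> 0"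
  shows "\<exists>c. (\<exists>u\<in>U. c u \<noteq> 0) \<and> (\<Sum>u\<in>U. [:[:c u:]:] * G u) = 0"
proof -
  from homogeneous_system_nontrivial[OF assms(2,1,3), of "\<lambda>(i, j) u. coeff (coeff (G u) i) j"]
  obtain c where c: "\<exists>u\<in>U. c u \<noteq> 0" "\<forall>e\<in>S. (\<Sum>u\<in>U. (case e of (i, j) \<Rightarrow> \<lambda>u. coeff (coeff (G u) i) j) u * c u) = 0"
    by (elim exE conjE)
  have "coeff (coeff (\<Sum>u\<in>U. [:[:c u:]:] * G u) i) j = (\<Sum>u\<in>U. coeff (coeff (G u) i) j * c u)" for i j
    by (simp add: coeff_sum mult.commute)
  then have "\<not> (\<exists>(i, j)\<in>S. coeff (coeff (\<Sum>u\<in>U. [:[:c u:]:] * G u) i) j \<noteq> 0)"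
    using c(2) by fastforce
  then have "(\<Sum>u\<in>U. [:[:c u:]:] * G u) = 0" using pos[of c] by blast
  with c(1) show ?thesis by (intro exI[of _ c]) simp
qed

lemma coeff2_mult_nonzero:
  assumes "coeff (coeff (F * G) i) j \<noteq> (0::complex)"
  shows "\<exists>i' j'. i' \<le> i \<and> j' \<le> j \<and> coeff (coeff F i') j' \<noteq> 0 \<and> coeff (coeff G (i - i')) (j - j') \<noteq> 0"
proof -
  have "coeff (coeff (F * G) i) j =
      (\<Sum>i'\<le>i. \<Sum>j'\<le>j. coeff (coeff F i') j' * coeff (coeff G (i - i')) (j - j'))"
    by (simp add: coeff_mult coeff_sum)
  with assms have "\<exists>i'\<in>{..i}. (\<Sum>j'\<le>j. coeff (coeff F i') j' * coeff (coeff G (i - i')) (j - j')) \<noteq> 0"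
    by (metis (no_types, lifting) sum.neutral)
  then obtain i' where i': "i' \<le> i" "(\<Sum>j'\<le>j. coeff (coeff F i') j' * coeff (coeff G (i - i')) (j - j')) \<noteq> 0"
    by auto
  from i'(2) have "\<exists>j'\<in>{..j}. coeff (coeff F i') j' * coeff (coeff G (i - i')) (j - j') \<noteq> 0"
    by (metis (no_types, lifting) sum.neutral)
  then show ?thesis using i'(1) by auto
qed

subsection \<open>Algebraic dependence of three bivariate polynomials\<close>

definition bidegree_le :: "nat \<Rightarrow> complex poly poly \<Rightarrow> bool" where
  "bidegree_le d F \<longleftrightarrow> (\<forall>i j. coeff (coeff F i) j \<noteq> 0 \<longrightarrow> i \<le> d \<and> j \<le> d)"

lemma bidegree_le_mult: "bidegree_le d F \<Longrightarrow> bidegree_le e G \<Longrightarrow> bidegree_le (d + e) (F * G)"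
  unfolding bidegree_le_def by (intro allI impI) (drule coeff2_mult_nonzero, fastforce)

lemma bidegree_le_power: "bidegree_le d F \<Longrightarrow> bidegree_le (k * d) (F ^ k)"
proof (induction k)
  case 0
  show ?case by (auto simp: bidegree_le_def coeff_1 split: if_splits)
next
  case (Suc k)
  then show ?case using bidegree_le_mult[of d F "k * d" "F ^ k"] by simp
qed

lemma bidegree_le_mono: "bidegree_le d F \<Longrightarrow> d \<le> e \<Longrightarrow> bidegree_le e F"
  unfolding bidegree_le_def by (meson order_trans)

lemma bidegree_le_exists: "\<exists>d. bidegree_le d F"
proof -
  define d where "d = Max (insert (degree F) ((\<lambda>i. degree (coeff F i)) ` {..degree F}))"
  have "i \<le> d \<and> j \<le> d" if "coeff (coeff F i) j \<noteq> 0" for i j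
  proof -
    have i: "i \<le> degree F" using that by (intro le_degree) auto
    have "j \<le> degree (coeff F i)" using that by (intro le_degree)
    also have "\<dots> \<le> d" unfolding d_def using i by (intro Max_ge) auto
    finally have "j \<le> d" .
    moreover have "degree F \<le> d" unfolding d_def by (intro Max_ge) auto
    ultimately show ?thesis using i by simp
  qed
  then show ?thesis unfolding bidegree_le_def by blast
qed

lemma polynomial_zero_coeffs:
  assumes "\<And>z::complex. (\<Sum>i\<le>n. c i * z ^ i) = 0" "i \<le> n"
  shows "c i = 0"
  using polyfun_eq_0[of c n] assms by blast

text \<open>
  There are about \<open>M ^ 3\<close> monomials of degree at most \<open>M\<close> in each of three polynomials, but they lie
  in a space of dimension proportional to \<open>M\<^sup>2\<close>.
\<close>

lemma three_bivariate_dependent: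
  fixes F G H :: "complex poly poly"
  shows "\<exists>M c. (\<exists>i\<le>M. \<exists>j\<le>M. \<exists>k\<le>M. c i j k \<noteq> 0) \<and>
    (\<Sum>i\<le>M. \<Sum>j\<le>M. \<Sum>k\<le>M. [:[:c i j k:]:] * (F ^ i * G ^ j * H ^ k)) = 0"
proof -
  obtain dF dG dH where dd: "bidegree_le dF F" "bidegree_le dG G" "bidegree_le dH H"
    using bidegree_le_exists by metis
  define d where "d = Suc (dF + dG + dH)"
  have d: "bidegree_le d F" "bidegree_le d G" "bidegree_le d H"
    by (rule bidegree_le_mono[OF dd(1)] bidegree_le_mono[OF dd(2)] bidegree_le_mono[OF dd(3)],
        simp add: d_def)+
  \<comment> \<open>chosen such that \<open>(M + 1) ^ 3\<close> exceeds \<open>(3 * d * (M + 1))\<^sup>2\<close>\<close>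
  define M where "M = 9 * d ^ 2"
  define U where "U = {..M} \<times> {..M} \<times> {..M}"
  define S where "S = {..3 * M * d} \<times> {..3 * M * d}"
  define T where "T = (\<lambda>(i, j, k). F ^ i * G ^ j * H ^ k)"
  have "card S \<le> (3 * d * Suc M) ^ 2"
  proof -
    have "card S = (3 * M * d + 1) ^ 2" by (simp add: S_def power2_eq_square)
    also have "3 * M * d + 1 \<le> 3 * d * Suc M"
    proof -
      have "3 * M * d + 1 \<le> 3 * (M * d) + 3 * d" by (simp add: d_def)
      then show ?thesis by (simp add: algebra_simps)
    qed
    then have "(3 * M * d + 1) ^ 2 \<le> (3 * d * Suc M) ^ 2" by (rule power_mono) simp
    finally show ?thesis .
  qed
  also have "\<dots> = 9 * d ^ 2 * Suc M ^ 2" by (simp add: power2_eq_square algebra_simps)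
  also have "\<dots> < Suc M * Suc M ^ 2" unfolding M_def by (intro mult_strict_right_mono) simp_all
  also have "\<dots> = card U" by (simp add: U_def power2_eq_square)
  finally have card: "card S < card U" .
  have T: "bidegree_le (3 * M * d) (T u)" if "u \<in> U" for u
  proof -
    obtain i j k where u: "u = (i, j, k)" "i \<le> M" "j \<le> M" "k \<le> M" using \<open>u \<in> U\<close> by (auto simp: U_def)
    have "bidegree_le (i * d + j * d + k * d) (T u)"
      unfolding T_def u(1) prod.case by (intro bidegree_le_mult bidegree_le_power d)
    moreover have "i * d + j * d + k * d \<le> M * d + M * d + M * d"
      using u by (intro add_mono mult_right_mono) auto
    then have "i * d + j * d + k * d \<le> 3 * M * d" by simp
    ultimately show ?thesis by (rule bidegree_le_mono)
  qed
  have "\<exists>c. (\<exists>u\<in>U. c u \<noteq> 0) \<and> (\<Sum>u\<in>U. [:[:c u:]:] * T u) = 0"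
  proof (rule linear_dependence_by_positions[OF _ _ card])
    fix c assume nz: "(\<Sum>u\<in>U. [:[:c u:]:] * T u) \<noteq> 0"
    define K where "K = (\<Sum>u\<in>U. [:[:c u:]:] * T u)"
    define i where "i = degree K"
    define j where "j = degree (coeff K i)"
    have "K \<noteq> 0" using nz unfolding K_def .
    then have "coeff (coeff K i) j \<noteq> 0" by (simp add: i_def j_def)
    then have ij: "coeff (coeff (\<Sum>u\<in>U. [:[:c u:]:] * T u) i) j \<noteq> 0" unfolding K_def .
    have "\<exists>u\<in>U. coeff (coeff (T u) i) j \<noteq> 0"
    proof (rule ccontr)
      assume "\<not> ?thesis"
      then have "coeff (coeff (\<Sum>u\<in>U. [:[:c u:]:] * T u) i) j = 0" by (simp add: coeff_sum)
      with ij show False by simp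
    qed
    then have "(i, j) \<in> S" using T by (auto simp: S_def bidegree_le_def)
    show "\<exists>(i, j)\<in>S. coeff (coeff (\<Sum>u\<in>U. [:[:c u:]:] * T u) i) j \<noteq> 0"
      by (rule bexI[OF _ \<open>(i, j) \<in> S\<close>]) (use ij in simp)
  qed (simp_all add: U_def S_def)
  then obtain c where "(\<exists>u\<in>U. c u \<noteq> 0) \<and> (\<Sum>u\<in>U. [:[:c u:]:] * T u) = 0" ..
  then have c: "\<exists>u\<in>U. c u \<noteq> 0" "(\<Sum>u\<in>U. [:[:c u:]:] * T u) = 0" by simp_all
  have "(\<Sum>i\<le>M. \<Sum>j\<le>M. \<Sum>k\<le>M. [:[:c (i, j, k):]:] * (F ^ i * G ^ j * H ^ k)) = 0"
    using c(2) by (simp add: U_def T_def sum.cartesian_product split_beta)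
  moreover have "\<exists>i\<le>M. \<exists>j\<le>M. \<exists>k\<le>M. c (i, j, k) \<noteq> 0" using c(1) by (auto simp: U_def)
  ultimately show ?thesis by (intro exI[of _ M] exI[of _ "\<lambda>i j k. c (i, j, k)"]) simp
qed

lemma no_three_alg_independent:
  assumes \<psi>: "\<And>s t. \<psi> s t \<in> affine_space I" "\<And>i. i \<in> I \<Longrightarrow> \<exists>F. \<forall>s t. \<psi> s t i = eval2 F s t"
  shows "\<not> alg_independent I (zariski_closure I (range (\<lambda>(s, t). \<psi> s t))) 3 h"
proof
  let ?X = "zariski_closure I (range (\<lambda>(s, t). \<psi> s t))"
  assume ind: "alg_independent I ?X 3 h"
  then have h: "h r \<in> poly_funs I" if "r < 3" for r using that by (simp add: alg_independent_def)
  have "\<exists>F. \<forall>s t. h r (\<psi> s t) = eval2 F s t" if "r < 3" for r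
    by (rule poly_funs_eval2[OF h[OF that] \<psi>(2)])
  then obtain F where F: "\<And>r s t. r < 3 \<Longrightarrow> h r (\<psi> s t) = eval2 (F r) s t" by metis
  from three_bivariate_dependent[of "F 0" "F 1" "F 2"] obtain M
    where "\<exists>c. (\<exists>i\<le>M. \<exists>j\<le>M. \<exists>k\<le>M. c i j k \<noteq> 0) \<and>
      (\<Sum>i\<le>M. \<Sum>j\<le>M. \<Sum>k\<le>M. [:[:c i j k:]:] * (F 0 ^ i * F 1 ^ j * F 2 ^ k)) = 0" ..
  then obtain c where cc: "(\<exists>i\<le>M. \<exists>j\<le>M. \<exists>k\<le>M. c i j k \<noteq> 0) \<and>
      (\<Sum>i\<le>M. \<Sum>j\<le>M. \<Sum>k\<le>M. [:[:c i j k:]:] * (F 0 ^ i * F 1 ^ j * F 2 ^ k)) = 0" ..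
  note nz = cc[THEN conjunct1] and c = cc[THEN conjunct2]
  define Q where "Q y = (\<Sum>i\<le>M. \<Sum>j\<le>M. \<Sum>k\<le>M. c i j k * (y 0 ^ i * y 1 ^ j * y 2 ^ k))"
    for y :: "nat \<Rightarrow> complex"
  have Q: "Q \<in> poly_funs {..<3}" unfolding Q_def[abs_def]
    by (intro poly_funs_sum poly_funs.mult poly_funs.const poly_funs_power poly_funs.coord) simp_all
  have Qh: "(\<lambda>x. Q (\<lambda>r. h r x)) \<in> poly_funs I"
    by (rule poly_funs_subst[OF Q]) (simp add: h)
  have "Q (\<lambda>r. h r (\<psi> s t)) = 0" for s t
  proof -
    have "Q (\<lambda>r. h r (\<psi> s t)) =
        eval2 (\<Sum>i\<le>M. \<Sum>j\<le>M. \<Sum>k\<le>M. [:[:c i j k:]:] * (F 0 ^ i * F 1 ^ j * F 2 ^ k)) s t"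
      by (simp only: eval2_simps eval2_sum) (simp add: Q_def F)
    also have "\<dots> = 0" unfolding c by simp
    finally show ?thesis .
  qed
  then have "Q (\<lambda>r. h r x) = 0" if "x \<in> ?X" for x
    by (intro zariski_closure_vanishes[OF _ Qh _ that]) (use \<psi>(1) in auto)
  moreover have "\<forall>Q\<in>poly_funs {..<3}. (\<forall>x\<in>?X. Q (\<lambda>r. h r x) = 0) \<longrightarrow> (\<forall>y. Q y = 0)"
    using ind by (simp add: alg_independent_def)
  from bspec[OF this Q] calculation have Q0: "Q y = 0" for y by simp
  have "c i j k = 0" if "i \<le> M" "j \<le> M" "k \<le> M" for i j k
  proof -
    have "(\<Sum>i\<le>M. (\<Sum>j\<le>M. (\<Sum>k\<le>M. c i j k * v ^ k) * z ^ j) * w ^ i) = 0" for v z w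
      using Q0[of "\<lambda>r. if r = 0 then w else if r = 1 then z else v"]
      by (simp add: Q_def sum_distrib_left sum_distrib_right mult_ac)
    then have "(\<Sum>j\<le>M. (\<Sum>k\<le>M. c i j k * v ^ k) * z ^ j) = 0" for v z
      using polynomial_zero_coeffs[OF _ \<open>i \<le> M\<close>, of "\<lambda>i. \<Sum>j\<le>M. (\<Sum>k\<le>M. c i j k * v ^ k) * z ^ j"]
      by blast
    then have "(\<Sum>k\<le>M. c i j k * v ^ k) = 0" for v
      using polynomial_zero_coeffs[OF _ \<open>j \<le> M\<close>, of "\<lambda>j. \<Sum>k\<le>M. c i j k * v ^ k"] by blast
    then show ?thesis using polynomial_zero_coeffs[OF _ \<open>k \<le> M\<close>, of "c i j"] by blast
  qed
  with nz show False by blast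
qed

section \<open>Leading monomials of polynomials in the coordinates\<close>

text \<open>
  \<open>m\<close> counts factors from \<open>G\<close> and not degrees: with the coordinates of a parametrized surface for \<open>G\<close>,
  these are the restrictions to the surface of polynomials of degree at most \<open>m\<close>.
\<close>

inductive polys_upto :: "complex poly poly set \<Rightarrow> nat \<Rightarrow> complex poly poly \<Rightarrow> bool"
  for G
where
  const: "polys_upto G m [:[:c:]:]"
| add: "polys_upto G m F \<Longrightarrow> polys_upto G m F' \<Longrightarrow> polys_upto G m (F + F')"
| gen: "polys_upto G m F \<Longrightarrow> g \<in> G \<Longrightarrow> polys_upto G (Suc m) (F * g)"
| lift: "polys_upto G m F \<Longrightarrow> polys_upto G (Suc m) F"

lemma polys_upto_lift: "polys_upto G m F \<Longrightarrow> m \<le> k \<Longrightarrow> polys_upto G k F"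
  by (induction k) (auto simp: le_Suc_eq intro: polys_upto.lift)

lemma polys_upto_sum:
  "finite U \<Longrightarrow> (\<And>u. u \<in> U \<Longrightarrow> polys_upto G m (F u)) \<Longrightarrow> polys_upto G m (\<Sum>u\<in>U. F u)"
proof (induction U rule: finite_induct)
  case empty
  show ?case using polys_upto.const[of G m 0] by simp
next
  case (insert u U)
  then show ?case by (simp add: polys_upto.add)
qed

lemma polys_upto_smult:
  assumes "polys_upto G m F"
  shows "polys_upto G m ([:[:c:]:] * F)"
  using assms
proof (induction rule: polys_upto.induct)
  case (const m d)
  show ?case using polys_upto.const[of G m "c * d"] by simp
next
  case (gen m F g)
  show ?case using polys_upto.gen[OF gen.IH gen.hyps(2)] by (simp add: mult.assoc)
next
  case (add m F F')
  show ?case using polys_upto.add[OF add.IH] by (simp add: distrib_left smult_add_right)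
qed (auto intro: polys_upto.lift)

lemma polys_upto_mult:
  assumes F: "polys_upto G k F" and H: "polys_upto G m H"
  shows "polys_upto G (k + m) (F * H)"
  using H
proof (induction rule: polys_upto.induct)
  case (const m c)
  show ?case using polys_upto_smult[OF polys_upto_lift[OF F, of "k + m"], of c]
    by (simp add: mult.commute)
next
  case (gen m H g)
  show ?case using polys_upto.gen[OF gen.IH gen.hyps(2)] by (simp add: mult.assoc)
next
  case (add m H H')
  show ?case using polys_upto.add[OF add.IH] by (simp add: distrib_left)
next
  case (lift m H)
  show ?case using polys_upto.lift[OF lift.IH] by simp
qed

lemma polys_upto_power: "polys_upto G 1 F \<Longrightarrow> polys_upto G k (F ^ k)"
proof (induction k)
  case 0
  show ?case using polys_upto.const[of G 0 1] by (simp add: one_pCons)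
next
  case (Suc k)
  then show ?case using polys_upto_mult[of G 1 F k "F ^ k"] by simp
qed

text \<open>
  Supports add up in products, and \<open>m P + P\<close> is contained in \<open>(m + 1) P\<close> for convex \<open>P\<close>; the case of
  fewer than \<open>m\<close> factors is covered because \<open>P\<close> contains the origin.
\<close>

lemma polys_upto_support:
  assumes P: "convex P" "0 \<in> P"
    and G: "\<And>g i j. g \<in> G \<Longrightarrow> coeff (coeff g i) j \<noteq> 0 \<Longrightarrow> (real i, real j) \<in> P"
    and F: "polys_upto G m F" "coeff (coeff F i) j \<noteq> 0"
  shows "\<exists>p\<in>P. (real i, real j) = real m *\<^sub>R p"
  using F
proof (induction arbitrary: i j rule: polys_upto.induct)
  case (const m c)
  then have "i = 0" "j = 0" by (auto simp: coeff_pCons split: nat.splits)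
  then show ?case using P(2) by (intro bexI[of _ 0]) (auto simp: zero_prod_def)
next
  case (add m F F')
  then have "coeff (coeff F i) j \<noteq> 0 \<or> coeff (coeff F' i) j \<noteq> 0" by auto
  then show ?case using add.IH by blast
next
  case (gen m F g)
  from coeff2_mult_nonzero[OF gen.prems] obtain i' j' where ij: "i' \<le> i" "j' \<le> j"
    "coeff (coeff F i') j' \<noteq> 0" "coeff (coeff g (i - i')) (j - j') \<noteq> 0" by auto
  from gen.IH[OF ij(3)] obtain p where p: "p \<in> P" "(real i', real j') = real m *\<^sub>R p" by auto
  define q where "q = (real (i - i'), real (j - j'))"
  have q: "q \<in> P" using G[OF gen.hyps(2) ij(4)] by (simp add: q_def)
  define r where "r = (real m / real (Suc m)) *\<^sub>R p + (1 / real (Suc m)) *\<^sub>R q"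
  have "r \<in> P" unfolding r_def
    by (rule convexD[OF P(1) p(1) q]) (simp_all add: field_simps)
  moreover have "real (Suc m) *\<^sub>R r = real m *\<^sub>R p + q"
    by (simp add: r_def scaleR_add_right del: of_nat_Suc)
  moreover have "\<dots> = (real i, real j)" unfolding p(2)[symmetric] q_def using ij(1,2) by simp
  ultimately show ?case by metis
next
  case (lift m F)
  from lift.IH[OF lift.prems] obtain p where p: "p \<in> P" "(real i, real j) = real m *\<^sub>R p" by auto
  define r where "r = (real m / real (Suc m)) *\<^sub>R p + (1 / real (Suc m)) *\<^sub>R 0"
  have "r \<in> P" unfolding r_def
    by (rule convexD[OF P(1) p(1) P(2)]) (simp_all add: field_simps)
  moreover have "real (Suc m) *\<^sub>R r = (real i, real j)"
    by (simp add: r_def p(2) scaleR_add_right del: of_nat_Suc)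
  ultimately show ?case by metis
qed

text \<open>
  The condition at infinity. Let every generator have degree at most \<open>c + \<delta>\<close> in a variable, with
  coefficients divisible by \<open>D\<close> in the degrees above \<open>c\<close>. In a product of \<open>m\<close> generators, degrees
  above \<open>m * c\<close> come from factors of the second kind, each of which exceeds \<open>c\<close> by at most \<open>\<delta>\<close> and
  contributes a factor \<open>D\<close>.
\<close>

definition vanishes_at_infinity :: "complex poly \<Rightarrow> nat \<Rightarrow> nat \<Rightarrow> nat \<Rightarrow> (nat \<Rightarrow> complex poly) \<Rightarrow> bool" where
  "vanishes_at_infinity D c \<delta> m f \<longleftrightarrow> (\<forall>i. D ^ ((i - m * c) div \<delta>) dvd f i)"

lemma vanishes_at_infinity_convolution:
  assumes f: "vanishes_at_infinity D c \<delta> m f"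
    and g: "\<And>i. g i \<noteq> 0 \<Longrightarrow> i \<le> c \<or> i \<le> c + \<delta> \<and> D dvd g i"
  shows "vanishes_at_infinity D c \<delta> (Suc m) (\<lambda>i. \<Sum>k\<le>i. f k * g (i - k))"
  unfolding vanishes_at_infinity_def
proof (intro allI dvd_sum)
  fix i k :: nat assume "k \<in> {..i}"
  then have k: "k \<le> i" by simp
  have fk: "D ^ ((k - m * c) div \<delta>) dvd f k" using f by (simp add: vanishes_at_infinity_def)
  show "D ^ ((i - Suc m * c) div \<delta>) dvd f k * g (i - k)"
  proof (cases "g (i - k) = 0")
    case False
    from g[OF this] show ?thesis
    proof
      assume "i - k \<le> c"
      then have "i - Suc m * c \<le> k - m * c" using k by simp
      then have "(i - Suc m * c) div \<delta> \<le> (k - m * c) div \<delta>" by (rule div_le_mono)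
      then show ?thesis using fk by (meson dvd_mult2 dvd_trans le_imp_power_dvd)
    next
      assume *: "i - k \<le> c + \<delta> \<and> D dvd g (i - k)"
      have "(i - Suc m * c) div \<delta> \<le> Suc ((k - m * c) div \<delta>)"
      proof (cases "\<delta> = 0")
        case False
        have "i - k \<le> c + \<delta>" "Suc m * c = c + m * c" using * by simp_all
        then have "i - Suc m * c \<le> k - m * c + \<delta>" using k by arith
        then have "(i - Suc m * c) div \<delta> \<le> (k - m * c + \<delta>) div \<delta>" by (rule div_le_mono)
        then show ?thesis using False by simp
      qed simp
      then have "D ^ ((i - Suc m * c) div \<delta>) dvd D ^ ((k - m * c) div \<delta>) * D"
        by (metis le_imp_power_dvd power_Suc2)
      also have "\<dots> dvd f k * g (i - k)" using fk * by (intro mult_dvd_mono) auto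
      finally show ?thesis .
    qed
  qed simp
qed

lemma vanishes_at_infinity_Suc:
  "vanishes_at_infinity D c \<delta> m f \<Longrightarrow> vanishes_at_infinity D c \<delta> (Suc m) f"
  unfolding vanishes_at_infinity_def
proof (intro allI)
  fix i assume *: "\<forall>i. D ^ ((i - m * c) div \<delta>) dvd f i"
  have "(i - Suc m * c) div \<delta> \<le> (i - m * c) div \<delta>" by (intro div_le_mono) simp
  then show "D ^ ((i - Suc m * c) div \<delta>) dvd f i" using * by (meson dvd_trans le_imp_power_dvd)
qed

text \<open>
  The coefficients of the powers of \<open>t\<^sub>2\<close>, which turn a statement about \<^term>\<open>coeff F\<close> into the one
  with the variables exchanged.
\<close>

definition row :: "complex poly poly \<Rightarrow> nat \<Rightarrow> complex poly" where
  "row F j = map_poly (\<lambda>p. coeff p j) F"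

lemma coeff_row [simp]: "coeff (row F j) i = coeff (coeff F i) j"
  by (simp add: row_def coeff_map_poly)

lemma row_add: "row (F + G) j = row F j + row G j"
  by (rule poly_eqI) simp

lemma row_mult: "row (F * G) j = (\<Sum>k\<le>j. row F k * row G (j - k))"
proof (rule poly_eqI)
  fix i
  have "coeff (row (F * G) j) i = (\<Sum>i'\<le>i. \<Sum>k\<le>j. coeff (coeff F i') k * coeff (coeff G (i - i')) (j - k))"
    by (simp add: coeff_mult coeff_sum)
  also have "\<dots> = (\<Sum>k\<le>j. \<Sum>i'\<le>i. coeff (coeff F i') k * coeff (coeff G (i - i')) (j - k))"
    by (rule sum.swap)
  finally show "coeff (row (F * G) j) i = coeff (\<Sum>k\<le>j. row F k * row G (j - k)) i"
    by (simp add: coeff_sum coeff_mult)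
qed

lemma polys_upto_columns_vanish:
  assumes "polys_upto G m F"
    and G: "\<And>g i. g \<in> G \<Longrightarrow> coeff g i \<noteq> 0 \<Longrightarrow> i \<le> c \<or> i \<le> c + \<delta> \<and> D dvd coeff g i"
  shows "vanishes_at_infinity D c \<delta> m (coeff F)"
  using assms(1)
proof (induction rule: polys_upto.induct)
  case (const m d)
  have "D ^ ((i - m * c) div \<delta>) dvd coeff [:[:d:]:] i" for i by (cases i) auto
  then show ?case by (simp add: vanishes_at_infinity_def)
next
  case (add m F F')
  then show ?case by (simp add: vanishes_at_infinity_def)
next
  case (gen m F g)
  have "coeff (F * g) = (\<lambda>i. \<Sum>k\<le>i. coeff F k * coeff g (i - k))" by (simp add: fun_eq_iff coeff_mult)
  then show ?case using vanishes_at_infinity_convolution[OF gen.IH, of "coeff g"] G[OF gen.hyps(2)] by simp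
qed (rule vanishes_at_infinity_Suc)

lemma polys_upto_rows_vanish:
  assumes "polys_upto G m F"
    and G: "\<And>g j. g \<in> G \<Longrightarrow> row g j \<noteq> 0 \<Longrightarrow> j \<le> c \<or> j \<le> c + \<delta> \<and> D dvd row g j"
  shows "vanishes_at_infinity D c \<delta> m (row F)"
  using assms(1)
proof (induction rule: polys_upto.induct)
  case (const m d)
  have "D ^ ((j - m * c) div \<delta>) dvd row [:[:d:]:] j" for j
  proof (cases j)
    case (Suc k)
    then have "row [:[:d:]:] j = 0" by (intro poly_eqI) (simp add: coeff_pCons split: nat.splits)
    then show ?thesis by simp
  qed simp
  then show ?case by (simp add: vanishes_at_infinity_def)
next
  case (add m F F')
  then show ?case by (simp add: vanishes_at_infinity_def row_add)
next
  case (gen m F g)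
  have "row (F * g) = (\<lambda>j. \<Sum>k\<le>j. row F k * row g (j - k))" by (simp add: fun_eq_iff row_mult)
  then show ?case using vanishes_at_infinity_convolution[OF gen.IH, of "row g"] G[OF gen.hyps(2)] by simp
qed (rule vanishes_at_infinity_Suc)

text \<open>
  The lexicographically leading monomial \<open>(i, j)\<close> satisfies both conditions at infinity: \<open>j\<close> is the
  degree of a nonzero multiple of a power of \<open>D\<close>, and, since no monomial has a higher degree in the
  first variable, \<open>i\<close> is the degree of a nonzero multiple of a power of \<open>D'\<close>.
\<close>

lemma leading_monomial:
  assumes "F \<noteq> 0"
    and col: "vanishes_at_infinity D c \<delta> m (coeff F)" and row: "vanishes_at_infinity D' c' \<delta>' m (row F)"
  shows "\<exists>i j. coeff (coeff F i) j \<noteq> 0 \<and> degree D * ((i - m * c) div \<delta>) \<le> j \<and>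
    degree D' * ((j - m * c') div \<delta>') \<le> i"
proof -
  define i where "i = degree F"
  define j where "j = degree (coeff F i)"
  have i: "coeff F i \<noteq> 0" using assms(1) by (simp add: i_def)
  then have nz: "coeff (coeff F i) j \<noteq> 0" by (simp add: j_def)
  have "D ^ ((i - m * c) div \<delta>) dvd coeff F i" using col by (simp add: vanishes_at_infinity_def)
  from dvd_imp_degree_le[OF this i] have 1: "degree D * ((i - m * c) div \<delta>) \<le> j"
    by (cases "D = 0") (simp_all add: j_def degree_power_eq mult.commute)
  have r: "row F j \<noteq> 0" using nz by (metis coeff_0 coeff_row)
  have "D' ^ ((j - m * c') div \<delta>') dvd row F j" using row by (simp add: vanishes_at_infinity_def)
  from dvd_imp_degree_le[OF this r] have "degree D' * ((j - m * c') div \<delta>') \<le> degree (row F j)"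
    by (cases "D' = 0") (simp_all add: degree_power_eq mult.commute)
  also have "degree (row F j) \<le> i"
    by (rule degree_le) (simp add: i_def coeff_eq_0)
  finally show ?thesis using nz 1 by blast
qed

section \<open>Chebyshev polynomials\<close>

fun chebyshev_poly :: "nat \<Rightarrow> complex poly" where
  "chebyshev_poly 0 = 1"
| "chebyshev_poly (Suc 0) = [:0, 1:]"
| "chebyshev_poly (Suc (Suc k)) = [:0, 2:] * chebyshev_poly (Suc k) - chebyshev_poly k"

lemma poly_chebyshev_poly [simp]: "poly (chebyshev_poly k) t = chebyshev_T k t"
  by (induction k rule: chebyshev_poly.induct) (simp_all add: mult_ac)

lemma degree_chebyshev_poly [simp]: "degree (chebyshev_poly k) = k"
proof (induction k rule: chebyshev_poly.induct)
  case (3 k)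
  then have "chebyshev_poly (Suc k) \<noteq> 0" by auto
  then have "degree ([:0, 2:] * chebyshev_poly (Suc k)) = Suc (Suc k)"
    using 3 by (subst degree_mult_eq) auto
  then show ?case using 3 degree_add_eq_left[of "- chebyshev_poly k" "[:0, 2:] * chebyshev_poly (Suc k)"]
    by simp
qed simp_all

lemma chebyshev_poly_nonzero [simp]: "chebyshev_poly k \<noteq> 0"
proof (cases k)
  case (Suc l)
  then show ?thesis using degree_chebyshev_poly[of k] by (metis degree_0 nat.distinct(1))
qed simp

lemma chebyshev_T_1: "chebyshev_T k 1 = 1"
  by (induction k rule: chebyshev_poly.induct) simp_all

lemma chebyshev_T_cos: "chebyshev_T k (cos z) = cos (of_nat k * z)"
proof (induction k rule: chebyshev_poly.induct)
  case (3 k)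
  define w where "w = of_nat (Suc k) * z"
  have "cos (w + z) + cos (w - z) = 2 * cos z * cos w" by (simp add: cos_add cos_diff)
  moreover have "w + z = of_nat (Suc (Suc k)) * z" "w - z = of_nat k * z"
    by (simp_all add: w_def algebra_simps)
  ultimately have "cos (of_nat (Suc (Suc k)) * z) + cos (of_nat k * z) =
      2 * cos z * cos (of_nat (Suc k) * z)" by (simp only: w_def)
  then show ?case using 3 by (simp add: diff_eq_eq)
qed simp_all

lemma chebyshev_T_compose: "chebyshev_T k (chebyshev_T l t) = chebyshev_T (k * l) t"
proof -
  have "cos (Arccos t) = t" by simp
  then show ?thesis by (metis chebyshev_T_cos mult.assoc of_nat_mult)
qed

lemma chebyshev_T_distinct:
  assumes "k \<noteq> l"
  shows "\<exists>t. chebyshev_T k t \<noteq> chebyshev_T l t"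
proof (rule ccontr)
  assume "\<not> ?thesis"
  then have "poly (chebyshev_poly k) = poly (chebyshev_poly l)" by (simp add: fun_eq_iff)
  then have "chebyshev_poly k = chebyshev_poly l" by (simp add: poly_eq_poly_eq_iff)
  then show False using assms degree_chebyshev_poly by metis
qed

definition tensor :: "complex poly \<Rightarrow> complex poly \<Rightarrow> complex poly poly" where
  "tensor p q = smult q (map_poly (\<lambda>c. [:c:]) p)"

lemma coeff_tensor [simp]: "coeff (tensor p q) i = smult (coeff p i) q"
  by (simp add: tensor_def coeff_map_poly mult.commute)

lemma row_tensor: "row (tensor p q) j = smult (coeff q j) p"
  by (rule poly_eqI) (simp add: mult.commute)

lemma eval2_tensor [simp]: "eval2 (tensor p q) s t = poly p s * poly q t"
proof -
  have "poly (map_poly (\<lambda>c. [:c:]) p) [:s:] = [:poly p s:]"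
    by (induction p) (simp_all add: map_poly_pCons)
  then show ?thesis by (simp add: eval2_def tensor_def mult.commute)
qed

section \<open>The number of points on a generic linear section\<close>

lemma generically_ball:
  assumes "finite S" "\<And>s. s \<in> S \<Longrightarrow> generically I (P s)"
  shows "generically I (\<lambda>x. \<forall>s\<in>S. P s x)"
  using assms
proof (induction S rule: finite_induct)
  case empty
  show ?case using generically_const[of True] by simp
next
  case (insert s S)
  then show ?case using generically_conj[of I "P s" "\<lambda>x. \<forall>s\<in>S. P s x"] by simp
qed

lemma poly_funs_override:
  assumes "f \<in> poly_funs I"
  shows "(\<lambda>y. f (override_on x y K)) \<in> poly_funs K"
proof (rule poly_funs_subst[OF assms])
  fix i assume "i \<in> I"
  show "(\<lambda>y. override_on x y K i) \<in> poly_funs K"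
    by (cases "i \<in> K") (simp_all add: poly_funs.const poly_funs.coord)
qed

lemma generically_override:
  assumes "f \<in> poly_funs I" "f x \<noteq> 0"
  shows "generically K (\<lambda>y. f (override_on x y K) \<noteq> 0)"
proof (rule genericallyI[where w="\<lambda>y. f (override_on x y K)" and x=x, OF poly_funs_override[OF assms(1)]])
  have "override_on x x K = x" by (auto simp: override_on_def)
  then show "f (override_on x x K) \<noteq> 0" using assms(2) by simp
qed

text \<open>
  Rows \<open>1\<close> and \<open>2\<close> of the parameter \<open>x\<close> hold the equations of a linear section; row \<open>3\<close> holds an
  auxiliary linear form whose values tell the points apart, so that one univariate polynomial can be
  made to vanish at all of them.
\<close>

definition separated_points :: "nat \<Rightarrow> (nat \<Rightarrow> complex) set \<Rightarrow> nat \<Rightarrow> (nat \<times> nat \<Rightarrow> complex) \<Rightarrow> bool" where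
  "separated_points n X k x \<longleftrightarrow> (\<exists>Y. (\<forall>r<k. Y r \<in> X \<and>
      (\<forall>i\<in>{1..2}. (\<Sum>j=1..n. x (i, j) * Y r j) = x (i, 0))) \<and>
      inj_on (\<lambda>r. \<Sum>j=1..n. x (3, j) * Y r j) {..<k})"

abbreviation section_params :: "nat \<Rightarrow> (nat \<times> nat) set" where
  "section_params n \<equiv> {1..3} \<times> {0..n}"

text \<open>The coordinates of the \<open>k\<close> points become further variables, in the rows \<open>4\<close> to \<open>k + 3\<close>.\<close>

lemma separated_points_constructible:
  assumes X: "zariski_closed {1..n} X"
  shows "separated_points n X k \<in> constructible (section_params n)"
proof -
  obtain S where S: "finite S" "S \<subseteq> poly_funs {1..n}" "X = {x \<in> affine_space {1..n}. \<forall>f\<in>S. f x = 0}"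
    using zariski_closed_finite[OF _ X] by auto
  define K where "K = {4..<4 + k} \<times> {1..n}"
  let ?J = "section_params n \<union> K"
  define A where "A r x \<longleftrightarrow> (\<forall>f\<in>S. f (\<lambda>j. x (4 + r, j)) = 0) \<and>
    (\<forall>i\<in>{1..2}. (\<Sum>j=1..n. x (i, j) * x (4 + r, j)) - x (i, 0) = 0)"
    for r and x :: "nat \<times> nat \<Rightarrow> complex"
  define l where "l r x = (\<Sum>j=1..n. x (3, j) * x (4 + r, j))" for r and x :: "nat \<times> nat \<Rightarrow> complex"
  define B where "B r r' x \<longleftrightarrow> r \<noteq> r' \<longrightarrow> l r x - l r' x \<noteq> 0"
    for r r' and x :: "nat \<times> nat \<Rightarrow> complex"
  have l: "l r \<in> poly_funs ?J" if "r < k" for r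
    unfolding l_def[abs_def] using that
    by (intro poly_funs_sum poly_funs.mult poly_funs.coord) (auto simp: K_def)
  have "A r \<in> constructible ?J" if r: "r < k" for r
  proof -
    have f: "(\<lambda>x. f (\<lambda>j. x (4 + r, j))) \<in> poly_funs ?J" if "f \<in> S" for f
    proof (rule poly_funs_subst[where I="{1..n}" and g="\<lambda>x j. x (4 + r, j)"])
      show "f \<in> poly_funs {1..n}" using S(2) that by (rule subsetD)
      show "(\<lambda>x. x (4 + r, j)) \<in> poly_funs ?J" if "j \<in> {1..n}" for j
        using r that by (intro poly_funs.coord) (auto simp: K_def)
    qed
    have g: "(\<lambda>x. (\<Sum>j=1..n. x (i, j) * x (4 + r, j)) - x (i, 0)) \<in> poly_funs ?J" if "i \<in> {1..2}" for i
      using r that by (intro poly_funs_diff poly_funs_sum poly_funs.mult poly_funs.coord) (auto simp: K_def)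
    have "(\<lambda>x. \<forall>f\<in>S. f (\<lambda>j. x (4 + r, j)) = 0) \<in> constructible ?J"
      by (rule constructible_ball[OF S(1) constructible.zero[OF f]])
    moreover have "(\<lambda>x. \<forall>i\<in>{1..2}. (\<Sum>j=1..n. x (i, j) * x (4 + r, j)) - x (i, 0) = 0) \<in> constructible ?J"
      by (rule constructible_ball[OF _ constructible.zero[OF g]]) simp_all
    ultimately show ?thesis unfolding A_def[abs_def] by (rule constructible.conj)
  qed
  then have 1: "(\<lambda>x. \<forall>r\<in>{..<k}. A r x) \<in> constructible ?J" by (intro constructible_ball) auto
  have "B r r' \<in> constructible ?J" if "r < k" "r' < k" for r r'
  proof (cases "r = r'")
    case True
    then show ?thesis using constructible_const[of True] by (simp add: B_def[abs_def])
  next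
    case False
    then show ?thesis
      using constructible_nonzero[OF poly_funs_diff[OF l[OF that(1)] l[OF that(2)]]]
      by (simp add: B_def[abs_def])
  qed
  then have 2: "(\<lambda>x. \<forall>r\<in>{..<k}. \<forall>r'\<in>{..<k}. B r r' x) \<in> constructible ?J"
    by (intro constructible_ball) auto
  have mem: "(\<lambda>x. \<exists>y. (\<forall>r\<in>{..<k}. A r (override_on x y K)) \<and>
      (\<forall>r\<in>{..<k}. \<forall>r'\<in>{..<k}. B r r' (override_on x y K))) \<in> constructible (section_params n)"
    by (rule constructible_exists_many[OF _ constructible.conj[OF 1 2]]) (auto simp: K_def)
  have "separated_points n X k x \<longleftrightarrow> (\<exists>y. (\<forall>r\<in>{..<k}. A r (override_on x y K)) \<and>
      (\<forall>r\<in>{..<k}. \<forall>r'\<in>{..<k}. B r r' (override_on x y K)))" for x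
  proof
    assume "separated_points n X k x"
    then obtain Y where Y: "\<forall>r<k. Y r \<in> X \<and> (\<forall>i\<in>{1..2}. (\<Sum>j=1..n. x (i, j) * Y r j) = x (i, 0))"
      "inj_on (\<lambda>r. \<Sum>j=1..n. x (3, j) * Y r j) {..<k}"
      unfolding separated_points_def by (elim exE conjE)
    define z where "z = override_on x (\<lambda>p. Y (fst p - 4) (snd p)) K"
    have z: "z (4 + r, j) = Y r j" if "r < k" "j \<in> {1..n}" for r j
      using that by (simp add: z_def K_def)
    have zx: "z (i, j) = x (i, j)" if "i \<le> 3" for i j
      using that by (simp add: z_def K_def override_on_def)
    have "A r z" if r: "r < k" for r
      unfolding A_def
    proof (intro conjI ballI)
      fix f assume f: "f \<in> S"
      then have "f (\<lambda>j. z (4 + r, j)) = f (Y r)"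
        using S(2) r z by (intro poly_funs_cong[of f "{1..n}"]) auto
      then show "f (\<lambda>j. z (4 + r, j)) = 0" using Y(1) r f S(3) by simp
    next
      fix i :: nat assume i: "i \<in> {1..2}"
      have "(\<Sum>j=1..n. z (i, j) * z (4 + r, j)) = (\<Sum>j=1..n. x (i, j) * Y r j)"
        using r i by (intro sum.cong) (auto simp: z zx)
      then show "(\<Sum>j=1..n. z (i, j) * z (4 + r, j)) - z (i, 0) = 0" using Y(1) r i by (simp add: zx)
    qed
    moreover have "B r r' z" if "r < k" "r' < k" for r r'
    proof -
      have "l s z = (\<Sum>j=1..n. x (3, j) * Y s j)" if "s < k" for s
        unfolding l_def using that by (intro sum.cong) (auto simp: z zx)
      then show ?thesis using that inj_onD[OF Y(2), of r r'] by (auto simp: B_def)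
    qed
    ultimately show "\<exists>y. (\<forall>r\<in>{..<k}. A r (override_on x y K)) \<and>
      (\<forall>r\<in>{..<k}. \<forall>r'\<in>{..<k}. B r r' (override_on x y K))"
      unfolding z_def by (intro exI[of _ "\<lambda>p. Y (fst p - 4) (snd p)"]) auto
  next
    assume "\<exists>y. (\<forall>r\<in>{..<k}. A r (override_on x y K)) \<and>
      (\<forall>r\<in>{..<k}. \<forall>r'\<in>{..<k}. B r r' (override_on x y K))"
    then obtain y where y: "(\<forall>r\<in>{..<k}. A r (override_on x y K)) \<and>
      (\<forall>r\<in>{..<k}. \<forall>r'\<in>{..<k}. B r r' (override_on x y K))" ..
    define z where "z = override_on x y K"
    have zx: "z (i, j) = x (i, j)" if "i \<le> 3" for i j
      using that by (simp add: z_def K_def override_on_def)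
    define Y where "Y r = restrict (\<lambda>j. z (4 + r, j)) {1..n}" for r
    have "Y r \<in> X \<and> (\<forall>i\<in>{1..2}. (\<Sum>j=1..n. x (i, j) * Y r j) = x (i, 0))" if r: "r < k" for r
    proof (intro conjI ballI)
      have "A r z" using y r by (simp add: z_def)
      have "\<forall>f\<in>S. f (Y r) = 0"
      proof
        fix f assume f: "f \<in> S"
        then have "f (\<lambda>j. z (4 + r, j)) = 0" using \<open>A r z\<close> by (simp add: A_def)
        moreover have "f (Y r) = f (\<lambda>j. z (4 + r, j))"
          unfolding Y_def by (rule poly_funs_restrict[OF subsetD[OF S(2) f]])
        ultimately show "f (Y r) = 0" by simp
      qed
      moreover have "Y r \<in> affine_space {1..n}" by (simp add: Y_def affine_space_def)
      ultimately show "Y r \<in> X" unfolding S(3) by simp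
      fix i :: nat assume i: "i \<in> {1..2}"
      have "(\<Sum>j=1..n. x (i, j) * Y r j) = (\<Sum>j=1..n. z (i, j) * z (4 + r, j))"
        using i by (intro sum.cong) (auto simp: zx Y_def)
      then show "(\<Sum>j=1..n. x (i, j) * Y r j) = x (i, 0)"
        using \<open>A r z\<close> i zx[of i 0] by (simp add: A_def)
    qed
    moreover have "inj_on (\<lambda>r. \<Sum>j=1..n. x (3, j) * Y r j) {..<k}"
    proof (rule inj_onI)
      have l: "l s z = (\<Sum>j=1..n. x (3, j) * Y s j)" for s
        unfolding l_def by (intro sum.cong) (auto simp: zx Y_def)
      fix r r' assume "r \<in> {..<k}" "r' \<in> {..<k}"
        "(\<Sum>j=1..n. x (3, j) * Y r j) = (\<Sum>j=1..n. x (3, j) * Y r' j)"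
      then show "r = r'" using y by (auto simp: B_def z_def[symmetric] l)
    qed
    ultimately show "separated_points n X k x" unfolding separated_points_def by (intro exI[of _ Y]) auto
  qed
  then have "separated_points n X k = (\<lambda>x. \<exists>y. (\<forall>r\<in>{..<k}. A r (override_on x y K)) \<and>
      (\<forall>r\<in>{..<k}. \<forall>r'\<in>{..<k}. B r r' (override_on x y K)))" by (rule ext)
  then show ?thesis using mem by (simp only:)
qed

text \<open>
  Almost every linear form separates finitely many points, so row \<open>3\<close> can be changed to one that does
  while \<open>v\<close> remains nonzero.
\<close>

lemma separate_points:
  assumes X: "X \<subseteq> affine_space {1..n}" and A: "A \<subseteq> X \<inter> linear_section n 2 x" "finite A" "card A = k"
    and v: "v \<in> poly_funs I" "v x \<noteq> 0"
  shows "\<exists>x'. v x' \<noteq> 0 \<and> separated_points n X k x'"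
proof -
  define K where "K = {3::nat} \<times> {1..n}"
  have sep: "generically K (\<lambda>y. (\<Sum>j=1..n. y (3, j) * (a j - b j)) \<noteq> 0)" if ab: "a \<in> A" "b \<in> A" "a \<noteq> b" for a b
  proof -
    have "a \<in> affine_space {1..n}" "b \<in> affine_space {1..n}" using ab A X by auto
    then obtain i where i: "i \<in> {1..n}" "a i \<noteq> b i"
      using ab(3) by (metis affine_space_def PiE_ext)
    have f: "(\<lambda>y. \<Sum>j=1..n. y (3::nat, j) * (a j - b j)) \<in> poly_funs K"
      by (intro poly_funs_sum poly_funs.mult poly_funs.coord poly_funs.const) (auto simp: K_def)
    show ?thesis
    proof (rule genericallyI[OF f, of "\<lambda>p. if snd p = i then 1 else 0"])
      have "(\<Sum>j=1..n. (if j = i then 1 else 0) * (a j - b j)) = a i - b i"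
        using i(1) by (simp add: if_distrib[of "\<lambda>c. c * _"] cong: if_cong)
      then show "(\<Sum>j=1..n. (if snd (3::nat, j) = i then 1 else 0) * (a j - b j)) \<noteq> 0" using i(2) by simp
    qed
  qed
  have "generically K (\<lambda>y. \<forall>ab\<in>{ab \<in> A \<times> A. fst ab \<noteq> snd ab}. (\<Sum>j=1..n. y (3, j) * (fst ab j - snd ab j)) \<noteq> 0)"
    by (rule generically_ball) (use A(2) sep in auto)
  from generically_ex[OF generically_conj[OF this generically_override[of v I x K]]] v
  obtain y where y: "(\<forall>ab\<in>{ab \<in> A \<times> A. fst ab \<noteq> snd ab}. (\<Sum>j=1..n. y (3, j) * (fst ab j - snd ab j)) \<noteq> 0) \<and>
    v (override_on x y K) \<noteq> 0" by auto
  define x' where "x' = override_on x y K"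
  have x': "x' (i, j) = x (i, j)" if "i \<le> 2" for i j
    using that by (simp add: x'_def K_def override_on_def)
  have x'3: "x' (3, j) = y (3, j)" if "j \<in> {1..n}" for j
    using that by (simp add: x'_def K_def override_on_def)
  obtain Y where Y: "bij_betw Y {..<k} A"
    using ex_bij_betw_nat_finite[OF A(2)] A(3) by (auto simp: atLeast0LessThan)
  have "Y r \<in> X \<and> (\<forall>i\<in>{1..2}. (\<Sum>j=1..n. x' (i, j) * Y r j) = x' (i, 0))" if "r < k" for r
  proof -
    have "Y r \<in> A" using bij_betwE[OF Y] that by auto
    then have "Y r \<in> X" "Y r \<in> linear_section n 2 x" using A(1) by auto
    then show ?thesis by (auto simp: linear_section_def x')
  qed
  moreover have "inj_on (\<lambda>r. \<Sum>j=1..n. x' (3, j) * Y r j) {..<k}"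
  proof (rule inj_onI, rule ccontr)
    fix r s assume rs: "r \<in> {..<k}" "s \<in> {..<k}" and eq: "(\<Sum>j=1..n. x' (3, j) * Y r j) = (\<Sum>j=1..n. x' (3, j) * Y s j)"
      and "r \<noteq> s"
    then have "Y r \<noteq> Y s" "Y r \<in> A" "Y s \<in> A"
      using bij_betw_imp_inj_on[OF Y] bij_betwE[OF Y] by (auto dest: inj_onD)
    then have "(\<Sum>j=1..n. y (3, j) * (Y r j - Y s j)) \<noteq> 0" using y by force
    moreover have "(\<Sum>j=1..n. y (3, j) * (Y r j - Y s j)) = (\<Sum>j=1..n. x' (3, j) * Y r j) - (\<Sum>j=1..n. x' (3, j) * Y s j)"
      unfolding sum_subtractf[symmetric] by (intro sum.cong) (auto simp: x'3 algebra_simps)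
    ultimately show False using eq by simp
  qed
  ultimately have "separated_points n X k x'" unfolding separated_points_def by (intro exI[of _ Y]) auto
  then show ?thesis using y unfolding x'_def by (intro exI[of _ "override_on x y K"]) simp
qed

lemma separated_points_card:
  assumes "separated_points n X k x" "X \<subseteq> affine_space {1..n}"
  shows "\<exists>A. A \<subseteq> X \<inter> linear_section n 2 x \<and> finite A \<and> card A = k"
proof -
  obtain Y where Y: "\<forall>r<k. Y r \<in> X \<and> (\<forall>i\<in>{1..2}. (\<Sum>j=1..n. x (i, j) * Y r j) = x (i, 0))"
    "inj_on (\<lambda>r. \<Sum>j=1..n. x (3, j) * Y r j) {..<k}"
    using assms(1) unfolding separated_points_def by (elim exE conjE)
  have "inj_on Y {..<k}"
  proof (rule inj_onI)
    fix r s assume "r \<in> {..<k}" "s \<in> {..<k}" "Y r = Y s"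
    then show "r = s" using inj_onD[OF Y(2), of r s] by simp
  qed
  then have "card (Y ` {..<k}) = k" by (simp add: card_image)
  moreover have "Y ` {..<k} \<subseteq> X \<inter> linear_section n 2 x"
    using Y(1) assms(2) by (auto simp: linear_section_def)
  ultimately show ?thesis by (intro exI[of _ "Y ` {..<k}"]) auto
qed

lemma generic_section_count_unique:
  assumes "generic_section_count n d V k" "generic_section_count n d V l"
  shows "k = l"
proof -
  let ?I = "{1..d} \<times> {0..n}"
  have nz: "\<exists>f. f \<in> poly_funs ?I \<and> (\<forall>z\<in>W. f z = 0) \<and> (\<exists>x. f x \<noteq> 0)"
    if W: "zariski_closed ?I W" "W \<noteq> affine_space ?I" for W
  proof -
    obtain x where x: "x \<in> affine_space ?I" "x \<notin> W" using W zariski_closed_affine[OF W(1)] by auto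
    from zariski_closed_separate[OF W(1) x] obtain f
      where "f \<in> poly_funs ?I" "\<forall>z\<in>W. f z = 0" "f x \<noteq> 0" by (elim exE conjE)
    then show ?thesis by (intro exI[of _ f] conjI exI[of _ x])
  qed
  obtain W where W: "zariski_closed ?I W" "W \<noteq> affine_space ?I"
    "\<forall>p\<in>affine_space ?I - W. card (V \<inter> linear_section n d p) = k"
    using assms(1) unfolding generic_section_count_def by blast
  obtain W' where W': "zariski_closed ?I W'" "W' \<noteq> affine_space ?I"
    "\<forall>p\<in>affine_space ?I - W'. card (V \<inter> linear_section n d p) = l"
    using assms(2) unfolding generic_section_count_def by blast
  from nz[OF W(1,2)] obtain f x where f: "f \<in> poly_funs ?I" "\<forall>z\<in>W. f z = 0" "f x \<noteq> 0" by (elim exE conjE)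
  from nz[OF W'(1,2)] obtain g y where g: "g \<in> poly_funs ?I" "\<forall>z\<in>W'. g z = 0" "g y \<noteq> 0" by (elim exE conjE)
  from poly_funs_mult_nonzero[of f ?I g x y] f g obtain z where z: "f z \<noteq> 0" "g z \<noteq> 0" by auto
  define p where "p = restrict z ?I"
  have "p \<in> affine_space ?I" by (simp add: p_def affine_space_def)
  moreover have "f p \<noteq> 0" "g p \<noteq> 0"
    unfolding p_def poly_funs_restrict[OF f(1)] poly_funs_restrict[OF g(1)] using z by simp_all
  then have "p \<notin> W" "p \<notin> W'" using f(2) g(2) by auto
  ultimately have "p \<in> affine_space ?I - W" "p \<in> affine_space ?I - W'" by simp_all
  with W(3) W'(3) show ?thesis by metis
qed

text \<open>
  Suppose that generic sections have \<open>k\<close> points separated by a third linear form. Then the products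
  \<open>\<lambda>\<^sub>1 ^ a * \<lambda>\<^sub>2 ^ b * \<lambda>\<^sub>3 ^ s\<close> with \<open>s < k\<close> are linearly independent on \<open>X\<close>: a relation becomes, at the
  \<open>k\<close> points with \<open>\<lambda>\<^sub>1 = z\<^sub>1\<close> and \<open>\<lambda>\<^sub>2 = z\<^sub>2\<close>, a polynomial in \<open>\<lambda>\<^sub>3\<close> of degree less than \<open>k\<close> with \<open>k\<close> roots.
  So the space of polynomials of degree at most \<open>m\<close> on \<open>X\<close> has dimension at least about \<open>k * m\<^sup>2 / 2\<close>.
\<close>

lemma separated_points_growth:
  assumes \<psi>: "\<And>s t. \<psi> s t \<in> affine_space {1..n}"
      "\<And>s t j. j \<in> {1..n} \<Longrightarrow> \<psi> s t j = eval2 (F j) s t"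
    and X: "X = zariski_closure {1..n} (range (\<lambda>(s, t). \<psi> s t))"
    and gen: "generically (section_params n) (separated_points n X k)"
    and L: "finite L" "\<And>H. polys_upto (F ` {1..n}) m H \<Longrightarrow> H \<noteq> 0 \<Longrightarrow> \<exists>(i, j)\<in>L. coeff (coeff H i) j \<noteq> 0"
    and m: "k \<le> m"
  shows "real k * real (m - k) ^ 2 / 2 \<le> real (card L)"
proof -
  \<comment> \<open>\<open>s < k\<close> and \<open>a + b \<le> m - k\<close> keep the degree of the products below \<open>m\<close>.\<close>
  define M where "M = m - k"
  define T where "T = Sigma {..M} (\<lambda>a. {..M - a})"
  define U where "U = {..<k} \<times> T"
  have "M ^ 2 \<le> 2 * card T"
  proof -
    have "card T = (\<Sum>a\<le>M. Suc (M - a))" unfolding T_def by (subst card_SigmaI) auto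
    also have "2 * \<dots> = (M + 1) * (M + 2)"
      by (induction M) (simp_all add: sum.atMost_Suc_shift algebra_simps del: sum.atMost_Suc)
    finally show ?thesis by (simp add: power2_eq_square algebra_simps)
  qed
  then have "k * M ^ 2 \<le> 2 * card U" unfolding U_def card_cartesian_product card_lessThan
    by (metis mult.left_commute mult_le_mono2)
  then have cardU: "real k * real M ^ 2 / 2 \<le> real (card U)"
    by (metis (mono_tags, lifting) divide_le_eq_numeral1(1) mult.commute of_nat_le_iff of_nat_mult of_nat_numeral of_nat_power)
  have "card U \<le> card L"
  proof (rule ccontr)
    assume "\<not> card U \<le> card L"
    then have card: "card L < card U" by simp
    obtain w x where w: "w \<in> poly_funs (section_params n)" "w x \<noteq> 0"
      "\<forall>x. w x \<noteq> 0 \<longrightarrow> separated_points n X k x"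
      using genericallyD[OF gen] by (elim exE conjE)
    define \<Lambda> where "\<Lambda> i = (\<Sum>j=1..n. [:[:x (i, j):]:] * F j)" for i
    define l where "l i y = (\<Sum>j=1..n. x (i, j) * y j)" for i and y :: "nat \<Rightarrow> complex"
    have eval_\<Lambda>: "eval2 (\<Lambda> i) s t = l i (\<psi> s t)" for i s t
      unfolding \<Lambda>_def l_def eval2_sum by (intro sum.cong) (simp_all add: \<psi>(2) eval2_simps(5) del: mult_pCons_left)
    have \<Lambda>: "polys_upto (F ` {1..n}) 1 (\<Lambda> i)" for i
      unfolding \<Lambda>_def
    proof (intro polys_upto_sum polys_upto_smult)
      fix j assume "j \<in> {1..n}"
      then have "polys_upto (F ` {1..n}) (Suc 0) ([:[:1:]:] * F j)"
        by (intro polys_upto.gen polys_upto.const) simp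
      then show "polys_upto (F ` {1..n}) 1 (F j)"
        by (simp only: one_pCons[symmetric] mult_1_left One_nat_def)
    qed simp
    define G where "G u = (\<Lambda> 1 ^ fst (snd u) * \<Lambda> 2 ^ snd (snd u)) * \<Lambda> 3 ^ fst u" for u :: "nat \<times> nat \<times> nat"
    have G: "polys_upto (F ` {1..n}) m (G u)" if "u \<in> U" for u
    proof -
      have "polys_upto (F ` {1..n}) (fst (snd u) + snd (snd u) + fst u) (G u)"
        unfolding G_def by (intro polys_upto_mult polys_upto_power \<Lambda>)
      moreover have "fst (snd u) + snd (snd u) + fst u \<le> m"
        using that m by (auto simp: U_def T_def M_def)
      ultimately show ?thesis by (rule polys_upto_lift)
    qed
    have finU: "finite U" by (simp add: U_def T_def)
    have "\<exists>c. (\<exists>u\<in>U. c u \<noteq> 0) \<and> (\<Sum>u\<in>U. [:[:c u:]:] * G u) = 0"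
      by (rule linear_dependence_by_positions[OF finU L(1) card])
        (rule L(2), rule polys_upto_sum[OF finU polys_upto_smult[OF G]], assumption+)
    then obtain c where c: "(\<exists>u\<in>U. c u \<noteq> 0) \<and> (\<Sum>u\<in>U. [:[:c u:]:] * G u) = 0" ..
    define q where "q y = (\<Sum>u\<in>U. c u * ((l 1 y ^ fst (snd u) * l 2 y ^ snd (snd u)) * l 3 y ^ fst u))" for y
    have l_poly: "l i \<in> poly_funs {1..n}" for i unfolding l_def[abs_def]
      by (intro poly_funs_sum poly_funs.mult poly_funs.coord poly_funs.const)
    have q_poly: "q \<in> poly_funs {1..n}" unfolding q_def[abs_def]
      by (intro poly_funs_sum poly_funs.mult poly_funs.const poly_funs_power l_poly)
    have q0: "q y = 0" if "y \<in> X" for y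
    proof (rule zariski_closure_vanishes[OF _ q_poly _ that[unfolded X]])
      show "range (\<lambda>(s, t). \<psi> s t) \<subseteq> affine_space {1..n}" using \<psi>(1) by auto
      fix y assume "y \<in> range (\<lambda>(s, t). \<psi> s t)"
      then obtain s t where y: "y = \<psi> s t" by auto
      have "q y = eval2 (\<Sum>u\<in>U. [:[:c u:]:] * G u) s t"
        unfolding q_def y G_def by (simp only: eval2_simps eval2_sum eval_\<Lambda>)
      also have "\<dots> = 0" unfolding c[THEN conjunct2] by simp
      finally show "q y = 0" .
    qed
    \<comment> \<open>the coefficient of \<open>\<lambda>\<^sub>3 ^ s\<close> in the relation, as a polynomial in the values of \<open>\<lambda>\<^sub>1\<close> and \<open>\<lambda>\<^sub>2\<close>\<close>
    define R where "R s z1 z2 = (\<Sum>ab\<in>T. c (s, ab) * (z1 ^ fst ab * z2 ^ snd ab))" for s z1 z2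
    have R0: "R s z1 z2 = 0" if nz: "w (x((1, 0) := z1, (2, 0) := z2)) \<noteq> 0" and s: "s < k" for s z1 z2
    proof -
      define x' where "x' = x((1, 0) := z1, (2, 0) := z2)"
      have "separated_points n X k x'" using w(3) nz by (simp add: x'_def)
      then obtain Y where Y: "\<forall>r<k. Y r \<in> X \<and> (\<forall>i\<in>{1..2}. (\<Sum>j=1..n. x' (i, j) * Y r j) = x' (i, 0))"
        "inj_on (\<lambda>r. \<Sum>j=1..n. x' (3, j) * Y r j) {..<k}"
        unfolding separated_points_def by (elim exE conjE)
      have l_eq: "(\<Sum>j=1..n. x' (i, j) * y j) = l i y" for i y
        unfolding l_def by (intro sum.cong) (auto simp: x'_def)
      have Y12: "l 1 (Y r) = z1" "l 2 (Y r) = z2" if "r < k" for r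
        using Y(1) that unfolding l_eq by (auto simp: x'_def)
      define p where "p = (\<Sum>s<k. monom (R s z1 z2) s)"
      have poly_p: "poly p v = (\<Sum>s<k. R s z1 z2 * v ^ s)" for v by (simp add: p_def poly_sum poly_monom)
      have root: "poly p (l 3 (Y r)) = 0" if r: "r < k" for r
      proof -
        have "q (Y r) = (\<Sum>s<k. \<Sum>ab\<in>T. c (s, ab) * ((z1 ^ fst ab * z2 ^ snd ab) * l 3 (Y r) ^ s))"
          unfolding q_def U_def Y12[OF r] by (simp add: sum.cartesian_product split_beta)
        also have "\<dots> = poly p (l 3 (Y r))"
          by (simp add: poly_p R_def sum_distrib_left sum_distrib_right mult_ac)
        finally show ?thesis using q0 Y(1) r by simp
      qed
      have "p = 0"
      proof (rule poly_eqI_degree)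
        show "poly p v = poly 0 v" if "v \<in> (\<lambda>r. l 3 (Y r)) ` {..<k}" for v using that root by auto
        have "card ((\<lambda>r. l 3 (Y r)) ` {..<k}) = k"
          using Y(2) unfolding l_eq by (simp add: card_image)
        moreover have "degree p \<le> k - 1"
          unfolding p_def by (intro degree_sum_le) (auto intro: order_trans[OF degree_monom_le])
        ultimately show "degree p < card ((\<lambda>r. l 3 (Y r)) ` {..<k})"
          "degree 0 < card ((\<lambda>r. l 3 (Y r)) ` {..<k})" using s by simp_all
      qed
      then have "coeff p s = 0" by simp
      moreover have "coeff p s = R s z1 z2" using s by (simp add: p_def coeff_sum)
      ultimately show ?thesis by simp
    qed
    have R_zero: "R s z1 z2 = 0" if s: "s < k" for s z1 z2
    proof (rule ccontr)
      assume nz: "R s z1 z2 \<noteq> 0"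
      define K where "K = {(1, 0), (2, 0) :: nat \<times> nat}"
      have f: "(\<lambda>y. R s (y (1, 0)) (y (2, 0))) \<in> poly_funs K" unfolding R_def
        by (intro poly_funs_sum poly_funs.mult poly_funs.const poly_funs_power poly_funs.coord) (auto simp: K_def)
      have "generically K (\<lambda>y. R s (y (1, 0)) (y (2, 0)) \<noteq> 0)"
        by (rule genericallyI[OF f, of "\<lambda>p. if p = (1, 0) then z1 else z2"]) (use nz in simp_all)
      from generically_ex[OF generically_conj[OF this generically_override[of w "section_params n" x K]]] w
      obtain y where y: "R s (y (1, 0)) (y (2, 0)) \<noteq> 0" "w (override_on x y K) \<noteq> 0" by auto
      have "override_on x y K = x((1, 0) := y (1, 0), (2, 0) := y (2, 0))"
        by (auto simp: override_on_def K_def fun_eq_iff)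
      then show False using R0[OF _ s, of "y (1, 0)" "y (2, 0)"] y by simp
    qed
    have "c (s, a, b) = 0" if "s < k" "(a, b) \<in> T" for s a b
    proof -
      have ab: "a \<le> M" "b \<le> M - a" using that(2) by (auto simp: T_def)
      have "(\<Sum>a\<le>M. (\<Sum>b\<le>M - a. c (s, a, b) * z2 ^ b) * z1 ^ a) = 0" for z1 z2
      proof -
        have "R s z1 z2 = (\<Sum>(a, b)\<in>Sigma {..M} (\<lambda>a. {..M - a}). c (s, a, b) * (z1 ^ a * z2 ^ b))"
          by (simp add: R_def T_def split_beta)
        also have "\<dots> = (\<Sum>a\<le>M. \<Sum>b\<le>M - a. c (s, a, b) * (z1 ^ a * z2 ^ b))"
          by (rule sum.Sigma[symmetric]) auto
        also have "\<dots> = (\<Sum>a\<le>M. (\<Sum>b\<le>M - a. c (s, a, b) * z2 ^ b) * z1 ^ a)"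
          by (simp add: sum_distrib_left sum_distrib_right mult_ac)
        finally show ?thesis using R_zero[OF that(1)] by simp
      qed
      then have "(\<Sum>b\<le>M - a. c (s, a, b) * z2 ^ b) = 0" for z2
        using polynomial_zero_coeffs[OF _ ab(1), of "\<lambda>a. \<Sum>b\<le>M - a. c (s, a, b) * z2 ^ b"] by blast
      then show ?thesis using polynomial_zero_coeffs[OF _ ab(2), of "\<lambda>b. c (s, a, b)"] by blast
    qed
    then show False using c by (auto simp: U_def)
  qed
  then have "real (card U) \<le> real (card L)" by simp
  then show ?thesis using cardU unfolding M_def by linarith
qed

text \<open>
  The growth bound leaves finitely many \<open>k\<close> such that generic sections have \<open>k\<close> separated points. For the
  largest one, the dichotomy for constructible conditions excludes \<open>k + 1\<close> separated points on generic
  sections, which therefore have exactly \<open>k\<close> points.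
\<close>

lemma variety_degree_le:
  assumes \<psi>: "\<And>s t. \<psi> s t \<in> affine_space {1..n}"
      "\<And>s t j. j \<in> {1..n} \<Longrightarrow> \<psi> s t j = eval2 (F j) s t"
    and X: "X = zariski_closure {1..n} (range (\<lambda>(s, t). \<psi> s t))"
    and dim: "variety_dim {1..n} X = 2"
    and L: "\<And>m. finite (L m)" "\<And>m H. polys_upto (F ` {1..n}) m H \<Longrightarrow> H \<noteq> 0 \<Longrightarrow>
      \<exists>(i, j)\<in>L m. coeff (coeff H i) j \<noteq> 0"
    and B: "\<And>k. (\<And>m. k \<le> m \<Longrightarrow> real k * real (m - k) ^ 2 / 2 \<le> real (card (L m))) \<Longrightarrow> real k \<le> B"
  shows "real (variety_degree n X) \<le> B"
proof -
  let ?I = "{1..2::nat} \<times> {0..n}"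
  have closed: "zariski_closed {1..n} X" unfolding X by (rule zariski_closed_closure) (use \<psi>(1) in auto)
  then have X_aff: "X \<subseteq> affine_space {1..n}" by (rule zariski_closed_affine)
  define gen where "gen k \<longleftrightarrow> generically (section_params n) (separated_points n X k)" for k
  have gen_le: "real k \<le> B" if "gen k" for k
    by (rule B, rule separated_points_growth[OF \<psi> X _ L]) (use that in \<open>simp_all add: gen_def\<close>)
  have "separated_points n X 0 x" for x by (simp add: separated_points_def)
  then have "gen 0" unfolding gen_def by (intro generically_mono[OF generically_const[of True]]) simp_all
  moreover have "\<forall>k. gen k \<longrightarrow> k \<le> nat \<lfloor>B\<rfloor>" using gen_le by (auto simp: le_nat_floor)
  ultimately obtain k where k: "gen k" "\<And>l. gen l \<Longrightarrow> l \<le> k"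
    using Greatest_le_nat[of gen _ "nat \<lfloor>B\<rfloor>"] GreatestI_nat[of gen 0 "nat \<lfloor>B\<rfloor>"] by blast
  have "\<not> gen (Suc k)" using k(2)[of "Suc k"] by auto
  then have notgen: "generically (section_params n) (\<lambda>x. \<not> separated_points n X (Suc k) x)"
    using constructible_generically[OF separated_points_constructible[OF closed], of "Suc k"]
    unfolding gen_def by (elim disjE) simp_all
  obtain v y where v: "v \<in> poly_funs (section_params n)" "v y \<noteq> 0" "\<forall>x. v x \<noteq> 0 \<longrightarrow> separated_points n X k x"
    using genericallyD[OF k(1)[unfolded gen_def]] by (elim exE conjE)
  obtain w z where w: "w \<in> poly_funs (section_params n)" "w z \<noteq> 0"
    "\<forall>x. w x \<noteq> 0 \<longrightarrow> \<not> separated_points n X (Suc k) x"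
    using genericallyD[OF notgen] by (elim exE conjE)
  obtain x where x: "v x \<noteq> 0" "w x \<noteq> 0"
    using poly_funs_mult_nonzero[of v "section_params n" w y z] v w by auto
  \<comment> \<open>Row \<open>3\<close> is fixed as in \<open>x\<close>, where neither \<open>v\<close> nor \<open>w\<close> vanishes identically in the other rows.\<close>
  define h where "h p = v (override_on x p ?I) * w (override_on x p ?I)" for p
  have h: "h \<in> poly_funs ?I" unfolding h_def[abs_def]
    by (intro poly_funs.mult poly_funs_override[OF v(1)] poly_funs_override[OF w(1)])
  define W where "W = {p \<in> affine_space ?I. h p = 0}"
  have "generic_section_count n 2 X k"
    unfolding generic_section_count_def
  proof (rule exI[of _ W], intro conjI ballI)
    have "{h} \<subseteq> poly_funs ?I" by (intro insert_subsetI h empty_subsetI)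
    moreover have "W = {p \<in> affine_space ?I. \<forall>f\<in>{h}. f p = 0}" unfolding W_def by simp
    ultimately show "zariski_closed ?I W" unfolding zariski_closed_def by (intro exI[of _ "{h}"] conjI)
    have "override_on x x ?I = x" by (auto simp: override_on_def)
    then have "h x \<noteq> 0" using x by (simp add: h_def)
    moreover have "h (restrict x ?I) = h x" by (rule poly_funs_restrict[OF h])
    ultimately have "h (restrict x ?I) \<noteq> 0" by simp
    then have "restrict x ?I \<in> affine_space ?I" "restrict x ?I \<notin> W"
      by (simp_all add: W_def affine_space_def)
    then show "W \<noteq> affine_space ?I" by metis
    fix p assume "p \<in> affine_space ?I - W"
    then have "h p \<noteq> 0" by (simp add: W_def)
    define x' where "x' = override_on x p ?I"
    have nz: "v x' \<noteq> 0" "w x' \<noteq> 0" using \<open>h p \<noteq> 0\<close> by (simp_all add: h_def x'_def)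
    have sec: "linear_section n 2 p = linear_section n 2 x'"
      by (auto simp: linear_section_def x'_def)
    have "separated_points n X k x'" using v(3) nz(1) by simp
    from separated_points_card[OF this X_aff]
    obtain A where A: "A \<subseteq> X \<inter> linear_section n 2 x'" "finite A" "card A = k" by (elim exE conjE)
    \<comment> \<open>If there were more points, a change of row \<open>3\<close> alone would separate them and keep \<open>w\<close> nonzero.\<close>
    have no: "\<not> (A' \<subseteq> X \<inter> linear_section n 2 x' \<and> finite A' \<and> card A' = Suc k)" for A'
    proof
      assume A': "A' \<subseteq> X \<inter> linear_section n 2 x' \<and> finite A' \<and> card A' = Suc k"
      have "\<exists>x''. w x'' \<noteq> 0 \<and> separated_points n X (Suc k) x''"
        by (rule separate_points[where A=A' and v=w and I="section_params n"])
          (use A' X_aff w(1) nz(2) in simp_all)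
      then show False using w(3) by auto
    qed
    have "X \<inter> linear_section n 2 x' = A"
    proof (rule ccontr)
      assume "X \<inter> linear_section n 2 x' \<noteq> A"
      then obtain a where "a \<in> X \<inter> linear_section n 2 x'" "a \<notin> A" using A(1) by auto
      then show False using no[of "insert a A"] A by simp
    qed
    then show "finite (X \<inter> linear_section n 2 p)" "card (X \<inter> linear_section n 2 p) = k"
      using A sec by simp_all
  qed
  then have "variety_degree n X = k"
    unfolding variety_degree_def dim
    by (intro the_equality generic_section_count_unique[of n 2 X _ k])
  then show ?thesis using gen_le[OF k(1)] by simp
qed

section \<open>Areas and numbers of lattice points\<close>

lemma measure_reflect:
  fixes S :: "(real \<times> real) set"
  assumes S: "S \<in> sets borel" and e: "\<bar>e1\<bar> = 1" "\<bar>e2\<bar> = 1"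
  shows "measure lborel ((\<lambda>z. (e1 * fst z, e2 * snd z)) -` S) = measure lborel S"
proof -
  define T where "T z = (e1 * fst z, e2 * snd z)" for z :: "real \<times> real"
  define c where "c j = (if j = (1, 0) then e1 else e2)" for j :: "real \<times> real"
  have T: "T = (\<lambda>x. 0 + (\<Sum>j\<in>Basis. (c j * (x \<bullet> j)) *\<^sub>R j))"
    by (rule ext) (simp add: T_def c_def Basis_prod_def sum.union_disjoint zero_prod_def inner_prod_def)
  have "(\<Prod>j\<in>Basis. \<bar>c j\<bar>) = 1" by (intro prod.neutral) (use e in \<open>auto simp: c_def\<close>)
  moreover have "c j \<noteq> 0" for j using e by (auto simp: c_def)
  ultimately have "lborel = density (distr lborel borel T) (\<lambda>_. 1)"
    using lborel_affine_euclidean[of c 0] unfolding T by simp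
  then have "lborel = distr lborel borel T" by (simp add: density_1)
  moreover have "T \<in> lborel \<rightarrow>\<^sub>M borel" unfolding T by measurable
  ultimately have "measure lborel S = measure lborel (T -` S)"
    using measure_distr[of T lborel borel S] S by simp
  then show ?thesis by (simp add: T_def[abs_def])
qed

lemma triangle_below_borel:
  "{z :: real \<times> real. c \<le> fst z \<and> fst z \<le> c + d \<and> 0 < snd z \<and> d * snd z < b * (fst z - c)} \<in> sets borel"
  unfolding Collect_conj_eq
  by (intro sets.Int borel_closed closed_Collect_le borel_open open_Collect_less continuous_intros)

lemma triangle_left_borel:
  "{z :: real \<times> real. c \<le> snd z \<and> snd z \<le> c + d \<and> 0 < fst z \<and> d * fst z < b * (snd z - c)} \<in> sets borel"
  unfolding Collect_conj_eq
  by (intro sets.Int borel_closed closed_Collect_le borel_open open_Collect_less continuous_intros)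

lemma measure_triangle_below:
  fixes b c d :: real
  assumes "0 \<le> b" "0 \<le> d"
  shows "measure lborel {z. c \<le> fst z \<and> fst z \<le> c + d \<and> 0 < snd z \<and> d * snd z < b * (fst z - c)} = d * b / 2"
    (is "measure _ ?A = _")
proof (cases "d = 0")
  case True
  have "?A = {}"
  proof (rule equals0I)
    fix z assume "z \<in> ?A"
    then have "fst z = c" "d * snd z < b * (fst z - c)" using True by auto
    then show False using True by simp
  qed
  then have "measure lborel ?A = 0" by (simp only: measure_empty)
  then show ?thesis using True by simp
next
  case False
  have "?A \<in> sets borel" by (rule triangle_below_borel)
  then have A: "?A \<in> sets (lborel \<Otimes>\<^sub>M lborel)" unfolding lborel_prod by simp
  have "emeasure lborel ?A = (\<integral>\<^sup>+x. emeasure lborel (Pair x -` ?A) \<partial>lborel)"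
    using lborel.emeasure_pair_measure_alt[OF A] by (simp add: lborel_prod)
  also have "\<dots> = (\<integral>\<^sup>+x. ennreal (b * (x - c) / d) * indicator {c..c + d} x \<partial>lborel)"
  proof (rule nn_integral_cong)
    fix x
    show "emeasure lborel (Pair x -` ?A) = ennreal (b * (x - c) / d) * indicator {c..c + d} x"
    proof (cases "x \<in> {c..c + d}")
      case True
      have "Pair x -` ?A = {0<..<b * (x - c) / d}"
        using True False assms(2) by (auto simp: field_simps)
      then show ?thesis using True assms by simp
    next
      case False
      then have "Pair x -` ?A = {}" by auto
      then have "emeasure lborel (Pair x -` ?A) = 0" by (simp only: emeasure_empty)
      then show ?thesis using False by simp
    qed
  qed
  also have "\<dots> = ennreal (b * (c + d - c) ^ 2 / (2 * d) - b * (c - c) ^ 2 / (2 * d))"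
  proof (rule nn_integral_FTC_Icc[where F="\<lambda>x. b * (x - c) ^ 2 / (2 * d)"])
    show "(\<lambda>x. b * (x - c) / d) \<in> borel_measurable borel" by measurable
    show "((\<lambda>x. b * (x - c) ^ 2 / (2 * d)) has_real_derivative b * (x - c) / d) (at x)" for x
      using False by (auto intro!: derivative_eq_intros simp: field_simps)
    show "0 \<le> b * (x - c) / d" if "x \<in> {c..c + d}" for x using assms that by simp
  qed (use assms in simp)
  also have "\<dots> = ennreal (d * b / 2)" using False by (simp add: power2_eq_square mult.commute)
  finally show ?thesis using assms by (intro measure_eq_emeasure_eq_ennreal) auto
qed

lemma measure_swap:
  fixes S :: "(real \<times> real) set"
  assumes "S \<in> sets borel"
  shows "measure lborel ((\<lambda>z. (snd z, fst z)) -` S) = measure lborel S"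
proof -
  have "lborel = distr lborel lborel (\<lambda>(x, y). (y, x) :: real \<times> real)"
    using lborel_pair.distr_pair_swap[where 'a=real and 'b=real] by (simp add: lborel_prod)
  then have "measure lborel S = measure (distr lborel lborel (\<lambda>(x, y). (y, x))) S" by simp
  also have "\<dots> = measure lborel ((\<lambda>(x, y). (y, x)) -` S \<inter> space lborel)"
  proof (rule measure_distr)
    show "(\<lambda>(x, y). (y, x)) \<in> lborel \<rightarrow>\<^sub>M (lborel :: (real \<times> real) measure)"
      unfolding measurable_lborel1 measurable_lborel2
      by (intro borel_measurable_continuous_onI) (auto simp: split_beta intro!: continuous_intros)
  qed (use assms in simp)
  finally show ?thesis by (simp add: split_beta')
qed

lemma measure_triangle_left:
  fixes b c d :: real
  assumes "0 \<le> b" "0 \<le> d"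
  shows "measure lborel {z. c \<le> snd z \<and> snd z \<le> c + d \<and> 0 < fst z \<and> d * fst z < b * (snd z - c)} = d * b / 2"
proof -
  let ?A = "{z :: real \<times> real. c \<le> fst z \<and> fst z \<le> c + d \<and> 0 < snd z \<and> d * snd z < b * (fst z - c)}"
  have "?A \<in> sets borel" by (rule triangle_below_borel)
  from measure_swap[OF this] show ?thesis
    unfolding measure_triangle_below[OF assms] by (simp add: vimage_def)
qed

text \<open>
  What the two conditions at infinity leave of \<open>P\<close> in the positive quadrant, after scaling. For positive
  \<open>d\<close> and \<open>d'\<close>, these are the points not below the line
  through \<open>(c, 0)\<close> and \<open>(c + d, b)\<close>, and not to the left of the line through \<open>(0, c')\<close> and
  \<open>(b', c' + d')\<close>.
\<close>

definition admissible_region ::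
    "(real \<times> real) set \<Rightarrow> real \<Rightarrow> real \<Rightarrow> real \<Rightarrow> real \<Rightarrow> real \<Rightarrow> real \<Rightarrow> (real \<times> real) set" where
  "admissible_region P c d b c' d' b' = {z \<in> P. 0 \<le> fst z \<and> 0 \<le> snd z \<and>
     b * (fst z - c) \<le> d * snd z \<and> b' * (snd z - c') \<le> d' * fst z}"

text \<open>
  In the positive quadrant of \<open>P\<close>, the region and the two triangles that it leaves out are disjoint;
  their reflections in the axes overlap in null sets only.
\<close>

lemma area_admissible_region:
  fixes P :: "(real \<times> real) set" and b c d b' c' d' :: real
  assumes P: "compact P" and sym: "\<And>x y. (x, y) \<in> P \<Longrightarrow> (- x, y) \<in> P \<and> (x, - y) \<in> P"
    and nonneg: "0 \<le> b" "0 \<le> c" "0 \<le> d" "0 \<le> b'" "0 \<le> c'" "0 \<le> d'"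
    and rect: "\<And>x y. 0 \<le> x \<Longrightarrow> x \<le> c + d \<Longrightarrow> 0 \<le> y \<Longrightarrow> y \<le> b \<Longrightarrow> (x, y) \<in> P"
      "\<And>x y. 0 \<le> x \<Longrightarrow> x \<le> b' \<Longrightarrow> 0 \<le> y \<Longrightarrow> y \<le> c' + d' \<Longrightarrow> (x, y) \<in> P"
    and disj: "\<And>x y. c \<le> x \<Longrightarrow> x \<le> c + d \<Longrightarrow> 0 < y \<Longrightarrow> d * y < b * (x - c) \<Longrightarrow>
      c' \<le> y \<Longrightarrow> y \<le> c' + d' \<Longrightarrow> 0 < x \<Longrightarrow> d' * x < b' * (y - c') \<Longrightarrow> False"
  shows "4 * (measure lborel (admissible_region P c d b c' d' b') + d * b / 2 + d' * b' / 2) \<le> measure lborel P"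
proof -
  define K where "K = admissible_region P c d b c' d' b'"
  define A where "A = {z :: real \<times> real. c \<le> fst z \<and> fst z \<le> c + d \<and> 0 < snd z \<and> d * snd z < b * (fst z - c)}"
  define B where "B = {z :: real \<times> real. c' \<le> snd z \<and> snd z \<le> c' + d' \<and> 0 < fst z \<and> d' * fst z < b' * (snd z - c')}"
  define U where "U = K \<union> A \<union> B"
  have Pfm: "P \<in> fmeasurable lborel" using fmeasurable_compact[OF P] .
  have Pb [measurable]: "P \<in> sets borel" using P by (simp add: borel_compact)
  have [measurable]: "A \<in> sets borel" unfolding A_def by (rule triangle_below_borel)
  have [measurable]: "B \<in> sets borel" unfolding B_def by (rule triangle_left_borel)
  have "K = P \<inter> {z. 0 \<le> fst z} \<inter> {z. 0 \<le> snd z} \<inter> {z. b * (fst z - c) \<le> d * snd z} \<inter>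
      {z. b' * (snd z - c') \<le> d' * fst z}"
    by (auto simp: K_def admissible_region_def)
  moreover have "closed \<dots>"
    using P by (intro closed_Int closed_Collect_le continuous_intros compact_imp_closed)
  ultimately have [measurable]: "K \<in> sets borel" by (simp add: borel_closed)
  have [measurable]: "U \<in> sets borel" unfolding U_def by measurable
  have A_y: "snd z \<le> b" if "z \<in> A" for z
  proof -
    have "d * snd z < b * (fst z - c)" "0 \<le> fst z - c" "fst z - c \<le> d" using that by (auto simp: A_def)
    then have "d * snd z < b * d" by (meson le_less_trans mult_left_mono nonneg(1) not_le)
    then have "d * snd z < d * b" by (simp add: mult.commute)
    then show ?thesis using nonneg(3) by (simp add: mult_less_cancel_left)
  qed
  have B_x: "fst z \<le> b'" if "z \<in> B" for z
  proof -
    have "d' * fst z < b' * (snd z - c')" "0 \<le> snd z - c'" "snd z - c' \<le> d'" using that by (auto simp: B_def)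
    then have "d' * fst z < b' * d'" by (meson le_less_trans mult_left_mono nonneg(4) not_le)
    then have "d' * fst z < d' * b'" by (simp add: mult.commute)
    then show ?thesis using nonneg(6) by (simp add: mult_less_cancel_left)
  qed
  have UP: "z \<in> P \<and> 0 \<le> fst z \<and> 0 \<le> snd z" if "z \<in> U" for z
  proof -
    have "z \<in> K \<Longrightarrow> ?thesis" by (auto simp: K_def admissible_region_def)
    moreover have "z \<in> A \<Longrightarrow> ?thesis"
      using rect(1)[of "fst z" "snd z"] A_y[of z] nonneg by (auto simp: A_def)
    moreover have "z \<in> B \<Longrightarrow> ?thesis"
      using rect(2)[of "fst z" "snd z"] B_x[of z] nonneg by (auto simp: B_def)
    ultimately show ?thesis using that by (auto simp: U_def)
  qed
  have fm: "X \<in> fmeasurable lborel" if "X \<in> sets borel" "X \<subseteq> P" for X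
    using fmeasurableI2[OF Pfm that(2)] that(1) by simp
  have sub: "K \<subseteq> P" "A \<subseteq> P" "B \<subseteq> P" using UP by (auto simp: U_def)
  have "A \<inter> B = {}" using disj by (auto simp: A_def B_def)
  moreover have "K \<inter> A = {}" "K \<inter> B = {}"
    by (auto simp: K_def A_def B_def admissible_region_def)
  ultimately have "measure lborel U = measure lborel K + measure lborel A + measure lborel B"
    unfolding U_def using sub fm by (subst measure_Un_AE, auto)+
  then have U: "measure lborel U = measure lborel K + d * b / 2 + d' * b' / 2"
    unfolding A_def B_def using nonneg by (simp add: measure_triangle_below measure_triangle_left)
  define E where "E = {1, -1 :: real} \<times> {1, -1 :: real}"
  define R where "R e = (\<lambda>z. (fst e * fst z, snd e * snd z)) -` U" for e
  have R_sub: "R e \<subseteq> P" if "e \<in> E" for e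
  proof
    fix z assume "z \<in> R e"
    then have *: "(fst e * fst z, snd e * snd z) \<in> P" using UP by (auto simp: R_def)
    have "(fst e * (fst e * fst z), snd e * (snd e * snd z)) \<in> P"
      using that sym[OF *] sym[of "- (fst e * fst z)" "snd e * snd z"] * by (auto simp: E_def)
    then show "z \<in> P" using that by (auto simp: E_def)
  qed
  have R_meas: "R e \<in> sets borel" for e
  proof -
    have "(\<lambda>z. (fst e * fst z, snd e * snd z)) \<in> borel_measurable borel"
      by (intro borel_measurable_continuous_onI continuous_intros)
    from measurable_sets_borel[OF this \<open>U \<in> sets borel\<close>] show ?thesis by (simp add: R_def)
  qed
  have "measure lborel (R e) = measure lborel U" if "e \<in> E" for e
    unfolding R_def using that by (intro measure_reflect) (auto simp: E_def)
  then have "4 * measure lborel U = (\<Sum>e\<in>E. measure lborel (R e))"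
    by (simp add: E_def)
  also have "\<dots> = measure lborel (\<Union>e\<in>E. R e)"
  proof (rule measure_UNION_AE[symmetric])
    show "finite E" by (simp add: E_def)
    show "R e \<in> fmeasurable lborel" if "e \<in> E" for e using fm R_meas R_sub[OF that] by simp
    have AE: "AE z :: real \<times> real in lborel. fst z \<noteq> 0 \<and> snd z \<noteq> 0"
    proof -
      have "((1, 0) :: real \<times> real) \<in> Basis" "((0, 1) :: real \<times> real) \<in> Basis" by (auto simp: Basis_prod_def)
      from AE_lborel_inner_neq[OF this(1), of 0] AE_lborel_inner_neq[OF this(2), of 0]
      show ?thesis by eventually_elim (auto simp: inner_prod_def)
    qed
    show "pairwise (\<lambda>e f. AE z in lborel. z \<notin> R e \<or> z \<notin> R f) E"
    proof (rule pairwiseI)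
      fix e f assume ef: "e \<in> E" "f \<in> E" "e \<noteq> f"
      show "AE z in lborel. z \<notin> R e \<or> z \<notin> R f"
        using AE
      proof eventually_elim
        case (elim z)
        show ?case
        proof (rule ccontr)
          assume "\<not> ?thesis"
          then have "(fst e * fst z, snd e * snd z) \<in> U" "(fst f * fst z, snd f * snd z) \<in> U"
            by (auto simp: R_def)
          from UP[OF this(1)] UP[OF this(2)] show False using ef elim by (auto simp: E_def)
        qed
      qed
    qed
  qed
  also have "\<dots> \<le> measure lborel P"
    using R_sub R_meas Pfm by (intro measure_mono_fmeasurable) (auto simp: E_def)
  finally show ?thesis unfolding U K_def .
qed

text \<open>
  The possible leading monomials at level \<open>m\<close>. After scaling by \<open>1 / m\<close> they need not lie in the
  admissible region, because of the rounding in the exponents, but only violate its conditions by a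
  constant multiple of \<open>1 / m\<close>.
\<close>

definition lattice_points ::
    "(real \<times> real) set \<Rightarrow> nat \<Rightarrow> nat \<Rightarrow> nat \<Rightarrow> nat \<Rightarrow> nat \<Rightarrow> nat \<Rightarrow> nat \<Rightarrow> (nat \<times> nat) set" where
  "lattice_points P c d b c' d' b' m = {(i, j). (\<exists>p\<in>P. (real i, real j) = real m *\<^sub>R p) \<and>
     b * ((i - m * c) div d) \<le> j \<and> b' * ((j - m * c') div d') \<le> i}"

lemma floor_condition:
  fixes i j m b c d :: nat
  assumes "b * ((i - m * c) div d) \<le> j" "i \<le> m * (c + d)"
  shows "real b * (real i - real m * real c) \<le> real d * real j + real b * real d"
proof (cases "d = 0")
  case True
  then have "real i \<le> real m * real c" using assms(2) by (metis add.right_neutral of_nat_le_iff of_nat_mult)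
  then show ?thesis using True by (simp add: mult_nonneg_nonpos)
next
  case False
  define q where "q = (i - m * c) div d"
  have "i - m * c \<le> d * q + d" using False
    by (metis add_left_mono div_mult_mod_eq less_imp_le mod_less_divisor mult.commute neq0_conv q_def)
  then have "i \<le> m * c + d * q + d" by linarith
  then have "real i - real m * real c \<le> real d * real q + real d"
    by (metis add.assoc add.commute diff_le_eq of_nat_add of_nat_le_iff of_nat_mult)
  then have "real b * (real i - real m * real c) \<le> real b * (real d * real q + real d)"
    by (intro mult_left_mono) auto
  also have "\<dots> = real d * real (b * q) + real b * real d" by (simp add: algebra_simps)
  also have "real (b * q) \<le> real j" using assms(1) by (simp only: q_def of_nat_le_iff)
  then have "real d * real (b * q) + real b * real d \<le> real d * real j + real b * real d"
    by (intro add_mono mult_left_mono) auto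
  finally show ?thesis .
qed

text \<open>
  A closed neighbourhood of the region that contains, for suitable \<open>\<epsilon>\<close> proportional to \<open>1 / m\<close>, not only
  the scaled lattice points but also the squares of side \<open>1 / m\<close> at them. Counting points thus becomes
  comparing areas, and the area tends to that of the region itself when \<open>\<epsilon>\<close> tends to \<open>0\<close>.
\<close>

definition relaxed_region ::
    "(real \<times> real) set \<Rightarrow> real \<Rightarrow> real \<Rightarrow> real \<Rightarrow> real \<Rightarrow> real \<Rightarrow> real \<Rightarrow> real \<Rightarrow> (real \<times> real) set" where
  "relaxed_region P c d b c' d' b' \<epsilon> = {z. infdist z P \<le> \<epsilon> \<and> 0 \<le> fst z \<and> 0 \<le> snd z \<and>
     b * (fst z - c) \<le> d * snd z + \<epsilon> \<and> b' * (snd z - c') \<le> d' * fst z + \<epsilon>}"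

lemma closed_relaxed_region: "closed (relaxed_region P c d b c' d' b' \<epsilon>)"
  unfolding relaxed_region_def Collect_conj_eq
  by (intro closed_Int closed_Collect_le continuous_intros)

lemma relaxed_region_fmeasurable:
  assumes "compact P" "P \<noteq> {}"
  shows "relaxed_region P c d b c' d' b' \<epsilon> \<in> fmeasurable lborel"
proof -
  obtain r where r: "\<And>p. p \<in> P \<Longrightarrow> norm p \<le> r"
    using compact_imp_bounded[OF assms(1)] unfolding bounded_iff by blast
  have "norm z \<le> r + \<epsilon>" if "z \<in> relaxed_region P c d b c' d' b' \<epsilon>" for z
  proof -
    obtain p where "p \<in> P" "infdist z P = dist z p"
      using infdist_attains_inf[OF compact_imp_closed[OF assms(1)] assms(2)] by blast
    then show ?thesis
      using that r[of p] norm_triangle_sub[of z p] by (simp add: relaxed_region_def dist_norm)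
  qed
  then have "bounded (relaxed_region P c d b c' d' b' \<epsilon>)" unfolding bounded_iff by blast
  then have "compact (relaxed_region P c d b c' d' b' \<epsilon>)"
    using closed_relaxed_region by (simp add: compact_eq_bounded_closed)
  then show ?thesis by (rule fmeasurable_compact)
qed

lemma le_if_le_add_null_sequence:
  assumes "\<And>m. (x :: real) \<le> y + C / real (Suc m)"
  shows "x \<le> y"
proof (rule LIMSEQ_le_const)
  have "(\<lambda>m. y + C * inverse (real (Suc m))) \<longlonglongrightarrow> y + C * 0"
    by (intro tendsto_intros LIMSEQ_inverse_real_of_nat)
  then show "(\<lambda>m. y + C / real (Suc m)) \<longlonglongrightarrow> y" by (simp add: divide_inverse)
qed (use assms in blast)

lemma measure_relaxed_region_tendsto:
  assumes P: "compact P" "P \<noteq> {}" and C: "C > 0"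
  shows "(\<lambda>m. measure lborel (relaxed_region P c d b c' d' b' (C / real (Suc m)))) \<longlonglongrightarrow>
    measure lborel (admissible_region P c d b c' d' b')"
proof -
  let ?R = "\<lambda>m. relaxed_region P c d b c' d' b' (C / real (Suc m))"
  have "(\<Inter>m. ?R m) = admissible_region P c d b c' d' b'"
  proof (intro equalityI subsetI)
    fix z assume z: "z \<in> (\<Inter>m. ?R m)"
    have "infdist z P \<le> 0"
      by (rule le_if_le_add_null_sequence[of _ _ C]) (use z in \<open>auto simp: relaxed_region_def\<close>)
    then have "z \<in> P" using in_closed_iff_infdist_zero[OF compact_imp_closed[OF P(1)] P(2)]
        infdist_nonneg[of z P] by auto
    moreover have "b * (fst z - c) \<le> d * snd z"
      by (rule le_if_le_add_null_sequence[of _ _ C]) (use z in \<open>auto simp: relaxed_region_def\<close>)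
    moreover have "b' * (snd z - c') \<le> d' * fst z"
      by (rule le_if_le_add_null_sequence[of _ _ C]) (use z in \<open>auto simp: relaxed_region_def\<close>)
    ultimately show "z \<in> admissible_region P c d b c' d' b'"
      using z by (auto simp: admissible_region_def relaxed_region_def)
  next
    fix z assume z: "z \<in> admissible_region P c d b c' d' b'"
    have "0 \<le> C / real (Suc m)" for m using C by simp
    then show "z \<in> (\<Inter>m. ?R m)" using z
      by (auto simp: admissible_region_def relaxed_region_def intro: add_increasing2)
  qed
  moreover have "(\<lambda>m. measure lborel (?R m)) \<longlonglongrightarrow> measure lborel (\<Inter>m. ?R m)"
  proof (rule Lim_measure_decseq)
    show "range ?R \<subseteq> sets lborel" using relaxed_region_fmeasurable[OF P] by (auto simp: fmeasurable_def)
    show "emeasure lborel (?R m) \<noteq> \<infinity>" for m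
      by (simp add: fmeasurableD2[OF relaxed_region_fmeasurable[OF P]] del: of_nat_Suc)
    show "decseq ?R"
    proof (rule decseq_SucI)
      fix m
      have "C / real (Suc (Suc m)) \<le> C / real (Suc m)" using C by (intro divide_left_mono) auto
      then show "?R (Suc m) \<subseteq> ?R m" by (auto simp: relaxed_region_def)
    qed
  qed
  ultimately show ?thesis by simp
qed

lemma lattice_points_le_area:
  fixes P :: "(real \<times> real) set" and b c d b' c' d' m :: nat and C :: real
  assumes P: "compact P" "P \<noteq> {}" and m: "m > 0"
    and bound: "\<And>z. z \<in> P \<Longrightarrow> fst z \<le> real (c + d) \<and> snd z \<le> real (c' + d')"
    and C: "C \<ge> 2 + real b * (1 + real d) + real b' * (1 + real d')"
  shows "real (card (lattice_points P c d b c' d' b' m)) / real m ^ 2 \<le>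
    measure lborel (relaxed_region P c d b c' d' b' (C / real m))"
proof (cases "finite (lattice_points P c d b c' d' b' m)")
  case True
  let ?L = "lattice_points P c d b c' d' b' m"
  let ?R = "relaxed_region P c d b c' d' b' (C / real m)"
  define Q where "Q ij = {real (fst ij) / m<..<(real (fst ij) + 1) / m} \<times>
    {real (snd ij) / m<..<(real (snd ij) + 1) / m}" for ij :: "nat \<times> nat"
  have Q_borel: "Q ij \<in> sets borel" for ij unfolding Q_def by (intro borel_open open_Times) auto
  have Q_emeasure: "emeasure lborel (Q ij) = ennreal (1 / real m ^ 2)" for ij
  proof -
    have "emeasure lborel (Q ij) = emeasure (lborel \<Otimes>\<^sub>M lborel) (Q ij)" by (simp add: lborel_prod)
    also have "\<dots> = ennreal (1 / m) * ennreal (1 / m)" unfolding Q_def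
      by (subst lborel.emeasure_pair_measure_Times) (auto simp: diff_divide_distrib[symmetric] divide_right_mono)
    also have "\<dots> = ennreal (1 / real m ^ 2)"
      by (subst ennreal_mult[symmetric]) (auto simp: power2_eq_square)
    finally show ?thesis .
  qed
  have Q_fm: "Q ij \<in> fmeasurable lborel" for ij
    using Q_borel[of ij] Q_emeasure[of ij] by (auto simp: fmeasurable_def)
  have Q_measure: "measure lborel (Q ij) = 1 / real m ^ 2" for ij
    using Q_emeasure[of ij] by (intro measure_eq_emeasure_eq_ennreal) auto
  \<comment> \<open>Moving by less than one unit changes each linear condition by at most its coefficient; rounding costs
    another \<open>b * d\<close> or \<open>b' * d'\<close>. This is the reason for the size of \<open>C\<close>.\<close>
  have Q_sub: "Q ij \<subseteq> ?R" if ij: "ij \<in> ?L" for ij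
  proof
    fix z assume z: "z \<in> Q ij"
    obtain i j p where ij': "ij = (i, j)" "p \<in> P" "(real i, real j) = real m *\<^sub>R p"
      "b * ((i - m * c) div d) \<le> j" "b' * ((j - m * c') div d') \<le> i"
      using ij by (auto simp: lattice_points_def)
    define x y where "x = fst z * m" and "y = snd z * m"
    have xy: "real i < x" "x < real i + 1" "real j < y" "y < real j + 1"
      using z m by (auto simp: Q_def ij' x_def y_def field_simps)
    have p: "real i = m * fst p" "real j = m * snd p"
      using ij'(3) by (auto simp: prod_eq_iff)
    have "m * fst p \<le> m * real (c + d)" "m * snd p \<le> m * real (c' + d')"
      using bound[OF ij'(2)] by (auto intro!: mult_left_mono)
    then have "real i \<le> real (m * (c + d))" "real j \<le> real (m * (c' + d'))" by (simp_all add: p)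
    then have ile: "i \<le> m * (c + d)" and jle: "j \<le> m * (c' + d')" by (simp_all only: of_nat_le_iff)
    have C0: "real b * (1 + real d) \<le> C" "real b' * (1 + real d') \<le> C" "2 \<le> C"
    proof -
      have "0 \<le> real b * (1 + real d)" "0 \<le> real b' * (1 + real d')" by simp_all
      then show "real b * (1 + real d) \<le> C" "real b' * (1 + real d') \<le> C" "2 \<le> C" using C by linarith+
    qed
    have 1: "real b * (x - m * c) \<le> d * y + C"
    proof -
      have "real b * (x - m * c) \<le> real b * (real i - m * c) + real b"
        using mult_left_mono[of x "real i + 1" "real b"] xy by (simp add: algebra_simps)
      also have "\<dots> \<le> real d * j + real b * d + real b" using floor_condition[OF ij'(4) ile] by simp
      also have "\<dots> \<le> d * y + real b * (1 + real d)"
        using mult_left_mono[of "real j" y "real d"] xy by (simp add: algebra_simps)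
      finally show ?thesis using C0 by simp
    qed
    have 2: "real b' * (y - m * c') \<le> d' * x + C"
    proof -
      have "real b' * (y - m * c') \<le> real b' * (real j - m * c') + real b'"
        using mult_left_mono[of y "real j + 1" "real b'"] xy by (simp add: algebra_simps)
      also have "\<dots> \<le> real d' * i + real b' * d' + real b'" using floor_condition[OF ij'(5) jle] by simp
      also have "\<dots> \<le> d' * x + real b' * (1 + real d')"
        using mult_left_mono[of "real i" x "real d'"] xy by (simp add: algebra_simps)
      finally show ?thesis using C0 by simp
    qed
    have "infdist z P \<le> dist z p" by (rule infdist_le[OF ij'(2)])
    also have "\<dots> \<le> \<bar>fst z - fst p\<bar> + \<bar>snd z - snd p\<bar>"
      unfolding dist_prod_def dist_real_def power2_abs by (rule sqrt_sum_squares_le_sum_abs)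
    also have "\<dots> = \<bar>x - i\<bar> / m + \<bar>y - j\<bar> / m"
    proof -
      have "fst z - fst p = (x - i) / m" "snd z - snd p = (y - j) / m"
        using m by (auto simp: x_def y_def p field_simps)
      then show ?thesis using m by (simp add: abs_divide)
    qed
    also have "\<dots> \<le> 1 / m + 1 / m" using xy by (intro add_mono divide_right_mono) auto
    also have "\<dots> \<le> C / m" using C0 m by (simp add: field_simps)
    finally have 3: "infdist z P \<le> C / m" .
    have "real b * (fst z - c) \<le> d * snd z + C / m"
    proof -
      have "m * (real b * (fst z - c)) \<le> m * (d * snd z + C / m)"
        using 1 m by (simp add: x_def y_def algebra_simps)
      then show ?thesis using m by (simp add: mult_le_cancel_left)
    qed
    moreover have "real b' * (snd z - c') \<le> d' * fst z + C / m"
    proof -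
      have "m * (real b' * (snd z - c')) \<le> m * (d' * fst z + C / m)"
        using 2 m by (simp add: x_def y_def algebra_simps)
      then show ?thesis using m by (simp add: mult_le_cancel_left)
    qed
    moreover have "0 \<le> x" "0 \<le> y" using xy by linarith+
    then have "0 \<le> fst z" "0 \<le> snd z" using m by (simp_all add: x_def y_def zero_le_mult_iff)
    ultimately show "z \<in> ?R" using 3 by (simp add: relaxed_region_def)
  qed
  have "disjnt (Q u) (Q v)" if "u \<noteq> v" for u v
  proof (rule ccontr)
    assume "\<not> ?thesis"
    then obtain z where "z \<in> Q u" "z \<in> Q v" by (auto simp: disjnt_iff)
    then have "real (fst u) < fst z * m" "fst z * m < real (fst u) + 1" "real (snd u) < snd z * m"
      "snd z * m < real (snd u) + 1" "real (fst v) < fst z * m" "fst z * m < real (fst v) + 1"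
      "real (snd v) < snd z * m" "snd z * m < real (snd v) + 1"
      using m by (auto simp: Q_def field_simps)
    then have "fst u = fst v" "snd u = snd v" by linarith+
    then show False using that by (simp add: prod_eq_iff)
  qed
  then have "measure lborel (\<Union>ij\<in>?L. Q ij) = (\<Sum>ij\<in>?L. measure lborel (Q ij))"
    using True Q_fm by (intro measure_UNION') (auto simp: pairwise_def)
  moreover have "measure lborel (\<Union>ij\<in>?L. Q ij) \<le> measure lborel ?R"
    using Q_sub Q_borel True relaxed_region_fmeasurable[OF P]
    by (intro measure_mono_fmeasurable) (auto intro: sets.finite_UN)
  ultimately show ?thesis by (simp add: Q_measure)
qed simp

text \<open>Division by \<open>m\<^sup>2\<close> and passage to the limit.\<close>

lemma quadratic_growth_le_area:
  fixes P :: "(real \<times> real) set" and b c d b' c' d' k :: nat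
  assumes P: "compact P" "P \<noteq> {}"
    and bound: "\<And>z. z \<in> P \<Longrightarrow> fst z \<le> real (c + d) \<and> snd z \<le> real (c' + d')"
    and growth: "\<And>m. m \<ge> k \<Longrightarrow>
      real k * real (m - k) ^ 2 / 2 \<le> real (card (lattice_points P c d b c' d' b' m))"
  shows "real k / 2 \<le> measure lborel (admissible_region P c d b c' d' b')"
proof (rule LIMSEQ_le)
  define C where "C = 2 + real b * (1 + real d) + real b' * (1 + real d')"
  have "C > 0" unfolding C_def by (intro add_pos_nonneg) auto
  then show "(\<lambda>m. measure lborel (relaxed_region P c d b c' d' b' (C / real (Suc m)))) \<longlonglongrightarrow>
      measure lborel (admissible_region P c d b c' d' b')"
    by (rule measure_relaxed_region_tendsto[OF P])
  have "(\<lambda>m. real k * (1 - real k * inverse (real (Suc m))) ^ 2 / 2) \<longlonglongrightarrow> real k * (1 - real k * 0) ^ 2 / 2"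
    by (intro tendsto_intros LIMSEQ_inverse_real_of_nat) simp
  then show "(\<lambda>m. real k * (1 - real k * inverse (real (Suc m))) ^ 2 / 2) \<longlonglongrightarrow> real k / 2" by simp
  have "real k * (1 - real k * inverse (real (Suc m))) ^ 2 / 2 \<le>
      measure lborel (relaxed_region P c d b c' d' b' (C / real (Suc m)))" if "m \<ge> k" for m
  proof -
    have "real k * (1 - real k * inverse (real (Suc m))) ^ 2 / 2 =
        real k * real (Suc m - k) ^ 2 / 2 / real (Suc m) ^ 2"
      using that by (simp add: field_simps of_nat_diff del: of_nat_Suc)
    also have "\<dots> \<le> real (card (lattice_points P c d b c' d' b' (Suc m))) / real (Suc m) ^ 2"
      using that by (intro divide_right_mono growth) auto
    also have "\<dots> \<le> measure lborel (relaxed_region P c d b c' d' b' (C / real (Suc m)))"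
      by (rule lattice_points_le_area[OF P _ bound]) (simp_all add: C_def)
    finally show ?thesis .
  qed
  then show "\<exists>N. \<forall>m\<ge>N. real k * (1 - real k * inverse (real (Suc m))) ^ 2 / 2 \<le>
      measure lborel (relaxed_region P c d b c' d' b' (C / real (Suc m)))" by blast
qed

section \<open>The surface and its Newton polygon\<close>

definition chebyshev_map :: "nat \<Rightarrow> (nat \<Rightarrow> nat) \<Rightarrow> (nat \<Rightarrow> nat) \<Rightarrow> complex \<Rightarrow> complex \<Rightarrow> nat \<Rightarrow> complex" where
  "chebyshev_map n a b s t = (\<lambda>j\<in>{1..n}. chebyshev_T (a j) s * chebyshev_T (b j) t)"

abbreviation coordinate_poly :: "(nat \<Rightarrow> nat) \<Rightarrow> (nat \<Rightarrow> nat) \<Rightarrow> nat \<Rightarrow> complex poly poly" where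
  "coordinate_poly a b j \<equiv> tensor (chebyshev_poly (a j)) (chebyshev_poly (b j))"

lemma chebyshev_map_affine: "chebyshev_map n a b s t \<in> affine_space {1..n}"
  by (simp add: chebyshev_map_def affine_space_def)

lemma chebyshev_map_eval2: "j \<in> {1..n} \<Longrightarrow> chebyshev_map n a b s t j = eval2 (coordinate_poly a b j) s t"
  by (simp add: chebyshev_map_def)

lemma chebyshev_surface_eq:
  "chebyshev_surface n a b = zariski_closure {1..n} (range (\<lambda>(s, t). chebyshev_map n a b s t))"
  by (simp add: chebyshev_surface_def chebyshev_map_def)

lemma matrix_rank_2_minor:
  assumes "matrix_rank n a b = 2"
  shows "\<exists>i\<in>{1..n}. \<exists>j\<in>{1..n}. a i * b j \<noteq> a j * b i"
proof (rule ccontr)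
  assume "\<not> ?thesis"
  then have minor: "a i * b j = a j * b i" if "i \<in> {1..n}" "j \<in> {1..n}" for i j using that by blast
  define S where "S = (\<lambda>j. (real (a j), real (b j))) ` {1..n}"
  have "\<exists>v. S \<subseteq> span {v}"
  proof (cases "S \<subseteq> {0}")
    case True
    then show ?thesis by (intro exI[of _ 0]) auto
  next
    case False
    then obtain w where w: "w \<in> S" "w \<noteq> 0" by blast
    then obtain i where "i \<in> {1..n}" "w = (real (a i), real (b i))" unfolding S_def by blast
    with w(2) have i: "i \<in> {1..n}" "a i \<noteq> 0 \<or> b i \<noteq> 0" by (auto simp: zero_prod_def)
    let ?v = "(real (a i), real (b i))"
    have "(real (a j), real (b j)) \<in> span {?v}" if j: "j \<in> {1..n}" for j
    proof -
      have m: "real (a i) * real (b j) = real (a j) * real (b i)"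
        using minor[OF i(1) j] by (metis of_nat_mult)
      define r where "r = (if a i \<noteq> 0 then real (a j) / real (a i) else real (b j) / real (b i))"
      have "(real (a j), real (b j)) = r *\<^sub>R ?v" using i(2) m by (auto simp: r_def field_simps)
      then show ?thesis by (metis span_base span_scale insertI1)
    qed
    then show ?thesis unfolding S_def by (intro exI[of _ ?v]) auto
  qed
  then obtain v where "S \<subseteq> span {v}" ..
  then have "dim S \<le> card {v}" by (intro dim_le_card) auto
  then show False using assms by (simp add: matrix_rank_def S_def)
qed

text \<open>
  The curve is the image of the line \<open>t\<^sub>1 = 1\<close>, on which the coordinates are \<open>T\<^bsub>b j\<^esub>(t\<^sub>2)\<close>. It lies on the
  hypersurface \<open>T\<^bsub>b j\<^esub>(x\<^sub>i) = T\<^bsub>b i\<^esub>(x\<^sub>j)\<close> because Chebyshev polynomials commute under composition; the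
  surface does not, since on the line \<open>t\<^sub>2 = 1\<close> the two sides are \<open>T\<^bsub>a i * b j\<^esub>(t\<^sub>1)\<close> and \<open>T\<^bsub>a j * b i\<^esub>(t\<^sub>1)\<close>.
\<close>

lemma variety_dim_chebyshev_surface:
  assumes ij: "i \<in> {1..n}" "j \<in> {1..n}" "a i * b j \<noteq> a j * b i"
  shows "variety_dim {1..n} (chebyshev_surface n a b) = 2"
proof -
  let ?\<phi> = "chebyshev_map n a b"
  let ?X = "chebyshev_surface n a b"
  define C where "C = zariski_closure {1..n} (range (?\<phi> 1))"
  define Z where "Z k = (if k = 0 then {?\<phi> 1 1} else if k = 1 then C else ?X)" for k :: nat
  have C_aff: "range (?\<phi> 1) \<subseteq> affine_space {1..n}"
    and X_aff: "range (\<lambda>(s, t). ?\<phi> s t) \<subseteq> affine_space {1..n}" using chebyshev_map_affine by auto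
  have X_closed: "zariski_closed {1..n} ?X"
    unfolding chebyshev_surface_eq by (rule zariski_closed_closure[OF X_aff])
  have in_X: "?\<phi> s t \<in> ?X" for s t
    unfolding chebyshev_surface_eq using zariski_closure_superset[of "range (\<lambda>(s, t). ?\<phi> s t)" "{1..n}"] by auto
  have in_C: "?\<phi> 1 t \<in> C" for t
    unfolding C_def using zariski_closure_superset[of "range (?\<phi> 1)" "{1..n}"] by auto
  have C_sub: "C \<subseteq> ?X" unfolding C_def by (rule zariski_closure_minimal[OF _ X_closed]) (use in_X in auto)
  have "irreducible_closed {1..n} ?X"
    unfolding chebyshev_surface_eq
  proof (rule irreducible_closure_image[OF X_aff])
    fix f g assume f: "f \<in> poly_funs {1..n}" and g: "g \<in> poly_funs {1..n}"
      and 0: "\<And>p. f (case p of (s, t) \<Rightarrow> ?\<phi> s t) * g (case p of (s, t) \<Rightarrow> ?\<phi> s t) = 0"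
    have coord: "\<exists>F. \<forall>s t. ?\<phi> s t j = eval2 F s t" if "j \<in> {1..n}" for j
      using chebyshev_map_eval2[OF that] by (intro exI[of _ "coordinate_poly a b j"]) simp
    obtain F where F: "\<forall>s t. f (?\<phi> s t) = eval2 F s t"
      using poly_funs_eval2[of f "{1..n}" ?\<phi>, OF f coord] by auto
    obtain G where G: "\<forall>s t. g (?\<phi> s t) = eval2 G s t"
      using poly_funs_eval2[of g "{1..n}" ?\<phi>, OF g coord] by auto
    have "eval2 F s t * eval2 G s t = 0" for s t
      using 0[of "(s, t)"] F G by simp
    from eval2_mult_eq_0[OF this] show "(\<forall>p. f (case p of (s, t) \<Rightarrow> ?\<phi> s t) = 0) \<or>
        (\<forall>p. g (case p of (s, t) \<Rightarrow> ?\<phi> s t) = 0)"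
      using F G by auto
  qed
  moreover have "irreducible_closed {1..n} C"
    unfolding C_def
  proof (rule irreducible_closure_image[OF C_aff])
    fix f g assume f: "f \<in> poly_funs {1..n}" and g: "g \<in> poly_funs {1..n}"
      and 0: "\<And>t. f (?\<phi> 1 t) * g (?\<phi> 1 t) = 0"
    have coord: "\<exists>q. \<forall>t. ?\<phi> 1 t j = poly q t" if "j \<in> {1..n}" for j
      using that by (intro exI[of _ "chebyshev_poly (b j)"]) (simp add: chebyshev_map_def chebyshev_T_1)
    obtain p where p: "\<forall>t. f (?\<phi> 1 t) = poly p t"
      using poly_funs_along_curve[of f "{1..n}" "?\<phi> 1", OF f coord] by auto
    obtain q where q: "\<forall>t. g (?\<phi> 1 t) = poly q t"
      using poly_funs_along_curve[of g "{1..n}" "?\<phi> 1", OF g coord] by auto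
    have "\<forall>t. poly (p * q) t = 0" using 0 p q by simp
    then have "p * q = 0" by (simp only: poly_all_0_iff_0)
    then show "(\<forall>t. f (?\<phi> 1 t) = 0) \<or> (\<forall>t. g (?\<phi> 1 t) = 0)" using p q by auto
  qed
  moreover have "irreducible_closed {1..n} {?\<phi> 1 1}"
    by (rule irreducible_closed_singleton[OF chebyshev_map_affine])
  ultimately have irr: "irreducible_closed {1..n} (Z k) \<and> Z k \<subseteq> ?X" for k
    using in_X C_sub by (simp add: Z_def)
  have "{?\<phi> 1 1} \<subset> C"
  proof -
    obtain l where l: "l \<in> {1..n}" "b l \<noteq> 0" using ij by (metis mult_0_right)
    obtain t where "chebyshev_T (b l) t \<noteq> chebyshev_T 0 t" using chebyshev_T_distinct[OF l(2)] by auto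
    then have "?\<phi> 1 t l \<noteq> ?\<phi> 1 1 l" using l by (simp add: chebyshev_map_def chebyshev_T_1)
    then have "?\<phi> 1 t \<noteq> ?\<phi> 1 1" by auto
    then show ?thesis using in_C by blast
  qed
  moreover have "C \<subset> ?X"
  proof -
    define f where "f x = poly (chebyshev_poly (b j)) (x i) - poly (chebyshev_poly (b i)) (x j)"
      for x :: "nat \<Rightarrow> complex"
    have p: "(\<lambda>x. poly p (x l)) \<in> poly_funs {1..n}" if "l \<in> {1..n}" for p l
      unfolding poly_altdef using that
      by (intro poly_funs_sum poly_funs.mult poly_funs.const poly_funs_power poly_funs.coord)
    have f: "f \<in> poly_funs {1..n}" unfolding f_def[abs_def] by (intro poly_funs_diff p ij)
    obtain s where s: "chebyshev_T (a i * b j) s \<noteq> chebyshev_T (a j * b i) s"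
      using chebyshev_T_distinct[OF ij(3)] by auto
    have "f x = 0" if "x \<in> C" for x
      by (rule zariski_closure_vanishes[OF C_aff f _ that[unfolded C_def]])
        (use ij in \<open>auto simp: f_def chebyshev_map_def chebyshev_T_1 chebyshev_T_compose mult.commute\<close>)
    moreover have "f (?\<phi> s 1) \<noteq> 0"
      using s ij by (simp add: f_def chebyshev_map_def chebyshev_T_1 chebyshev_T_compose mult.commute)
    ultimately have "?\<phi> s 1 \<notin> C" by auto
    then show ?thesis using C_sub in_X[of s 1] by blast
  qed
  ultimately have strict: "Z k \<subset> Z (Suc k)" if "k < 2" for k
    using that by (auto simp: Z_def less_2_cases_iff)
  show ?thesis
  proof (rule variety_dim_eqI[of 2 "{1..n}" Z])
    show "irreducible_closed {1..n} (Z k) \<and> Z k \<subseteq> ?X" for k by (rule irr)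
    show "Z k \<subset> Z (Suc k)" if "k < 2" for k by (rule strict[OF that])
    show "\<not> alg_independent {1..n} ?X (Suc 2) h" for h
      using no_three_alg_independent[of ?\<phi> "{1..n}" h] chebyshev_map_affine chebyshev_map_eval2
      unfolding chebyshev_surface_eq by (metis numeral_2_eq_2 numeral_3_eq_3)
  qed
qed

lemma polygon_B_compact: "compact (polygon_B n a b)"
  unfolding polygon_B_def by (intro compact_convex_hull finite_imp_compact) auto

lemma polygon_B_rectangle:
  assumes "j \<in> {1..n}" "\<bar>x\<bar> \<le> real (a j)" "\<bar>y\<bar> \<le> real (b j)"
  shows "(x, y) \<in> polygon_B n a b"
proof -
  have seg: "convex hull {- r, r} = {- r..r}" if "0 \<le> r" for r :: real
    using that by (simp add: segment_convex_hull[symmetric] closed_segment_eq_real_ivl)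
  have "(x, y) \<in> convex hull ({- real (a j), real (a j)} \<times> {- real (b j), real (b j)})"
    using assms unfolding convex_hull_Times by (simp add: seg abs_le_iff)
  moreover have "convex hull ({- real (a j), real (a j)} \<times> {- real (b j), real (b j)}) \<subseteq> polygon_B n a b"
    unfolding polygon_B_def using assms(1) by (intro hull_mono) blast
  ultimately show ?thesis by blast
qed

lemma polygon_B_bounded:
  assumes "\<And>j. j \<in> {1..n} \<Longrightarrow> a j \<le> A \<and> b j \<le> B" "z \<in> polygon_B n a b"
  shows "fst z \<le> real A \<and> snd z \<le> real B"
proof -
  have "polygon_B n a b \<subseteq> {- real A..real A} \<times> {- real B..real B}"
    unfolding polygon_B_def
  proof (rule hull_minimal)
    show "(\<Union>j\<in>{1..n}. {- real (a j), real (a j)} \<times> {- real (b j), real (b j)}) \<subseteq>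
        {- real A..real A} \<times> {- real B..real B}"
      using assms(1) by fastforce
  qed (intro convex_Times convex_real_interval)
  then show ?thesis using assms(2) by auto
qed

lemma polygon_B_symmetric:
  assumes "(x, y) \<in> polygon_B n a b"
  shows "(- x, y) \<in> polygon_B n a b \<and> (x, - y) \<in> polygon_B n a b"
proof -
  let ?S = "\<Union>j\<in>{1..n}. {- real (a j), real (a j)} \<times> {- real (b j), real (b j)}"
  have refl: "f ` polygon_B n a b \<subseteq> polygon_B n a b" if "linear f" "f ` ?S \<subseteq> ?S" for f
    unfolding polygon_B_def convex_hull_linear_image[OF that(1)] using that(2) by (rule hull_mono)
  have "linear (\<lambda>z :: real \<times> real. (- fst z, snd z))" "linear (\<lambda>z :: real \<times> real. (fst z, - snd z))"
    by (auto intro!: linearI)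
  from refl[OF this(1)] refl[OF this(2)] have
    "(\<lambda>z. (- fst z, snd z)) ` polygon_B n a b \<subseteq> polygon_B n a b"
    "(\<lambda>z. (fst z, - snd z)) ` polygon_B n a b \<subseteq> polygon_B n a b" by fastforce+
  then show ?thesis using assms by force
qed

text \<open>
  Either the second triangle lies to the left of the first one or is empty, or the two share a corner;
  in the last case the line from the origin to that corner separates them.
\<close>

lemma triangles_disjoint:
  fixes b c d b' c' d' x y :: real
  assumes nonneg: "0 \<le> b" "0 \<le> c" "0 \<le> d" "0 \<le> b'" "0 \<le> c'" "0 \<le> d'"
    and pos: "b' \<le> c \<or> d' = 0 \<or> c + d = b' \<and> c' + d' = b"
    and x: "c \<le> x" "x \<le> c + d" and A: "d * y < b * (x - c)"
    and y: "c' \<le> y" "y \<le> c' + d'" and B: "d' * x < b' * (y - c')"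
  shows False
proof -
  have d': "d' > 0"
  proof (rule ccontr)
    assume "\<not> d' > 0"
    then have "d' = 0" "y = c'" using nonneg y by auto
    then show False using B by simp
  qed
  have d: "d > 0"
  proof (rule ccontr)
    assume "\<not> d > 0"
    then have "d = 0" "x = c" using nonneg x by auto
    then show False using A by simp
  qed
  from pos d' consider "b' \<le> c" | "b' = c + d" "b = c' + d'" by auto
  then show False
  proof cases
    case 1
    have "d' * x < b' * d'" using B mult_left_mono[of "y - c'" d' b'] nonneg y by simp
    then have "x < b'" using d' by (simp add: mult.commute)
    then show False using 1 x by simp
  next
    case 2
    have "0 \<le> c * (c + d - x)" "0 \<le> c' * (c' + d' - y)" using nonneg x y by simp_all
    then have 3: "b' * (x - c) \<le> d * x" "b * (y - c') \<le> d' * y" using 2 by (simp_all add: algebra_simps)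
    have "b' > 0" "b > 0" using 2 d d' nonneg by linarith+
    have "d * (b' * y) = b' * (d * y)" by simp
    also have "\<dots> < b' * (b * (x - c))" using A \<open>b' > 0\<close> by (rule mult_strict_left_mono)
    also have "\<dots> = b * (b' * (x - c))" by simp
    also have "\<dots> \<le> b * (d * x)" using 3(1) \<open>b > 0\<close> by (intro mult_left_mono) auto
    finally have "d * (b' * y) < d * (b * x)" by (simp add: mult_ac)
    then have less: "b' * y < b * x" using d by simp
    have "d' * (b * x) = b * (d' * x)" by simp
    also have "\<dots> < b * (b' * (y - c'))" using B \<open>b > 0\<close> by (rule mult_strict_left_mono)
    also have "\<dots> = b' * (b * (y - c'))" by simp
    also have "\<dots> \<le> b' * (d' * y)" using 3(2) \<open>b' > 0\<close> by (intro mult_left_mono) auto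
    finally have "d' * (b * x) < d' * (b' * y)" by (simp add: mult_ac)
    then have "b * x < b' * y" using d' by simp
    with less show False by simp
  qed
qed

theorem theorem4p8:
  fixes n \<alpha> \<beta> :: nat and a b \<sigma> :: "nat \<Rightarrow> nat"
  assumes "mono_on {1..n} a"
    and "\<sigma> permutes {1..n}"
    and "mono_on {1..n} (\<lambda>j. b (\<sigma> j))"
    and "a 0 = 0" and "b 0 = 0"
    and "a (\<sigma> 0) = 0" and "b (\<sigma> 0) = 0"
    and "\<alpha> = (GREATEST j. j \<le> n \<and> b j \<noteq> b n)"
    and "\<beta> = (GREATEST j. j \<le> n \<and> a (\<sigma> j) \<noteq> a (\<sigma> n))"
    and "matrix_rank n a b = 2"
  shows "real (variety_degree n (chebyshev_surface n a b)) \<le>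
    1 / 4 * (2 * measure lborel (polygon_B n a b)
             - 4 * real (b n) * (real (a n) - real (a \<alpha>))
             - 4 * real (a (\<sigma> n)) * (real (b (\<sigma> n)) - real (b (\<sigma> \<beta>))))"
proof -
  obtain i0 j0 where ij0: "i0 \<in> {1..n}" "j0 \<in> {1..n}" "a i0 * b j0 \<noteq> a j0 * b i0"
    using matrix_rank_2_minor[OF assms(10)] by blast
  have n: "n \<in> {1..n}" using ij0(1) by auto
  have \<sigma>_in: "\<sigma> r \<in> {1..n} \<longleftrightarrow> r \<in> {1..n}" for r using permutes_in_image[OF assms(2)] .
  have \<sigma>_surj: "\<exists>r\<in>{1..n}. j = \<sigma> r" if "j \<in> {1..n}" for j
    using that permutes_image[OF assms(2)] by (metis imageE)
  have mono_a: "a i \<le> a j" if "i \<le> j" "j \<le> n" for i j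
  proof (cases "i = 0")
    case False
    then show ?thesis using that by (intro mono_onD[OF assms(1)]) auto
  qed (simp add: assms(4))
  have mono_b: "b (\<sigma> i) \<le> b (\<sigma> j)" if "i \<le> j" "j \<le> n" for i j
  proof (cases "i = 0")
    case False
    then show ?thesis using that by (intro mono_onD[OF assms(3)]) auto
  qed (simp add: assms(7))
  have "\<exists>j\<le>n. b j \<noteq> b n"
  proof (rule ccontr)
    assume "\<not> ?thesis"
    then have "b j = 0" if "j \<le> n" for j using that assms(5) by (metis le0)
    then show False using ij0 by simp
  qed
  then have \<alpha>: "\<alpha> \<le> n \<and> b \<alpha> \<noteq> b n"
    unfolding assms(8) by (intro GreatestI_ex_nat[where P="\<lambda>j. j \<le> n \<and> b j \<noteq> b n" and b=n]) auto
  have above_\<alpha>: "b j = b n" if "\<alpha> < j" "j \<le> n" for j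
  proof (rule ccontr)
    assume "b j \<noteq> b n"
    then have "j \<le> \<alpha>" unfolding assms(8) using that
      by (intro Greatest_le_nat[where P="\<lambda>j. j \<le> n \<and> b j \<noteq> b n" and b=n]) auto
    then show False using that by simp
  qed
  have "\<exists>j\<le>n. a (\<sigma> j) \<noteq> a (\<sigma> n)"
  proof (rule ccontr)
    assume "\<not> ?thesis"
    then have "a (\<sigma> j) = 0" if "j \<le> n" for j using that assms(6) by (metis le0)
    then have "a j = 0" if "j \<in> {1..n}" for j using \<sigma>_surj[OF that] by auto
    then show False using ij0 by simp
  qed
  then have \<beta>: "\<beta> \<le> n \<and> a (\<sigma> \<beta>) \<noteq> a (\<sigma> n)"
    unfolding assms(9) by (intro GreatestI_ex_nat[where P="\<lambda>j. j \<le> n \<and> a (\<sigma> j) \<noteq> a (\<sigma> n)" and b=n]) auto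
  have above_\<beta>: "a (\<sigma> j) = a (\<sigma> n)" if "\<beta> < j" "j \<le> n" for j
  proof (rule ccontr)
    assume "a (\<sigma> j) \<noteq> a (\<sigma> n)"
    then have "j \<le> \<beta>" unfolding assms(9) using that
      by (intro Greatest_le_nat[where P="\<lambda>j. j \<le> n \<and> a (\<sigma> j) \<noteq> a (\<sigma> n)" and b=n]) auto
    then show False using that by simp
  qed
  \<comment> \<open>\<open>c\<close> and \<open>d\<close> belong to the condition at infinity in \<open>t\<^sub>1\<close>, \<open>c'\<close> and \<open>d'\<close> to the one in \<open>t\<^sub>2\<close>.\<close>
  define P where "P = polygon_B n a b"
  define c where "c = a \<alpha>"
  define d where "d = a n - a \<alpha>"
  define c' where "c' = b (\<sigma> \<beta>)"
  define d' where "d' = b (\<sigma> n) - b (\<sigma> \<beta>)"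
  have cd: "c + d = a n" using mono_a[of \<alpha> n] \<alpha> by (simp add: c_def d_def)
  have cd': "c' + d' = b (\<sigma> n)" using mono_b[of \<beta> n] \<beta> by (simp add: c'_def d'_def)
  have a_le: "a j \<le> c + d" if "j \<in> {1..n}" for j using mono_a[of j n] that by (simp add: cd)
  have b_le: "b j \<le> c' + d'" if j: "j \<in> {1..n}" for j
  proof -
    obtain r where "r \<in> {1..n}" "j = \<sigma> r" using \<sigma>_surj[OF j] by blast
    then show ?thesis using mono_b[of r n] by (simp add: cd')
  qed
  have P: "compact P" "convex P" unfolding P_def polygon_B_def[of n a b]
    using polygon_B_compact[of n a b] by (simp_all add: polygon_B_def)
  have P0: "0 \<in> P" unfolding P_def zero_prod_def by (rule polygon_B_rectangle[OF n]) simp_all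
  have P_bound: "fst z \<le> real (c + d) \<and> snd z \<le> real (c' + d')" if "z \<in> P" for z
    using a_le b_le that unfolding P_def by (intro polygon_B_bounded) auto
  define G where "G = coordinate_poly a b ` {1..n}"
  define L where "L m = lattice_points P c d (b n) c' d' (a (\<sigma> n)) m" for m
  have columns: "i \<le> c \<or> i \<le> c + d \<and> chebyshev_poly (b n) dvd coeff g i"
    if "g \<in> G" "coeff g i \<noteq> 0" for g i
  proof -
    obtain j where j: "j \<in> {1..n}" "g = coordinate_poly a b j" using \<open>g \<in> G\<close> by (auto simp: G_def)
    have "coeff (chebyshev_poly (a j)) i \<noteq> 0" using that(2) by (auto simp: j(2))
    then have i: "i \<le> a j" using le_degree by fastforce
    show ?thesis
    proof (cases "j \<le> \<alpha>")
      case True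
      then show ?thesis using i mono_a[of j \<alpha>] \<alpha> by (simp add: c_def)
    next
      case False
      then have "b j = b n" using above_\<alpha>[of j] j(1) by simp
      then show ?thesis using i a_le[OF j(1)] by (simp add: j(2) dvd_smult)
    qed
  qed
  have rows: "i \<le> c' \<or> i \<le> c' + d' \<and> chebyshev_poly (a (\<sigma> n)) dvd row g i"
    if "g \<in> G" "row g i \<noteq> 0" for g i
  proof -
    obtain j where j: "j \<in> {1..n}" "g = coordinate_poly a b j" using \<open>g \<in> G\<close> by (auto simp: G_def)
    obtain r where r: "r \<in> {1..n}" "j = \<sigma> r" using \<sigma>_surj[OF j(1)] by blast
    have "coeff (chebyshev_poly (b j)) i \<noteq> 0" using that(2) by (auto simp: j(2) row_tensor)
    then have i: "i \<le> b j" using le_degree by fastforce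
    show ?thesis
    proof (cases "r \<le> \<beta>")
      case True
      then show ?thesis using i mono_b[of r \<beta>] \<beta> by (simp add: c'_def r(2))
    next
      case False
      then have "a j = a (\<sigma> n)" using above_\<beta>[of r] r by simp
      then show ?thesis using i b_le[OF j(1)] by (simp add: j(2) row_tensor dvd_smult)
    qed
  qed
  have support: "(real i, real j) \<in> P" if "g \<in> G" "coeff (coeff g i) j \<noteq> 0" for g i j
  proof -
    obtain k where k: "k \<in> {1..n}" "g = coordinate_poly a b k" using \<open>g \<in> G\<close> by (auto simp: G_def)
    then have "coeff (chebyshev_poly (a k)) i \<noteq> 0" "coeff (chebyshev_poly (b k)) j \<noteq> 0"
      using that(2) by auto
    then have "i \<le> a k" "j \<le> b k" using le_degree by fastforce+
    then show ?thesis unfolding P_def using k(1) by (intro polygon_B_rectangle[of k]) auto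
  qed
  have leading: "\<exists>(i, j)\<in>L m. coeff (coeff H i) j \<noteq> 0" if H: "polys_upto G m H" "H \<noteq> 0" for m H
  proof -
    from leading_monomial[OF H(2) polys_upto_columns_vanish[OF H(1) columns] polys_upto_rows_vanish[OF H(1) rows]]
    obtain i j where ij: "coeff (coeff H i) j \<noteq> 0" "b n * ((i - m * c) div d) \<le> j"
      "a (\<sigma> n) * ((j - m * c') div d') \<le> i" by auto
    have "\<exists>p\<in>P. (real i, real j) = real m *\<^sub>R p"
      by (rule polys_upto_support[OF P(2) P0 support H(1) ij(1)])
    then have "(i, j) \<in> L m" using ij by (simp add: L_def lattice_points_def)
    then show ?thesis using ij(1) by blast
  qed
  have finL: "finite (L m)" for m
  proof (rule finite_subset)
    show "L m \<subseteq> {..m * (c + d)} \<times> {..m * (c' + d')}"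
    proof (clarify, unfold L_def lattice_points_def, clarify)
      fix i j u v assume uv: "(u, v) \<in> P" "(real i, real j) = real m *\<^sub>R (u, v)"
      have "real i \<le> real m * real (c + d)" "real j \<le> real m * real (c' + d')"
        using uv P_bound[OF uv(1)] by (auto intro!: mult_left_mono)
      then have "real i \<le> real (m * (c + d))" "real j \<le> real (m * (c' + d'))" by simp_all
      then show "i \<in> {..m * (c + d)} \<and> j \<in> {..m * (c' + d')}" by (simp only: of_nat_le_iff atMost_iff)
    qed
  qed simp
  \<comment> \<open>The top corners of the two triangles are \<open>(a n, b n)\<close> and \<open>(a (\<sigma> n), b (\<sigma> n))\<close>. If the second one
    lies to the right of \<open>c\<close>, then \<open>\<sigma> n > \<alpha>\<close> and so \<open>b n\<close> is the largest entry of \<open>b\<close>; unless \<open>d' = 0\<close>, the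
    same reasoning for \<open>\<beta>\<close> shows that \<open>a (\<sigma> n)\<close> is the largest entry of \<open>a\<close>.\<close>
  have position: "a (\<sigma> n) \<le> c \<or> d' = 0 \<or> c + d = a (\<sigma> n) \<and> c' + d' = b n"
  proof (cases "a (\<sigma> n) \<le> c \<or> d' = 0")
    case False
    have \<sigma>n: "\<sigma> n \<in> {1..n}" using \<sigma>_in n by simp
    have "\<alpha> < \<sigma> n"
    proof (rule ccontr)
      assume "\<not> \<alpha> < \<sigma> n"
      then show False using False mono_a[of "\<sigma> n" \<alpha>] \<alpha> by (simp add: c_def)
    qed
    then have b\<sigma>: "b (\<sigma> n) = b n" using above_\<alpha>[of "\<sigma> n"] \<sigma>n by simp
    obtain r where r: "r \<in> {1..n}" "n = \<sigma> r" using \<sigma>_surj[OF n] by blast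
    have "\<beta> < r"
    proof (rule ccontr)
      assume "\<not> \<beta> < r"
      then have "b n \<le> b (\<sigma> \<beta>)" using mono_b[of r \<beta>] \<beta> r(2) by simp
      then show False using False b\<sigma> by (simp add: d'_def)
    qed
    then have "a n = a (\<sigma> n)" using above_\<beta>[of r] r by simp
    then show ?thesis using cd cd' b\<sigma> by simp
  qed blast
  have area: "4 * (measure lborel (admissible_region P c d (b n) c' d' (a (\<sigma> n))) +
      real d * real (b n) / 2 + real d' * real (a (\<sigma> n)) / 2) \<le> measure lborel P"
  proof (rule area_admissible_region[OF P(1)])
    show "(- x, y) \<in> P \<and> (x, - y) \<in> P" if "(x, y) \<in> P" for x y
      using that unfolding P_def by (rule polygon_B_symmetric)
    show "(x, y) \<in> P" if "0 \<le> x" "x \<le> real c + real d" "0 \<le> y" "y \<le> real (b n)" for x y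
      unfolding P_def
    proof (rule polygon_B_rectangle[OF n])
      show "\<bar>x\<bar> \<le> real (a n)" using that(1,2) cd by (metis abs_of_nonneg of_nat_add)
    qed (use that in simp)
    show "(x, y) \<in> P" if "0 \<le> x" "x \<le> real (a (\<sigma> n))" "0 \<le> y" "y \<le> real c' + real d'" for x y
      unfolding P_def
    proof (rule polygon_B_rectangle[of "\<sigma> n"])
      show "\<bar>y\<bar> \<le> real (b (\<sigma> n))" using that(3,4) cd' by (metis abs_of_nonneg of_nat_add)
      show "\<sigma> n \<in> {1..n}" using \<sigma>_in n by simp
    qed (use that in simp)
    have "real (a (\<sigma> n)) \<le> real c \<or> real d' = 0 \<or>
        real c + real d = real (a (\<sigma> n)) \<and> real c' + real d' = real (b n)"
      using position by (metis of_nat_0 of_nat_add of_nat_le_iff)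
    then show False if "real c \<le> x" "x \<le> real c + real d" "0 < y" "real d * y < real (b n) * (x - real c)"
      "real c' \<le> y" "y \<le> real c' + real d'" "0 < x" "real d' * x < real (a (\<sigma> n)) * (y - real c')" for x y
      using that by (intro triangles_disjoint[of "real (b n)" c d "a (\<sigma> n)" c' d' x y]) auto
  qed simp_all
  have "real (variety_degree n (chebyshev_surface n a b)) \<le>
      measure lborel P / 2 - real d * real (b n) - real d' * real (a (\<sigma> n))"
  proof (rule variety_degree_le[OF chebyshev_map_affine chebyshev_map_eval2 chebyshev_surface_eq
        variety_dim_chebyshev_surface[OF ij0], where L=L])
    show "finite (L m)" for m by (rule finL)
    show "\<exists>(i, j)\<in>L m. coeff (coeff H i) j \<noteq> 0"
      if "polys_upto (coordinate_poly a b ` {1..n}) m H" "H \<noteq> 0" for m H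
      using leading that by (simp add: G_def)
    fix k :: nat assume growth: "\<And>m. k \<le> m \<Longrightarrow> real k * real (m - k) ^ 2 / 2 \<le> real (card (L m))"
    have "real k / 2 \<le> measure lborel (admissible_region P c d (b n) c' d' (a (\<sigma> n)))"
      by (rule quadratic_growth_le_area[OF P(1) _ P_bound]) (use P0 growth in \<open>auto simp: L_def\<close>)
    with area show "real k \<le> measure lborel P / 2 - real d * real (b n) - real d' * real (a (\<sigma> n))" by simp
  qed simp_all
  moreover have "real d = real (a n) - real (a \<alpha>)" "real d' = real (b (\<sigma> n)) - real (b (\<sigma> \<beta>))"
    using cd cd' by (simp_all add: c_def c'_def flip: cd cd')
  ultimately show ?thesis by (simp add: P_def algebra_simps)
qed

end
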